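(* Assume that the homogeneous subduction algorithm terminates for $A$. Let $f_1,\dots,f_k\in A$ be (non-zero) $\Delta$-homogeneous generators of $A$ as a $K$-algebra. Let $\alpha:K[X_1,\dots,X_k]\to A$, $X_i\mapsto f_i$, and $\beta:K[X_1,\dots,X_k]\to\operatorname{in}_v^\Delta(A)$, $X_i\mapsto\operatorname{in}_v^\Delta(f_i)$, be the corresponding $K$-algebra morphisms, $I=\ker(\alpha)$, $J=\ker(\beta)$, and $\operatorname{in}_\Gamma(I)=\langle\operatorname{in}_\Gamma(h)\mid h\in I\rangle$. The following conditions are equivalent: (i) The morphism $\beta$ is surjective, that is, $\{f_1,\dots,f_k\}$ is a $\Delta$-homogeneous Khovanskii basis of $A$ with respect to $v$. (ii) The ideals $\operatorname{in}_\Gamma(I)$ and $J$ coincide. (iii) For a (i.e. for some) set of generators $\{h_1,\dots,h_s\}$ of $J$ consisting of polynomials that are both $\Gamma$-homogeneous and $\Delta$-homogeneous, the homogeneous subduction algorithm terminates with remainder $0$ on input $h_i(f_1,\dots,f_k)$ and $\{f_1,\dots,f_k\}$, for every $1\le i\le s$.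
   Context: $K$ is a field; $A\le B$ are finitely generated commutative $K$-algebras and domains ($A$ a $K$-subalgebra of $B$). $(\Gamma,+,\succeq)$ is a linearly ordered abelian group (total order with $\gamma_1\succeq\gamma_2\Rightarrow\gamma_1+\gamma_3\succeq\gamma_2+\gamma_3$). $v:B\setminus\{0\}\to\Gamma$ is a valuation over $K$: $v(f+g)\succeq\min\{v(f),v(g)\}$ whenever $f,g,f+g\ne0$; $v(fg)=v(f)+v(g)$ for $f,g\neq 0$; $v(\lambda f)=v(f)$ for $0\ne\lambda\in K$, $f\neq0$. For $\gamma\in\Gamma$ let $F_{v\succeq\gamma}=\{f\in B\setminus\{0\}\mid v(f)\succeq\gamma\}\cup\{0\}$, similarly $F_{v\succ\gamma}$, and $\operatorname{gr}_v(B)=\bigoplus_{\gamma\in\Gamma}F_{v\succeq\gamma}/F_{v\succ\gamma}$ (associated graded algebra). For $0\ne f\in B$ with $v(f)=\gamma$, $\operatorname{in}_v(f)$ is the class of $f$ in $F_{v\succeq\gamma}/F_{v\succ\gamma}$. $A$ is graded by a finitely generated abelian group $\Delta$, with degree function $\deg_\Delta$. For $\Delta$-homogeneous $0\neq f\in A$ of degree $\delta$ put $\operatorname{in}_v^\Delta(f)=\operatorname{in}_v(f)\otimes\delta\in\operatorname{gr}_v(B)\otimes_KK\Delta$, where $K\Delta$ is the group ring. For $S\subseteq A$, $\operatorname{in}_v^\Delta(S)\le\operatorname{gr}_v(B)\otimes_KK\Delta$ is the $K$-subalgebra generated by all $\operatorname{in}_v^\Delta(f)$ with $0\ne f\in S$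 $\Delta$-homogeneous. A set $\mathcal G\subseteq A$ of $\Delta$-homogeneous $K$-algebra generators of $A$ is a $\Delta$-homogeneous Khovanskii basis of $A$ with respect to $v$ if $\{\operatorname{in}_v^\Delta(f)\mid f\in\mathcal G\}$ generates $\operatorname{in}_v^\Delta(A)$ as a $K$-algebra. Given $f_1,\dots,f_k$, the ring $K[X_1,\dots,X_k]$ is graded by $\Delta$ via $\deg_\Delta(X_i)=\deg_\Delta(f_i)$ and by $\Gamma$ via $\deg_\Gamma(X_i)=v(f_i)$. For a polynomial $h$, $\operatorname{in}_\Gamma(h)$ is the sum of the terms of $h$ of minimal $\Gamma$-degree (with respect to $\succeq$), and $\operatorname{Supp}(h)$ is the set of non-zero terms of $h$. Homogeneous subduction algorithm. Input: a $\Delta$-homogeneous $f\in A$ and a (possibly infinite) set $\mathcal G\subseteq A$ of (non-zero) $\Delta$-homogeneous elements. Polynomials live in $K[X_g\mid g\in\mathcal G]$. Initialize $\mathcal G'=\emptyset$, $h=0$, $r=f$. While $r\neq0$ and $\operatorname{in}_v^\Delta(r)\in\operatorname{in}_v^\Delta(\mathcal G)$: choose a finite subset $\{f_1,\dots,f_k\}\subseteq\mathcal G$ and a polynomial $h'\in K[X_{f_1},\dots,X_{f_k}]$ with $h'(\operatorname{in}_v^\Delta(f_1),\dots,\operatorname{in}_v^\Delta(f_k))=\operatorname{in}_v^\Delta(r)$ and with $v(t(f_1,\dots,f_k))\succeq v(r)$ and $\deg_\Delta(t(f_1,\dots,f_k))=\deg_\Delta(r)$ for every $t\in\operatorname{Supp}(h')$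 (such a choice always exists; it is made by an arbitrary but fixed rule); then replace $\mathcal G'$ by $\mathcal G'\cup\{f_1,\dots,f_k\}$, $r$ by $r-h'(f_1,\dots,f_k)$, and $h$ by $h+h'$. When the loop ends, return $\mathcal G'$, $h$ and the remainder $r$. The algorithm "terminates for $A$" if it terminates after finitely many steps for every $\Delta$-homogeneous $f\in A$ and every set $\mathcal G\subseteq A$ of $\Delta$-homogeneous elements. *)

theory Defs
  imports
    "HOL-Algebra.QuotRing"
    "HOL-Algebra.Module"
    "HOL-Algebra.Subrings"
    "HOL-Library.Poly_Mapping"
    "HOL-Library.While_Combinator"
    "HOL-Computational_Algebra.Group_Closure"
begin

section \<open>Algebras over a field\<close>

text \<open>
  The base field is a type \<open>'k\<close>, and the domain \<open>B\<close> is a type \<open>'b\<close> together with a scalar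
  multiplication. Algebras whose carrier depends on the valuation are records of
  \<^theory>\<open>HOL-Algebra.Module\<close> with scalars ranging over all of \<open>'k\<close>.
\<close>

locale K_algebra = vector_space scale
  for scale :: "'k::field \<Rightarrow> 'b::comm_ring_1 \<Rightarrow> 'b" +
  assumes scale_mult_left: "scale c x * y = scale c (x * y)"

definition class_algebra :: "('k \<Rightarrow> 'b \<Rightarrow> 'b) \<Rightarrow> ('k::field, 'b::comm_ring_1) module"
  where "class_algebra scale =
    \<lparr>carrier = UNIV, mult = (*), one = 1, zero = 0, add = (+), smult = scale\<rparr>"

definition K_subalgebra :: "('k::field, 'c, 'z) module_scheme \<Rightarrow> 'c set \<Rightarrow> bool"
  where "K_subalgebra T C \<longleftrightarrow> subring C T \<and> (\<forall>c. \<forall>x\<in>C. c \<odot>\<^bsub>T\<^esub> x \<in> C)"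

definition generated_algebra :: "('k::field, 'c, 'z) module_scheme \<Rightarrow> 'c set \<Rightarrow> 'c set"
  where "generated_algebra T S = \<Inter>{C. K_subalgebra T C \<and> S \<subseteq> C}"

definition fg_algebra :: "('k::field, 'c, 'z) module_scheme \<Rightarrow> 'c set \<Rightarrow> bool"
  where "fg_algebra T C \<longleftrightarrow>
    K_subalgebra T C \<and> (\<exists>S. finite S \<and> S \<subseteq> C \<and> generated_algebra T S = C)"


section \<open>Polynomials\<close>

text \<open>
  A monomial is a finitely supported exponent function on the indeterminates, which are the
  elements of an arbitrary type \<open>'x\<close>; a polynomial is a finitely supported function on monomials.
\<close>

type_synonym ('x, 'k) mpoly = "('x \<Rightarrow>\<^sub>0 nat) \<Rightarrow>\<^sub>0 'k"

definition mpoly_ring :: "'x set \<Rightarrow> ('x, 'k::field) mpoly ring"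
  where "mpoly_ring V =
    \<lparr>carrier = {p. \<forall>t\<in>Poly_Mapping.keys p. Poly_Mapping.keys t \<subseteq> V},
     mult = (*), one = 1, zero = 0, add = (+)\<rparr>"

definition mpoly_eval ::
    "('k::field, 'c, 'z) module_scheme \<Rightarrow> ('x \<Rightarrow> 'c) \<Rightarrow> ('x, 'k) mpoly \<Rightarrow> 'c"
  where "mpoly_eval T \<sigma> p =
    (\<Oplus>\<^bsub>T\<^esub>t\<in>Poly_Mapping.keys p. Poly_Mapping.lookup p t \<odot>\<^bsub>T\<^esub>
      (\<Otimes>\<^bsub>T\<^esub>x\<in>Poly_Mapping.keys t. \<sigma> x [^]\<^bsub>T\<^esub> Poly_Mapping.lookup t x))"

definition monomial_degree :: "('x \<Rightarrow> 'w::comm_monoid_add) \<Rightarrow> ('x \<Rightarrow>\<^sub>0 nat) \<Rightarrow> 'w"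
  where "monomial_degree w t = (\<Sum>x\<in>Poly_Mapping.keys t. \<Sum>_<Poly_Mapping.lookup t x. w x)"

definition homogeneous_poly :: "('x \<Rightarrow> 'w::comm_monoid_add) \<Rightarrow> ('x, 'k::field) mpoly \<Rightarrow> bool"
  where "homogeneous_poly w p \<longleftrightarrow> (\<exists>d. \<forall>t\<in>Poly_Mapping.keys p. monomial_degree w t = d)"

definition initial_poly ::
    "('x \<Rightarrow> 'w::linordered_ab_group_add) \<Rightarrow> ('x, 'k::field) mpoly \<Rightarrow> ('x, 'k) mpoly"
  where "initial_poly w p =
    (\<Sum>t | t \<in> Poly_Mapping.keys p \<and>
           (\<forall>s\<in>Poly_Mapping.keys p. monomial_degree w t \<le> monomial_degree w s).
       Poly_Mapping.single t (Poly_Mapping.lookup p t))"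


section \<open>Gradings\<close>

definition fg_group :: "'d::ab_group_add itself \<Rightarrow> bool"
  where "fg_group _ \<longleftrightarrow> (\<exists>S :: 'd set. finite S \<and> group_closure S = UNIV)"

definition is_grading ::
    "('k::field \<Rightarrow> 'b::comm_ring_1 \<Rightarrow> 'b) \<Rightarrow> 'b set \<Rightarrow> ('d::ab_group_add \<Rightarrow> 'b set) \<Rightarrow> bool"
  where "is_grading scale A grd \<longleftrightarrow>
    (\<forall>\<delta>. module.subspace scale (grd \<delta>) \<and> grd \<delta> \<subseteq> A) \<and>
    (\<forall>a\<in>A. \<exists>!c :: 'd \<Rightarrow>\<^sub>0 'b. (\<forall>\<delta>. Poly_Mapping.lookup c \<delta> \<in> grd \<delta>) \<and>
      a = (\<Sum>\<delta>\<in>Poly_Mapping.keys c. Poly_Mapping.lookup c \<delta>)) \<and>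
    (\<forall>\<delta> \<epsilon>. \<forall>a\<in>grd \<delta>. \<forall>b\<in>grd \<epsilon>. a * b \<in> grd (\<delta> + \<epsilon>))"

definition homogeneous :: "('d \<Rightarrow> 'b set) \<Rightarrow> 'b \<Rightarrow> bool"
  where "homogeneous grd a \<longleftrightarrow> (\<exists>\<delta>. a \<in> grd \<delta>)"

text \<open>Only meaningful for non-zero homogeneous elements.\<close>

definition hdegree :: "('d \<Rightarrow> 'b set) \<Rightarrow> 'b \<Rightarrow> 'd"
  where "hdegree grd a = (THE \<delta>. a \<in> grd \<delta>)"


section \<open>Valuations and the associated graded algebra\<close>

text \<open>The value \<open>v 0\<close> is irrelevant throughout.\<close>

definition is_valuation ::
    "('k::field \<Rightarrow> 'b::idom \<Rightarrow> 'b) \<Rightarrow> ('b \<Rightarrow> 'g::linordered_ab_group_add) \<Rightarrow> bool"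
  where "is_valuation scale v \<longleftrightarrow>
    (\<forall>f g. f \<noteq> 0 \<longrightarrow> g \<noteq> 0 \<longrightarrow> f + g \<noteq> 0 \<longrightarrow> v (f + g) \<ge> min (v f) (v g)) \<and>
    (\<forall>f g. f \<noteq> 0 \<longrightarrow> g \<noteq> 0 \<longrightarrow> v (f * g) = v f + v g) \<and>
    (\<forall>c f. c \<noteq> 0 \<longrightarrow> f \<noteq> 0 \<longrightarrow> v (scale c f) = v f)"

definition F_ge :: "('b::idom \<Rightarrow> 'g::linordered_ab_group_add) \<Rightarrow> 'g \<Rightarrow> 'b set"
  where "F_ge v \<gamma> = {f. f \<noteq> 0 \<and> v f \<ge> \<gamma>} \<union> {0}"

definition F_gt :: "('b::idom \<Rightarrow> 'g::linordered_ab_group_add) \<Rightarrow> 'g \<Rightarrow> 'b set"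
  where "F_gt v \<gamma> = {f. f \<noteq> 0 \<and> v f > \<gamma>} \<union> {0}"

definition gr_class :: "('b::idom \<Rightarrow> 'g::linordered_ab_group_add) \<Rightarrow> 'g \<Rightarrow> 'b \<Rightarrow> 'b set"
  where "gr_class v \<gamma> f = {g. f - g \<in> F_gt v \<gamma>}"

text \<open>
  An element of the direct sum of the quotients \<open>F_ge v \<gamma> / F_gt v \<gamma>\<close> is a function sending
  \<open>\<gamma>\<close> to a coset in \<open>F_ge v \<gamma>\<close>, equal to the zero coset \<open>F_gt v \<gamma>\<close> for almost all \<open>\<gamma>\<close>.
  The product extends bilinearly the multiplication of classes, (class of \<open>f\<close> in degree \<open>\<alpha>\<close>) times
  (class of \<open>g\<close> in degree \<open>\<beta>\<close>) = class of \<open>f * g\<close> in degree \<open>\<alpha> + \<beta>\<close>. To compute it, choose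
  finitely supported families \<open>p\<close>, \<open>q\<close> of representatives: the coefficient in degree \<open>\<gamma>\<close> of
  their convolution product is the sum of all \<open>p\<^sub>\<alpha> * q\<^sub>\<beta>\<close> with \<open>\<alpha> + \<beta> = \<gamma>\<close>, and its class
  does not depend on the choice; so the union over all choices is this one coset.
\<close>

definition gr_algebra ::
    "('k::field \<Rightarrow> 'b::idom \<Rightarrow> 'b) \<Rightarrow> ('b \<Rightarrow> 'g::linordered_ab_group_add) \<Rightarrow>
      ('k, 'g \<Rightarrow> 'b set) module"
  where "gr_algebra scale v =
    \<lparr>carrier = {x. (\<forall>\<gamma>. x \<gamma> \<in> F_ge v \<gamma> // {(f, g). f - g \<in> F_gt v \<gamma>}) \<and>
                   finite {\<gamma>. x \<gamma> \<noteq> F_gt v \<gamma>}},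
     mult = (\<lambda>x y \<gamma>. \<Union>{gr_class v \<gamma> (Poly_Mapping.lookup (p * q) \<gamma>) | p q :: 'g \<Rightarrow>\<^sub>0 'b.
                       (\<forall>\<alpha>. Poly_Mapping.lookup p \<alpha> \<in> x \<alpha>) \<and> (\<forall>\<beta>. Poly_Mapping.lookup q \<beta> \<in> y \<beta>)}),
     one = (\<lambda>\<gamma>. if \<gamma> = 0 then gr_class v 0 1 else F_gt v \<gamma>),
     zero = F_gt v,
     add = (\<lambda>x y \<gamma>. {f + g | f g. f \<in> x \<gamma> \<and> g \<in> y \<gamma>}),
     smult = (\<lambda>c x \<gamma>. \<Union>{gr_class v \<gamma> (scale c f) | f. f \<in> x \<gamma>})\<rparr>"

definition initial_form :: "('b::idom \<Rightarrow> 'g::linordered_ab_group_add) \<Rightarrow> 'b \<Rightarrow> ('g \<Rightarrow> 'b set)"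
  where "initial_form v f = (\<lambda>\<gamma>. if \<gamma> = v f then gr_class v \<gamma> f else F_gt v \<gamma>)"


section \<open>Tensor products of algebras and group algebras\<close>

text \<open>
  The vector space with basis the carrier of a monoid \<open>G\<close>, with the multiplication extending
  that of \<open>G\<close> bilinearly.
\<close>

definition monoid_algebra :: "('m, 'z) monoid_scheme \<Rightarrow> ('m \<Rightarrow>\<^sub>0 'k::field) ring"
  where "monoid_algebra G =
    \<lparr>carrier = {p. Poly_Mapping.keys p \<subseteq> carrier G},
     mult = (\<lambda>p q. \<Sum>a\<in>Poly_Mapping.keys p. \<Sum>b\<in>Poly_Mapping.keys q.
               Poly_Mapping.single (a \<otimes>\<^bsub>G\<^esub> b) (Poly_Mapping.lookup p a * Poly_Mapping.lookup q b)),
     one = Poly_Mapping.single \<one>\<^bsub>G\<^esub> 1, zero = 0, add = (+)\<rparr>"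

text \<open>
  The tensor product is the free vector space on pairs modulo the bilinearity relations.
  The span of the relations is an ideal for the product \<open>(m, n)(m', n') = (m m', n n')\<close>, so it
  is the ideal generated by the relations.
\<close>

definition free_pairs ::
    "('k::field, 'm, 'y) module_scheme \<Rightarrow> ('k, 'n, 'z) module_scheme \<Rightarrow> ('m \<times> 'n \<Rightarrow>\<^sub>0 'k) ring"
  where "free_pairs M N = monoid_algebra (M \<times>\<times> N)"

definition bilinearity_relations ::
    "('k::field, 'm, 'y) module_scheme \<Rightarrow> ('k, 'n, 'z) module_scheme \<Rightarrow> ('m \<times> 'n \<Rightarrow>\<^sub>0 'k) set"
  where "bilinearity_relations M N =
    {Poly_Mapping.single (m \<oplus>\<^bsub>M\<^esub> m', n) 1 - Poly_Mapping.single (m, n) 1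
        - Poly_Mapping.single (m', n) 1
      | m m' n. m \<in> carrier M \<and> m' \<in> carrier M \<and> n \<in> carrier N} \<union>
    {Poly_Mapping.single (m, n \<oplus>\<^bsub>N\<^esub> n') 1 - Poly_Mapping.single (m, n) 1
        - Poly_Mapping.single (m, n') 1
      | m n n'. m \<in> carrier M \<and> n \<in> carrier N \<and> n' \<in> carrier N} \<union>
    {Poly_Mapping.single (c \<odot>\<^bsub>M\<^esub> m, n) 1 - Poly_Mapping.single (m, n) c
      | c m n. m \<in> carrier M \<and> n \<in> carrier N} \<union>
    {Poly_Mapping.single (m, c \<odot>\<^bsub>N\<^esub> n) 1 - Poly_Mapping.single (m, n) c
      | c m n. m \<in> carrier M \<and> n \<in> carrier N}"

definition tensor_ideal ::
    "('k::field, 'm, 'y) module_scheme \<Rightarrow> ('k, 'n, 'z) module_scheme \<Rightarrow> ('m \<times> 'n \<Rightarrow>\<^sub>0 'k) set"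
  where "tensor_ideal M N = Idl\<^bsub>free_pairs M N\<^esub> (bilinearity_relations M N)"

definition tensor_algebra ::
    "('k::field, 'm, 'y) module_scheme \<Rightarrow> ('k, 'n, 'z) module_scheme \<Rightarrow>
      ('k, ('m \<times> 'n \<Rightarrow>\<^sub>0 'k) set) module"
  where "tensor_algebra M N =
    (let R = free_pairs M N; I = tensor_ideal M N; Q = R Quot I in
     \<lparr>carrier = carrier Q, mult = mult Q, one = one Q, zero = zero Q, add = add Q,
      smult = (\<lambda>c X. (I +>\<^bsub>R\<^esub> Poly_Mapping.single (\<one>\<^bsub>M\<^esub>, \<one>\<^bsub>N\<^esub>) c) \<otimes>\<^bsub>Q\<^esub> X)\<rparr>)"

definition pure_tensor ::
    "('k::field, 'm, 'y) module_scheme \<Rightarrow> ('k, 'n, 'z) module_scheme \<Rightarrow> 'm \<Rightarrow> 'n \<Rightarrow>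
      ('m \<times> 'n \<Rightarrow>\<^sub>0 'k) set"
  where "pure_tensor M N m n = tensor_ideal M N +>\<^bsub>free_pairs M N\<^esub> Poly_Mapping.single (m, n) 1"

text \<open>
  The group ring of \<open>'d\<close> is \<open>'d \<Rightarrow>\<^sub>0 'k\<close> with convolution; \<open>\<delta>\<close> corresponds to
  \<open>Poly_Mapping.single \<delta> 1\<close>.
\<close>

definition group_algebra :: "('k::field, 'd::ab_group_add \<Rightarrow>\<^sub>0 'k) module"
  where "group_algebra = class_algebra (\<lambda>c. Poly_Mapping.map ((*) c))"

type_synonym ('g, 'b, 'd, 'k) gr_tensor = "(('g \<Rightarrow> 'b set) \<times> ('d \<Rightarrow>\<^sub>0 'k) \<Rightarrow>\<^sub>0 'k) set"

definition gr_tensor_algebra ::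
    "('k::field \<Rightarrow> 'b::idom \<Rightarrow> 'b) \<Rightarrow> ('b \<Rightarrow> 'g::linordered_ab_group_add) \<Rightarrow>
      ('k, ('g, 'b, 'd::ab_group_add, 'k) gr_tensor) module"
  where "gr_tensor_algebra scale v = tensor_algebra (gr_algebra scale v) group_algebra"


section \<open>Homogeneous initial algebras and Khovanskii bases\<close>

definition initial_form_hom ::
    "('k::field \<Rightarrow> 'b::idom \<Rightarrow> 'b) \<Rightarrow> ('b \<Rightarrow> 'g::linordered_ab_group_add) \<Rightarrow>
      ('d::ab_group_add \<Rightarrow> 'b set) \<Rightarrow> 'b \<Rightarrow> ('g, 'b, 'd, 'k) gr_tensor"
  where "initial_form_hom scale v grd f =
    pure_tensor (gr_algebra scale v) group_algebra
      (initial_form v f) (Poly_Mapping.single (hdegree grd f) 1)"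

definition initial_algebra ::
    "('k::field \<Rightarrow> 'b::idom \<Rightarrow> 'b) \<Rightarrow> ('b \<Rightarrow> 'g::linordered_ab_group_add) \<Rightarrow>
      ('d::ab_group_add \<Rightarrow> 'b set) \<Rightarrow> 'b set \<Rightarrow> ('g, 'b, 'd, 'k) gr_tensor set"
  where "initial_algebra scale v grd S =
    generated_algebra (gr_tensor_algebra scale v)
      {initial_form_hom scale v grd f | f. f \<in> S \<and> f \<noteq> 0 \<and> homogeneous grd f}"

definition khovanskii_basis ::
    "('k::field \<Rightarrow> 'b::idom \<Rightarrow> 'b) \<Rightarrow> ('b \<Rightarrow> 'g::linordered_ab_group_add) \<Rightarrow>
      ('d::ab_group_add \<Rightarrow> 'b set) \<Rightarrow> 'b set \<Rightarrow> 'b set \<Rightarrow> bool"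
  where "khovanskii_basis scale v grd A G \<longleftrightarrow>
    G \<subseteq> A \<and> (\<forall>g\<in>G. homogeneous grd g) \<and>
    generated_algebra (class_algebra scale) G = A \<and>
    generated_algebra (gr_tensor_algebra scale v) (initial_form_hom scale v grd ` (G - {0})) =
      initial_algebra scale v grd A"


section \<open>The homogeneous subduction algorithm\<close>

text \<open>
  The indeterminate \<open>X\<^sub>g\<close> is indexed by the element \<open>g\<close> itself. A state is a triple
  \<open>(G', h, r)\<close>. A rule sees the input \<open>f\<close>, \<open>G\<close> and the current state, and returns the finite
  subset \<open>{f\<^sub>1, \<dots>, f\<^sub>k}\<close> together with the polynomial \<open>h'\<close>.
\<close>

type_synonym ('b, 'k) subduction_state = "'b set \<times> ('b, 'k) mpoly \<times> 'b"

type_synonym ('b, 'k) subduction_rule =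
  "'b \<Rightarrow> 'b set \<Rightarrow> ('b, 'k) subduction_state \<Rightarrow> 'b set \<times> ('b, 'k) mpoly"

definition subduction_input :: "'b::idom set \<Rightarrow> ('d \<Rightarrow> 'b set) \<Rightarrow> 'b \<Rightarrow> 'b set \<Rightarrow> bool"
  where "subduction_input A grd f G \<longleftrightarrow>
    f \<in> A \<and> homogeneous grd f \<and> G \<subseteq> A \<and> (\<forall>g\<in>G. g \<noteq> 0 \<and> homogeneous grd g)"

definition subduction_continues ::
    "('k::field \<Rightarrow> 'b::idom \<Rightarrow> 'b) \<Rightarrow> ('b \<Rightarrow> 'g::linordered_ab_group_add) \<Rightarrow>
      ('d::ab_group_add \<Rightarrow> 'b set) \<Rightarrow> 'b set \<Rightarrow> 'b \<Rightarrow> bool"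
  where "subduction_continues scale v grd G r \<longleftrightarrow>
    r \<noteq> 0 \<and> initial_form_hom scale v grd r \<in> initial_algebra scale v grd G"

definition valid_choice ::
    "('k::field \<Rightarrow> 'b::idom \<Rightarrow> 'b) \<Rightarrow> ('b \<Rightarrow> 'g::linordered_ab_group_add) \<Rightarrow>
      ('d::ab_group_add \<Rightarrow> 'b set) \<Rightarrow> 'b set \<Rightarrow> 'b \<Rightarrow> 'b set \<Rightarrow> ('b, 'k) mpoly \<Rightarrow> bool"
  where "valid_choice scale v grd G r F h' \<longleftrightarrow>
    finite F \<and> F \<subseteq> G \<and> h' \<in> carrier (mpoly_ring F) \<and>
    mpoly_eval (gr_tensor_algebra scale v) (initial_form_hom scale v grd) h' =
      initial_form_hom scale v grd r \<and>
    (\<forall>t\<in>Poly_Mapping.keys h'.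
      let b = mpoly_eval (class_algebra scale) (\<lambda>g. g)
                (Poly_Mapping.single t (Poly_Mapping.lookup h' t))
      in v b \<ge> v r \<and> hdegree grd b = hdegree grd r)"

definition valid_rule ::
    "('k::field \<Rightarrow> 'b::idom \<Rightarrow> 'b) \<Rightarrow> ('b \<Rightarrow> 'g::linordered_ab_group_add) \<Rightarrow>
      'b set \<Rightarrow> ('d::ab_group_add \<Rightarrow> 'b set) \<Rightarrow> ('b, 'k) subduction_rule \<Rightarrow> bool"
  where "valid_rule scale v A grd \<rho> \<longleftrightarrow>
    (\<forall>f G G' h r. subduction_input A grd f G \<and> r \<in> A \<and> homogeneous grd r \<and>
       subduction_continues scale v grd G r \<longrightarrow>
       (case \<rho> f G (G', h, r) of (F, h') \<Rightarrow> valid_choice scale v grd G r F h'))"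

definition subduction_step ::
    "('k::field \<Rightarrow> 'b::idom \<Rightarrow> 'b) \<Rightarrow> ('b, 'k) subduction_rule \<Rightarrow> 'b \<Rightarrow> 'b set \<Rightarrow>
      ('b, 'k) subduction_state \<Rightarrow> ('b, 'k) subduction_state"
  where "subduction_step scale \<rho> f G = (\<lambda>(G', h, r).
    case \<rho> f G (G', h, r) of (F, h') \<Rightarrow>
      (G' \<union> F, h + h', r - mpoly_eval (class_algebra scale) (\<lambda>g. g) h'))"

text \<open>The result is \<open>None\<close> if the loop runs forever.\<close>

definition subduction ::
    "('k::field \<Rightarrow> 'b::idom \<Rightarrow> 'b) \<Rightarrow> ('b \<Rightarrow> 'g::linordered_ab_group_add) \<Rightarrow>
      ('d::ab_group_add \<Rightarrow> 'b set) \<Rightarrow> ('b, 'k) subduction_rule \<Rightarrow> 'b \<Rightarrow> 'b set \<Rightarrow>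
      ('b, 'k) subduction_state option"
  where "subduction scale v grd \<rho> f G =
    while_option (\<lambda>(G', h, r). subduction_continues scale v grd G r)
      (subduction_step scale \<rho> f G) ({}, 0, f)"

definition subduction_terminates ::
    "('k::field \<Rightarrow> 'b::idom \<Rightarrow> 'b) \<Rightarrow> ('b \<Rightarrow> 'g::linordered_ab_group_add) \<Rightarrow>
      'b set \<Rightarrow> ('d::ab_group_add \<Rightarrow> 'b set) \<Rightarrow> ('b, 'k) subduction_rule \<Rightarrow> bool"
  where "subduction_terminates scale v A grd \<rho> \<longleftrightarrow>
    (\<forall>f G. subduction_input A grd f G \<longrightarrow> subduction scale v grd \<rho> f G \<noteq> None)"

end

theory Submission
  imports Defs "HOL-Computational_Algebra.Polynomial"
begin

text \<open>
  A bihomogeneous element of \<open>gr_v(B) \<otimes> K\<Delta>\<close> is the class of some \<open>b\<close> in a quotient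
  \<open>F_ge v \<gamma> / F_gt v \<gamma>\<close>, labelled by \<open>\<delta>\<close>; hence a polynomial lies in \<open>J\<close> iff each of its
  bihomogeneous parts, of \<open>\<Gamma>\<close>-degree \<open>\<gamma>\<close> say, is mapped by \<open>\<alpha>\<close> to an element of value \<open>> \<gamma>\<close>.
  In particular \<open>in_\<Gamma>(I) \<subseteq> J\<close>. If subduction of \<open>\<alpha>(h)\<close> ends with remainder \<open>0\<close> for a
  bihomogeneous \<open>h \<in> J\<close>, the polynomials subtracted along the way have \<open>\<Gamma>\<close>-degree above that of
  \<open>h\<close>, so \<open>h\<close> is the initial form of a relation. If \<open>\<beta>\<close> is surjective, the remainder is always
  \<open>0\<close>. The finite generating set in (iii) exists by Hilbert's basis theorem.

  For (ii) \<open>\<Longrightarrow>\<close> (i) write \<open>a = \<alpha>(h)\<close> with \<open>h\<close> of largest possible initial degree. Such an \<open>h\<close>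
  exists because of the termination hypothesis: if \<open>z\<close> had \<open>\<Delta>\<close>-degree \<open>0\<close> and positive value,
  subduction of \<open>z\<close> by \<open>z - z\<^sup>2\<close> would not terminate, so by Dickson's lemma the values of the
  monomials of a given \<open>\<Delta>\<close>-degree contain no infinite strictly increasing sequence.
\<close>

section \<open>Polynomials and monomials\<close>

text \<open>\<open>\<Gamma>\<close> is an arbitrary linearly ordered group, and the values of
  elements are not known to be well-ordered in either direction. Every well-foundedness argument
  therefore takes place on monomials in finitely many variables, where Dickson's lemma applies: for
  the leading monomials behind the finite basis, for the lexicographic descent, and for the weights
  within one \<open>\<Delta>\<close>-degree. The tensor product is a quotient by a generated ideal,
  so non-vanishing cannot be read off directly. It is detected by an ideal containing the relations
  and given by explicit conditions on coefficients, \<open>vanishing\<close>. The element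
  \<open>z - z^2 = z (1 - z)\<close> combines two properties: \<open>1 - z\<close> has initial form
  1, so the initial form of \<open>z\<close> is kept, while polynomials in \<open>X - X^2\<close>
  have even degree, so \<open>X\<close> is not among them. The finite bihomogeneous basis rests on
  an auxiliary lexicographic order that has nothing to do with the values: cutting a polynomial down
  to the bidegree of its leading monomial keeps that leading monomial.\<close>

lemma poly_mapping_sum_single:
  assumes "finite S" "Poly_Mapping.keys p \<subseteq> S"
  shows "p = (\<Sum>t\<in>S. Poly_Mapping.single t (Poly_Mapping.lookup p t))"
proof (rule poly_mapping_eqI)
  fix k
  have "Poly_Mapping.lookup (\<Sum>t\<in>S. Poly_Mapping.single t (Poly_Mapping.lookup p t)) k
    = (\<Sum>t\<in>S. if t = k then Poly_Mapping.lookup p t else 0)"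
    by (auto simp: lookup_sum lookup_single when_def intro!: sum.cong)
  also have "\<dots> = Poly_Mapping.lookup p k"
    using assms by (auto simp: sum.delta' in_keys_iff)
  finally show "Poly_Mapping.lookup p k =
    Poly_Mapping.lookup (\<Sum>t\<in>S. Poly_Mapping.single t (Poly_Mapping.lookup p t)) k" ..
qed

text \<open>In a group \<open>\<alpha> + \<beta> = \<gamma>\<close> determines
  \<open>\<beta>\<close>, so the double sum of the convolution collapses. This serves both families
  indexed by \<open>\<Gamma>\<close> and the group ring of \<open>\<Delta>\<close>.\<close>

lemma lookup_mult_group:
  fixes p q :: "'a::ab_group_add \<Rightarrow>\<^sub>0 'b::semiring_0"
  assumes "finite S" "Poly_Mapping.keys p \<subseteq> S"
  shows "Poly_Mapping.lookup (p * q) \<gamma> = (\<Sum>\<alpha>\<in>S. Poly_Mapping.lookup p \<alpha> * Poly_Mapping.lookup q (\<gamma> - \<alpha>))"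
proof -
  have *: "(\<gamma> = \<alpha> + \<beta>) = (\<beta> = \<gamma> - \<alpha>)" for \<alpha> \<beta> by (auto simp: algebra_simps)
  have "Poly_Mapping.lookup (p * q) \<gamma> = Sum_any (\<lambda>\<alpha>. Poly_Mapping.lookup p \<alpha> * Poly_Mapping.lookup q (\<gamma> - \<alpha>))"
    by (simp add: lookup_mult *)
  also have "\<dots> = (\<Sum>\<alpha>\<in>S. Poly_Mapping.lookup p \<alpha> * Poly_Mapping.lookup q (\<gamma> - \<alpha>))"
  proof (rule Sum_any.expand_superset[OF assms(1)])
    show "{a. Poly_Mapping.lookup p a * Poly_Mapping.lookup q (\<gamma> - a) \<noteq> 0} \<subseteq> S"
      using assms(2) by (auto simp: in_keys_iff dest!: subsetD)
  qed
  finally show ?thesis .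
qed

lemma lookup_single_mult:
  fixes q :: "('x \<Rightarrow>\<^sub>0 nat) \<Rightarrow>\<^sub>0 'b::comm_ring_1"
  shows "Poly_Mapping.lookup (Poly_Mapping.single u c * q) (u + s) = c * Poly_Mapping.lookup q s"
proof -
  have "Poly_Mapping.single u c * q = (\<Sum>t\<in>Poly_Mapping.keys q. Poly_Mapping.single (u + t) (c * Poly_Mapping.lookup q t))"
    by (subst poly_mapping_sum_single[of "Poly_Mapping.keys q" q])
      (auto simp: sum_distrib_left mult_single)
  then have "Poly_Mapping.lookup (Poly_Mapping.single u c * q) (u + s) =
      (\<Sum>t\<in>Poly_Mapping.keys q. if t = s then c * Poly_Mapping.lookup q t else 0)"
    by (auto simp: lookup_sum lookup_single when_def intro!: sum.cong)
  then show ?thesis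
    by (auto simp: in_keys_iff)
qed

lemma keys_single_mult_subset:
  fixes q :: "('x \<Rightarrow>\<^sub>0 nat) \<Rightarrow>\<^sub>0 'b::comm_ring_1"
  shows "Poly_Mapping.keys (Poly_Mapping.single u c * q) \<subseteq> (+) u ` Poly_Mapping.keys q"
  using keys_mult[of "Poly_Mapping.single u c" q] by (auto split: if_splits)

lemma keys_add_nat:
  fixes s t :: "'x \<Rightarrow>\<^sub>0 nat"
  shows "Poly_Mapping.keys (s + t) = Poly_Mapping.keys s \<union> Poly_Mapping.keys t"
  by (auto simp: in_keys_iff lookup_add)

lemma poly_mapping_nat_le:
  fixes s t :: "'x \<Rightarrow>\<^sub>0 nat"
  assumes "\<And>x. Poly_Mapping.lookup s x \<le> Poly_Mapping.lookup t x"
  shows "t = s + (t - s)"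
  by (rule poly_mapping_eqI) (simp add: lookup_add lookup_minus assms)

text \<open>The order is lexicographic: at the first place where \<open>x\<close> and 0 differ,
  \<open>x < 0\<close> would ask for a natural number below 0. Hence a monomial never exceeds its
  multiples.\<close>

lemma poly_mapping_nat_nonneg: "0 \<le> (x :: 'x::linorder \<Rightarrow>\<^sub>0 nat)"
proof -
  have "\<not> x < 0"
    by transfer (simp add: less_fun_def)
  then show ?thesis by simp
qed

subsection \<open>Dickson's lemma\<close>

lemma nat_increasing_subsequence:
  fixes s :: "nat \<Rightarrow> nat"
  shows "\<exists>\<phi> :: nat \<Rightarrow> nat. strict_mono \<phi> \<and> mono (s \<circ> \<phi>)"
proof -
  \<comment> \<open>\<open>Q n i\<close> says that over the indices beyond \<open>n\<close> the
    sequence attains its minimum at \<open>i\<close>. Iterating this choice gives a non-decreasing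
    subsequence, because every later index still lies beyond the earlier \<open>n\<close>.\<close>
  define Q where "Q n i \<longleftrightarrow> n < i \<and> (\<forall>j>n. s i \<le> s j)" for n i
  have ex: "\<exists>i. Q n i" for n
  proof -
    have "\<exists>i. n < i \<and> (\<forall>j. n < j \<longrightarrow> s i \<le> s j)"
      using ex_has_least_nat[of "\<lambda>i. n < i" "Suc n" s] by auto
    then show ?thesis by (auto simp: Q_def)
  qed
  define \<phi> where "\<phi> = rec_nat (SOME i. Q 0 i) (\<lambda>_ n. SOME i. Q n i)"
  have step: "Q (\<phi> n) (\<phi> (Suc n))" for n
    unfolding \<phi>_def using someI_ex[OF ex] by simp
  have lt: "\<phi> n < \<phi> (Suc n)" for n using step[of n] by (auto simp: Q_def)
  then have sm: "strict_mono \<phi>" by (rule strict_mono_Suc_iff[THEN iffD2, rule_format])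
  have "s (\<phi> n) \<le> s (\<phi> (Suc n))" for n
  proof (cases n)
    case 0
    have "Q 0 (\<phi> 0)" unfolding \<phi>_def using someI_ex[OF ex] by simp
    then show ?thesis using lt[of 0] 0 unfolding Q_def by (metis gr_zeroI le_zero_eq less_nat_zero_code not_less)
  next
    case (Suc m)
    then show ?thesis using step[of m] lt[of n] lt[of m] unfolding Q_def by (metis less_trans)
  qed
  then have "mono (s \<circ> \<phi>)" by (auto simp: mono_iff_le_Suc)
  with sm show ?thesis by blast
qed

text \<open>Coordinates are treated one after the other: passing to a further subsequence keeps the
  monotonicity already achieved.\<close>

lemma increasing_subsequence_on:
  fixes s :: "nat \<Rightarrow> 'x \<Rightarrow> nat"
  assumes "finite V"
  shows "\<exists>\<phi> :: nat \<Rightarrow> nat. strict_mono \<phi> \<and> (\<forall>x\<in>V. mono (\<lambda>n. s (\<phi> n) x))"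
  using assms
proof induction
  case empty
  then show ?case by (intro exI[of _ id]) (simp add: strict_mono_def)
next
  case (insert x V)
  then obtain \<phi> :: "nat \<Rightarrow> nat" where \<phi>: "strict_mono \<phi>" "\<forall>x\<in>V. mono (\<lambda>n. s (\<phi> n) x)" by blast
  obtain \<psi> :: "nat \<Rightarrow> nat" where \<psi>: "strict_mono \<psi>" "mono ((\<lambda>n. s (\<phi> n) x) \<circ> \<psi>)"
    using nat_increasing_subsequence by blast
  have "strict_mono (\<phi> \<circ> \<psi>)" using \<phi>(1) \<psi>(1) by (rule strict_mono_o)
  moreover have "mono (\<lambda>n. s ((\<phi> \<circ> \<psi>) n) y)" if "y \<in> insert x V" for y
  proof (cases "y = x")
    case True then show ?thesis using \<psi>(2) by (simp add: comp_def)
  next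
    case False
    then have "mono (\<lambda>n. s (\<phi> n) y)" using that \<phi>(2) by auto
    then show ?thesis using strict_mono_mono[OF \<psi>(1)] by (auto simp: mono_def)
  qed
  ultimately show ?case by blast
qed

text \<open>Along a subsequence that is non-decreasing in every coordinate of \<open>V\<close>, each
  member divides the next; outside \<open>V\<close> all exponents are 0.\<close>

lemma dickson:
  fixes t :: "nat \<Rightarrow> 'x \<Rightarrow>\<^sub>0 nat"
  assumes "finite V" "\<And>n. Poly_Mapping.keys (t n) \<subseteq> V"
  shows "\<exists>i j u. i < j \<and> t j = t i + u"
proof -
  obtain \<phi> :: "nat \<Rightarrow> nat" where \<phi>: "strict_mono \<phi>" "\<forall>x\<in>V. mono (\<lambda>n. Poly_Mapping.lookup (t (\<phi> n)) x)"
    using increasing_subsequence_on[OF assms(1), of "\<lambda>n. Poly_Mapping.lookup (t n)"] by blast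
  have "Poly_Mapping.lookup (t (\<phi> 0)) x \<le> Poly_Mapping.lookup (t (\<phi> 1)) x" for x
  proof (cases "x \<in> V")
    case True then show ?thesis using \<phi>(2) by (auto simp: mono_def)
  next
    case False
    then have "x \<notin> Poly_Mapping.keys (t (\<phi> 0))" using assms(2) by auto
    then show ?thesis by (simp add: in_keys_iff)
  qed
  then have "t (\<phi> 1) = t (\<phi> 0) + (t (\<phi> 1) - t (\<phi> 0))" by (rule poly_mapping_nat_le)
  moreover have "\<phi> 0 < \<phi> 1" using \<phi>(1) by (simp add: strict_mono_def)
  ultimately show ?thesis by blast
qed

text \<open>Otherwise elements of \<open>M\<close> divisible by none of the earlier ones could be
  picked forever, against \<open>dickson\<close>.\<close>

lemma finite_divisibility_basis:
  fixes M :: "('x::linorder \<Rightarrow>\<^sub>0 nat) set"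
  assumes "finite V" "\<And>m. m \<in> M \<Longrightarrow> Poly_Mapping.keys m \<subseteq> V"
  shows "\<exists>N. finite N \<and> N \<subseteq> M \<and> (\<forall>m\<in>M. \<exists>n\<in>N. \<exists>u. m = n + u)"
  (is ?Q)
proof (rule ccontr)
  assume no: "\<not> ?Q"
  have step: "\<exists>m. m \<in> M \<and> (\<forall>n\<in>N. \<forall>u. m \<noteq> n + u)" if "finite N" "N \<subseteq> M" for N
  proof (rule ccontr)
    assume "\<not> ?thesis"
    then have "\<forall>m\<in>M. \<exists>n\<in>N. \<exists>u. m = n + u" by simp
    with that have ?Q by (intro exI[of _ N] conjI)
    with no show False ..
  qed
  define pick where "pick N = (SOME m. m \<in> M \<and> (\<forall>n\<in>N. \<forall>u. m \<noteq> n + u))" for N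
  \<comment> \<open>\<open>S n\<close> collects the first \<open>n\<close> picks, so that
    \<open>pick (S j)\<close> avoids all multiples of \<open>pick (S i)\<close> for
    \<open>i < j\<close>.\<close>
  define S where "S = rec_nat {} (\<lambda>_ N. insert (pick N) N)"
  have S: "finite (S n) \<and> S n \<subseteq> M" for n
  proof (induction n)
    case 0 then show ?case by (simp add: S_def)
  next
    case (Suc n)
    then show ?case using someI_ex[OF step, of "S n"] by (simp add: S_def pick_def)
  qed
  have p: "pick (S n) \<in> M \<and> (\<forall>m\<in>S n. \<forall>u. pick (S n) \<noteq> m + u)" for n
    using someI_ex[OF step, of "S n"] S[of n] by (simp add: pick_def)
  have mono: "S i \<subseteq> S j" if "i \<le> j" for i j
    using that by (rule lift_Suc_mono_le[rotated]) (auto simp: S_def)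
  obtain i j u where "i < j" "pick (S j) = pick (S i) + u"
    using dickson[of V "\<lambda>n. pick (S n)"] assms p by blast
  moreover have "pick (S i) \<in> S (Suc i)" by (simp add: S_def)
  then have "pick (S i) \<in> S j" using mono[of "Suc i" j] \<open>i < j\<close> by auto
  ultimately show False using p by blast
qed

text \<open>In a descending chain \<open>dickson\<close> finds an earlier member dividing a later
  one, and a divisor is never larger. Finiteness of \<open>V\<close> matters: with infinitely many
  variables the lexicographic order allows \<open>X_0 > X_1 > X_2 > ...\<close>.\<close>

lemma wfp_less_on_monomials:
  fixes V :: "'x::linorder set"
  assumes "finite V"
  shows "wf {(s, t :: 'x \<Rightarrow>\<^sub>0 nat). s < t \<and> Poly_Mapping.keys s \<subseteq> V \<and> Poly_Mapping.keys t \<subseteq> V}"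
proof (subst wf_iff_no_infinite_down_chain, rule notI, elim exE)
  fix t :: "nat \<Rightarrow> 'x \<Rightarrow>\<^sub>0 nat"
  assume t: "\<forall>i. (t (Suc i), t i) \<in> {(s, t). s < t \<and> Poly_Mapping.keys s \<subseteq> V \<and> Poly_Mapping.keys t \<subseteq> V}"
  then obtain i j u where ij: "i < j" "t j = t i + u"
    using dickson[OF assms, of t] by auto
  have "t n < t m" if "m < n" for m n
    using that
  proof (induction n)
    case (Suc n)
    have "t (Suc n) < t n" using t by auto
    then show ?case using Suc by (cases "m = n") auto
  qed simp
  then have "t j < t i" using ij(1) .
  moreover have "t i \<le> t j" unfolding ij(2) using poly_mapping_nat_nonneg[of u] by (simp add: add_increasing2)
  ultimately show False by simp
qed

subsection \<open>The polynomial ring and its ideals\<close>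

lemma mpoly_ring_simps [simp]:
  "p \<otimes>\<^bsub>mpoly_ring V\<^esub> q = p * q" "\<one>\<^bsub>mpoly_ring V\<^esub> = 1"
  "\<zero>\<^bsub>mpoly_ring V\<^esub> = 0" "p \<oplus>\<^bsub>mpoly_ring V\<^esub> q = p + q"
  by (simp_all add: mpoly_ring_def)

lemma mem_mpoly_ring: "p \<in> carrier (mpoly_ring V) \<longleftrightarrow> (\<forall>t\<in>Poly_Mapping.keys p. Poly_Mapping.keys t \<subseteq> V)"
  by (simp add: mpoly_ring_def)

lemma mpoly_ring_closed:
  assumes "p \<in> carrier (mpoly_ring V)" "q \<in> carrier (mpoly_ring V)"
  shows "p + q \<in> carrier (mpoly_ring V)" "p - q \<in> carrier (mpoly_ring V)"
    "p * q \<in> carrier (mpoly_ring V)" "- p \<in> carrier (mpoly_ring V)"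
proof -
  show "p + q \<in> carrier (mpoly_ring V)" using keys_add[of p q] assms by (auto simp: mem_mpoly_ring dest!: subsetD)
  have "Poly_Mapping.keys (-p) = Poly_Mapping.keys p" by (auto simp: in_keys_iff)
  then show "- p \<in> carrier (mpoly_ring V)" using assms by (auto simp: mem_mpoly_ring)
  have "Poly_Mapping.keys (p - q) \<subseteq> Poly_Mapping.keys p \<union> Poly_Mapping.keys q" by (auto simp: in_keys_iff lookup_minus)
  then show "p - q \<in> carrier (mpoly_ring V)" using assms by (auto simp: mem_mpoly_ring dest!: subsetD)
  show "p * q \<in> carrier (mpoly_ring V)" using keys_mult[of p q] assms
    unfolding mem_mpoly_ring by (fastforce simp: keys_add_nat)
qed

lemma mpoly_ring_single:
  "Poly_Mapping.keys t \<subseteq> V \<Longrightarrow> Poly_Mapping.single t c \<in> carrier (mpoly_ring V)"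
  by (simp add: mem_mpoly_ring)

lemma mpoly_ring_zero: "0 \<in> carrier (mpoly_ring V)"
  by (simp add: mem_mpoly_ring)

lemma mpoly_ring_one: "1 \<in> carrier (mpoly_ring V)"
  by (simp add: mem_mpoly_ring)

lemma mpoly_ring_sum:
  "(\<And>i. i \<in> S \<Longrightarrow> p i \<in> carrier (mpoly_ring V)) \<Longrightarrow> (\<Sum>i\<in>S. p i) \<in> carrier (mpoly_ring V)"
  by (induction S rule: infinite_finite_induct) (auto simp: mpoly_ring_zero mpoly_ring_closed(1))

lemma cring_mpoly_ring: "cring (mpoly_ring V :: ('x, 'k::field) mpoly ring)"
proof (rule cringI)
  show "abelian_group (mpoly_ring V :: ('x, 'k) mpoly ring)"
  proof (rule abelian_groupI)
    fix x :: "('x, 'k) mpoly" assume "x \<in> carrier (mpoly_ring V)"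
    then show "\<exists>y\<in>carrier (mpoly_ring V). y \<oplus>\<^bsub>mpoly_ring V\<^esub> x = \<zero>\<^bsub>mpoly_ring V\<^esub>"
      by (intro bexI[of _ "-x"]) (auto simp: mpoly_ring_closed(4))
  qed (auto simp: mpoly_ring_closed mpoly_ring_zero algebra_simps)
  show "comm_monoid (mpoly_ring V :: ('x, 'k) mpoly ring)"
    by (rule comm_monoidI) (auto simp: mpoly_ring_closed algebra_simps mpoly_ring_one)
qed (auto simp: algebra_simps)

text \<open>Closure under multiplication by single terms suffices, since every polynomial is a
  finite sum of terms; additive inverses come from the constant -1.\<close>

lemma ideal_mpoly_ringI:
  assumes "Z \<subseteq> carrier (mpoly_ring V)" "0 \<in> Z" "\<And>p q. p \<in> Z \<Longrightarrow> q \<in> Z \<Longrightarrow> p + q \<in> Z"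
    and "\<And>t c p. Poly_Mapping.keys t \<subseteq> V \<Longrightarrow> p \<in> Z \<Longrightarrow> Poly_Mapping.single t c * p \<in> Z"
  shows "ideal Z (mpoly_ring V :: ('x, 'k::field) mpoly ring)"
proof -
  interpret cring "mpoly_ring V :: ('x, 'k) mpoly ring" by (rule cring_mpoly_ring)
  have sum: "(\<Sum>i\<in>S. g i) \<in> Z" if "\<And>i. i \<in> S \<Longrightarrow> g i \<in> Z" for S and g :: "('x \<Rightarrow>\<^sub>0 nat) \<Rightarrow> ('x, 'k) mpoly"
    using that by (induction S rule: infinite_finite_induct) (auto simp: assms)
  have m: "q * p \<in> Z" if "q \<in> carrier (mpoly_ring V)" "p \<in> Z" for p q
  proof -
    have "q * p = (\<Sum>t\<in>Poly_Mapping.keys q. Poly_Mapping.single t (Poly_Mapping.lookup q t) * p)"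
      by (subst poly_mapping_sum_single[of "Poly_Mapping.keys q" q]) (auto simp: sum_distrib_right)
    also have "\<dots> \<in> Z" using that by (intro sum assms(4)) (auto simp: mem_mpoly_ring)
    finally show ?thesis .
  qed
  have neg: "- p \<in> Z" if "p \<in> Z" for p
    using m[OF _ that, of "-1"] mpoly_ring_closed(4)[of 1] one_closed by auto
  show ?thesis
  proof (rule idealI)
    show "subgroup Z (add_monoid (mpoly_ring V))"
    proof (rule add.subgroupI)
      fix a assume a: "a \<in> Z"
      have "\<ominus>\<^bsub>mpoly_ring V\<^esub> a = - a"
        using a neg[OF a] assms(1) by (intro minus_equality) auto
      then show "\<ominus>\<^bsub>mpoly_ring V\<^esub> a \<in> Z" using neg[OF a] by simp
    qed (use assms in auto)
    show "\<And>a x. a \<in> Z \<Longrightarrow> x \<in> carrier (mpoly_ring V) \<Longrightarrow> x \<otimes>\<^bsub>mpoly_ring V\<^esub> a \<in> Z" using m by simp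
    show "\<And>a x. a \<in> Z \<Longrightarrow> x \<in> carrier (mpoly_ring V) \<Longrightarrow> a \<otimes>\<^bsub>mpoly_ring V\<^esub> x \<in> Z" using m by (metis mpoly_ring_simps(1) mult.commute)
  qed (rule ring_axioms)
qed

lemma ideal_mpoly_ringD:
  assumes "ideal Z (mpoly_ring V :: ('x, 'k::field) mpoly ring)"
  shows "Z \<subseteq> carrier (mpoly_ring V)" "0 \<in> Z"
    and "\<And>p q. p \<in> Z \<Longrightarrow> q \<in> Z \<Longrightarrow> p + q \<in> Z"
    and "\<And>p q. p \<in> Z \<Longrightarrow> q \<in> Z \<Longrightarrow> p - q \<in> Z"
    and "\<And>p q. p \<in> carrier (mpoly_ring V) \<Longrightarrow> q \<in> Z \<Longrightarrow> p * q \<in> Z"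
proof -
  interpret ideal Z "mpoly_ring V :: ('x, 'k) mpoly ring" by fact
  show sub: "Z \<subseteq> carrier (mpoly_ring V)" using a_subset .
  show "0 \<in> Z" using additive_subgroup.zero_closed[OF additive_subgroup_axioms] by simp
  show p: "p + q \<in> Z" if "p \<in> Z" "q \<in> Z" for p q using additive_subgroup.a_closed[OF additive_subgroup_axioms that] by simp
  show m: "p * q \<in> Z" if "p \<in> carrier (mpoly_ring V)" "q \<in> Z" for p q using I_l_closed[OF that(2,1)] by simp
  show "p - q \<in> Z" if "p \<in> Z" "q \<in> Z" for p q
    using p[OF that(1) m[OF mpoly_ring_closed(4)[of 1] that(2)]] one_closed by simp
qed

lemma ideal_sum_mem:
  assumes "ideal Z (mpoly_ring V :: ('x, 'k::field) mpoly ring)" "\<And>i. i \<in> S \<Longrightarrow> g i \<in> Z"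
  shows "(\<Sum>i\<in>S. g i) \<in> Z"
  using assms(2) ideal_mpoly_ringD[OF assms(1)]
  by (induction S rule: infinite_finite_induct) auto

text \<open>Leading monomials refer to the lexicographic order on exponent functions.\<close>

theorem finite_basis_with_leading_monomials:
  fixes J :: "('x::linorder, 'k::field) mpoly set"
  assumes V: "finite V" and J: "ideal J (mpoly_ring V)" and "S \<subseteq> J"
    and lead: "\<And>p. p \<in> J \<Longrightarrow> p \<noteq> 0 \<Longrightarrow>
      \<exists>q\<in>S. q \<noteq> 0 \<and> Max (Poly_Mapping.keys q) = Max (Poly_Mapping.keys p)"
  shows "\<exists>H. finite H \<and> H \<subseteq> S \<and> Idl\<^bsub>mpoly_ring V\<^esub> H = J"
proof -
  let ?P = "mpoly_ring V :: ('x, 'k) mpoly ring"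
  interpret P: cring ?P by (rule cring_mpoly_ring)
  note JD = ideal_mpoly_ringD[OF J]
  define lm where "lm p = Max (Poly_Mapping.keys p)" for p :: "('x, 'k) mpoly"
  have lm_in: "lm p \<in> Poly_Mapping.keys p" if "p \<noteq> 0" for p
    unfolding lm_def using that by (intro Max_in) auto
  have lm_max: "t \<le> lm p" if "t \<in> Poly_Mapping.keys p" for t p
    unfolding lm_def using that by simp
  have lmV: "Poly_Mapping.keys (lm p) \<subseteq> V" if "p \<in> J" "p \<noteq> 0" for p
    using subsetD[OF JD(1) that(1)] lm_in[OF that(2)] unfolding mem_mpoly_ring by (rule bspec)
  \<comment> \<open>Leading monomials are taken from \<open>S\<close>. By \<open>lead\<close> these
    are all the leading monomials of \<open>J\<close>, and the finite set of generators is then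
    found inside \<open>S\<close>.\<close>
  define M where "M = lm ` (S - {0})"
  have MV: "Poly_Mapping.keys m \<subseteq> V" if "m \<in> M" for m
    using that lmV \<open>S \<subseteq> J\<close> unfolding M_def by blast
  obtain N where N: "finite N" "N \<subseteq> M" "\<forall>m\<in>M. \<exists>n\<in>N. \<exists>u. m = n + u"
    using finite_divisibility_basis[OF V MV, of M] by auto
  obtain H where H: "finite H" "H \<subseteq> S - {0}" "N = lm ` H"
    using N(1,2) unfolding M_def by (meson finite_subset_image)
  have HJ: "H \<subseteq> J" using H(2) \<open>S \<subseteq> J\<close> by auto
  have Hc: "H \<subseteq> carrier ?P" using HJ JD(1) by blast
  have idl: "ideal (Idl\<^bsub>?P\<^esub> H) ?P" by (rule P.genideal_ideal[OF Hc])
  note ID = ideal_mpoly_ringD[OF idl]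
  have "J \<subseteq> Idl\<^bsub>?P\<^esub> H"
  proof (rule ccontr)
    assume "\<not> J \<subseteq> Idl\<^bsub>?P\<^esub> H"
    then obtain p0 where p0: "p0 \<in> J - Idl\<^bsub>?P\<^esub> H" by blast
    \<comment> \<open>A counterexample with smallest leading monomial; cancelling its leading term
      will yield a smaller one.\<close>
    obtain m where m: "m \<in> lm ` (J - Idl\<^bsub>?P\<^esub> H)"
      and min: "\<And>s. (s, m) \<in> {(s, t). s < t \<and> Poly_Mapping.keys s \<subseteq> V \<and> Poly_Mapping.keys t \<subseteq> V}
        \<Longrightarrow> s \<notin> lm ` (J - Idl\<^bsub>?P\<^esub> H)"
      using wfE_min[OF wfp_less_on_monomials[OF V], of "lm p0" "lm ` (J - Idl\<^bsub>?P\<^esub> H)"] p0 by blast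
    obtain p where p: "p \<in> J" "p \<notin> Idl\<^bsub>?P\<^esub> H" "m = lm p" using m by blast
    have pn: "p \<noteq> 0" using p(2) ID(2) by auto
    have "lm p \<in> M" using lead[OF p(1) pn] unfolding M_def lm_def by (metis DiffI image_eqI singletonD)
    then obtain h u where h: "h \<in> H" and u: "lm p = lm h + u" using N(3) H(3) by blast
    have hn: "h \<noteq> 0" using h H(2) by auto
    \<comment> \<open>The coefficient is chosen so that \<open>s\<close> is a multiple of
      \<open>h\<close> with the same leading term as \<open>p\<close>. As \<open>s\<close> lies in
      both ideals, \<open>p - s\<close> is again a counterexample.\<close>
    define c where "c = Poly_Mapping.lookup p (lm p) / Poly_Mapping.lookup h (lm h)"
    define s where "s = Poly_Mapping.single u c * h"
    have uV: "Poly_Mapping.keys u \<subseteq> V" using lmV[OF p(1) pn] u by (auto simp: keys_add_nat)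
    have sI: "s \<in> Idl\<^bsub>?P\<^esub> H" unfolding s_def
      using ID(5)[OF mpoly_ring_single[OF uV]] P.genideal_self[OF Hc] h by blast
    have sJ: "s \<in> J" unfolding s_def using JD(5)[OF mpoly_ring_single[OF uV]] h HJ by blast
    have d: "p - s \<in> J - Idl\<^bsub>?P\<^esub> H"
      using JD(4)[OF p(1) sJ] ID(3)[of "p - s" s] sI p(2) by auto
    then have dn: "p - s \<noteq> 0" using ID(2) by auto
    have le: "t \<le> lm p" if "t \<in> Poly_Mapping.keys (p - s)" for t
    proof -
      have "t \<in> Poly_Mapping.keys p \<or> t \<in> Poly_Mapping.keys s" using that by (auto simp: in_keys_iff lookup_minus)
      then show ?thesis
      proof
        assume "t \<in> Poly_Mapping.keys s"
        then obtain t' where "t' \<in> Poly_Mapping.keys h" "t = u + t'"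
          unfolding s_def using keys_single_mult_subset by blast
        then show ?thesis using add_left_mono[OF lm_max[of t' h], of u] u by (simp add: add.commute)
      qed (rule lm_max)
    qed
    have "Poly_Mapping.lookup s (lm p) = Poly_Mapping.lookup p (lm p)"
      unfolding s_def u add.commute[of "lm h"] lookup_single_mult
      using lm_in[OF hn] by (simp add: c_def u add.commute in_keys_iff)
    then have "lm p \<notin> Poly_Mapping.keys (p - s)" by (simp add: in_keys_iff lookup_minus)
    then have "lm (p - s) < m" using le[OF lm_in[OF dn]] lm_in[OF dn] p(3) by (metis order_neq_le_trans)
    then show False using min[of "lm (p - s)"] d lmV[OF _ dn] lmV[OF p(1) pn] p(3) by auto
  qed
  moreover have "Idl\<^bsub>?P\<^esub> H \<subseteq> J" using HJ J by (rule P.genideal_minimal[rotated])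
  ultimately show ?thesis using H by (intro exI[of _ H]) auto
qed

lemma mpoly_induct [consumes 1, case_names zero add]:
  fixes p :: "('x, 'k::field) mpoly"
  assumes p: "p \<in> carrier (mpoly_ring V)" and "P 0"
    and step: "\<And>t c p. Poly_Mapping.keys t \<subseteq> V \<Longrightarrow> p \<in> carrier (mpoly_ring V) \<Longrightarrow> P p \<Longrightarrow>
      P (Poly_Mapping.single t c + p)"
  shows "P p"
proof -
  have "P (\<Sum>t\<in>S. Poly_Mapping.single t (Poly_Mapping.lookup p t)) \<and>
      (\<Sum>t\<in>S. Poly_Mapping.single t (Poly_Mapping.lookup p t)) \<in> carrier (mpoly_ring V)"
    if "finite S" "S \<subseteq> Poly_Mapping.keys p" for S
    using that p
    by (induction S)
      (auto simp: \<open>P 0\<close> mpoly_ring_zero mem_mpoly_ring[of p] intro!: step mpoly_ring_closed(1) mpoly_ring_single)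
  from this[of "Poly_Mapping.keys p"] show ?thesis
    using poly_mapping_sum_single[of "Poly_Mapping.keys p" p] by simp
qed

subsection \<open>Selecting the terms of a polynomial\<close>

text \<open>One operator yields initial forms, \<open>\<Delta>\<close>-homogeneous parts and
  bihomogeneous parts, so that their compositions can be compared coefficientwise.\<close>

definition select_terms :: "('a \<Rightarrow> bool) \<Rightarrow> ('a \<Rightarrow>\<^sub>0 'b::zero) \<Rightarrow> ('a \<Rightarrow>\<^sub>0 'b)"
  where "select_terms Q p = Poly_Mapping.mapp (\<lambda>t c. if Q t then c else 0) p"

lemma lookup_select_terms: "Poly_Mapping.lookup (select_terms Q p) t = (if Q t then Poly_Mapping.lookup p t else 0)"
  by (auto simp: select_terms_def lookup_mapp when_def in_keys_iff)

lemma keys_select_terms: "Poly_Mapping.keys (select_terms Q p) = {t \<in> Poly_Mapping.keys p. Q t}"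
  by (auto simp: in_keys_iff lookup_select_terms split: if_splits)

lemma select_terms_add: "select_terms Q (p + q) = select_terms Q p + select_terms Q q"
  for p q :: "'a \<Rightarrow>\<^sub>0 'b::ab_group_add"
  by (rule poly_mapping_eqI) (simp add: lookup_select_terms lookup_add)

lemma select_terms_zero [simp]: "select_terms Q 0 = 0"
  by (rule poly_mapping_eqI) (simp add: lookup_select_terms)

lemma select_terms_mpoly_ring: "p \<in> carrier (mpoly_ring V) \<Longrightarrow> select_terms Q p \<in> carrier (mpoly_ring V)"
  by (simp add: mem_mpoly_ring keys_select_terms)

lemma select_terms_eq_self: "(\<And>t. t \<in> Poly_Mapping.keys p \<Longrightarrow> Q t) \<Longrightarrow> select_terms Q p = p"
  by (rule poly_mapping_eqI) (auto simp: lookup_select_terms in_keys_iff)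

lemma select_terms_cong:
  "(\<And>t. t \<in> Poly_Mapping.keys p \<Longrightarrow> Q t = Q' t) \<Longrightarrow> select_terms Q p = select_terms Q' p"
  by (rule poly_mapping_eqI) (auto simp: lookup_select_terms in_keys_iff)

lemma sum_select_terms:
  fixes p :: "'a \<Rightarrow>\<^sub>0 'b::comm_monoid_add"
  assumes "finite S" "\<phi> ` Poly_Mapping.keys p \<subseteq> S"
  shows "(\<Sum>s\<in>S. select_terms (\<lambda>t. \<phi> t = s) p) = p"
proof (rule poly_mapping_eqI)
  fix t
  show "Poly_Mapping.lookup (\<Sum>s\<in>S. select_terms (\<lambda>t. \<phi> t = s) p) t = Poly_Mapping.lookup p t"
    using assms by (cases "t \<in> Poly_Mapping.keys p") (auto simp: lookup_sum lookup_select_terms in_keys_iff)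
qed

lemma initial_poly_eq_select_terms:
  "initial_poly w p = select_terms (\<lambda>t. \<forall>s\<in>Poly_Mapping.keys p. monomial_degree w t \<le> monomial_degree w s) p"
proof -
  let ?q = "select_terms (\<lambda>t. \<forall>s\<in>Poly_Mapping.keys p. monomial_degree w t \<le> monomial_degree w s) p"
  have "?q = (\<Sum>t\<in>Poly_Mapping.keys ?q. Poly_Mapping.single t (Poly_Mapping.lookup ?q t))"
    by (rule poly_mapping_sum_single) auto
  also have "\<dots> = initial_poly w p" unfolding initial_poly_def
    by (rule sum.cong) (auto simp: keys_select_terms lookup_select_terms)
  finally show ?thesis ..
qed

section \<open>Degrees of monomials and induction over monomials\<close>

lemma monomial_degree_superset:
  assumes "finite S" "Poly_Mapping.keys t \<subseteq> S"
  shows "monomial_degree w t = (\<Sum>x\<in>S. \<Sum>_<Poly_Mapping.lookup t x. w x)"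
  unfolding monomial_degree_def using assms
  by (intro sum.mono_neutral_left) (auto simp: in_keys_iff)

lemma monomial_degree_add:
  fixes w :: "'a \<Rightarrow> 'b::comm_monoid_add"
  shows "monomial_degree w (s + t) = monomial_degree w s + monomial_degree w t"
proof -
  let ?S = "Poly_Mapping.keys s \<union> Poly_Mapping.keys t"
  have *: "(\<Sum>_<a + b. c) = (\<Sum>_<a. c) + (\<Sum>_<b. c)" for a b :: nat and c :: 'b
    by (induction b) (simp_all add: add.assoc)
  show ?thesis
    by (simp add: monomial_degree_superset[of ?S s] monomial_degree_superset[of ?S t]
        monomial_degree_superset[of ?S "s + t"] keys_add_nat lookup_add * sum.distrib)
qed

lemma monomial_degree_zero [simp]: "monomial_degree w 0 = 0"
  by (simp add: monomial_degree_def)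

lemma monomial_degree_single: "monomial_degree w (Poly_Mapping.single x n) = (\<Sum>_<n. w x)"
  by (simp add: monomial_degree_superset[of "{x}"])

lemma poly_mapping_nat_induct [consumes 1, case_names zero add]:
  fixes t :: "'x \<Rightarrow>\<^sub>0 nat"
  assumes "Poly_Mapping.keys t \<subseteq> V" "P 0"
    and step: "\<And>x t. x \<in> V \<Longrightarrow> Poly_Mapping.keys t \<subseteq> V \<Longrightarrow> P t \<Longrightarrow> P (Poly_Mapping.single x 1 + t)"
  shows "P t"
proof -
  have *: "P (Poly_Mapping.single x n + s)"
    if "x \<in> V" "Poly_Mapping.keys s \<subseteq> V" "P s" for x n s
  proof (induction n)
    case 0 then show ?case using that by simp
  next
    case (Suc n)
    have "Poly_Mapping.single x (Suc n) + s = Poly_Mapping.single x 1 + (Poly_Mapping.single x n + s)"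
      by (simp add: single_add[symmetric] add.assoc[symmetric])
    moreover have "Poly_Mapping.keys (Poly_Mapping.single x n + s) \<subseteq> V"
      using that by (auto simp: keys_add_nat)
    ultimately show ?case using step[OF that(1) _ Suc] by simp
  qed
  have "P (\<Sum>x\<in>S. Poly_Mapping.single x (Poly_Mapping.lookup t x)) \<and>
      Poly_Mapping.keys (\<Sum>x\<in>S. Poly_Mapping.single x (Poly_Mapping.lookup t x)) \<subseteq> V"
    if "finite S" "S \<subseteq> V" for S
    using that
    by (induction S) (auto simp: assms(2) keys_add_nat intro!: *)
  from this[of "Poly_Mapping.keys t"] show ?thesis
    using poly_mapping_sum_single[of "Poly_Mapping.keys t" t] assms(1) by simp
qed

section \<open>Evaluation of polynomials in a commutative algebra\<close>

text \<open>Scalars form the whole type \<open>'k\<close>, as in \<open>K_subalgebra\<close>. Both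
  \<open>B\<close> and the tensor product are instances, so \<open>\<alpha>\<close> and
  \<open>\<beta>\<close> share one theory of evaluation.\<close>

locale record_algebra = cring T for T :: "('k::field, 'c, 'z) module_scheme" (structure) +
  assumes smult_closed [simp]: "x \<in> carrier T \<Longrightarrow> c \<odot> x \<in> carrier T"
    and smult_r_distrib: "x \<in> carrier T \<Longrightarrow> y \<in> carrier T \<Longrightarrow> c \<odot> (x \<oplus> y) = c \<odot> x \<oplus> c \<odot> y"
    and smult_l_distrib: "x \<in> carrier T \<Longrightarrow> (c + d) \<odot> x = c \<odot> x \<oplus> d \<odot> x"
    and smult_assoc: "x \<in> carrier T \<Longrightarrow> (c * d) \<odot> x = c \<odot> (d \<odot> x)"
    and smult_one: "x \<in> carrier T \<Longrightarrow> 1 \<odot> x = x"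
    and smult_mult: "x \<in> carrier T \<Longrightarrow> y \<in> carrier T \<Longrightarrow> (c \<odot> x) \<otimes> y = c \<odot> (x \<otimes> y)"
begin

lemma smult_zero_left: "x \<in> carrier T \<Longrightarrow> 0 \<odot> x = \<zero>"
  using smult_l_distrib[of x 0 0] add.l_cancel_one[of "0 \<odot> x" "0 \<odot> x"] by simp

lemma smult_zero_right: "c \<odot> \<zero> = \<zero>"
  using smult_r_distrib[of \<zero> \<zero> c] add.l_cancel_one[of "c \<odot> \<zero>" "c \<odot> \<zero>"] by simp

definition monomial :: "('x \<Rightarrow> 'c) \<Rightarrow> ('x \<Rightarrow>\<^sub>0 nat) \<Rightarrow> 'c"
  where "monomial \<sigma> t = (\<Otimes>x\<in>Poly_Mapping.keys t. \<sigma> x [^] Poly_Mapping.lookup t x)"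

lemma mpoly_eval_monomial:
  "mpoly_eval T \<sigma> p = (\<Oplus>t\<in>Poly_Mapping.keys p. Poly_Mapping.lookup p t \<odot> monomial \<sigma> t)"
  by (simp add: mpoly_eval_def monomial_def)

text \<open>Only the variables in \<open>V\<close> are required to have images in the carrier:
  outside \<open>V\<close> the generators, and hence their initial forms, are arbitrary.\<close>

context
  fixes \<sigma> :: "'x \<Rightarrow> 'c" and V :: "'x set"
  assumes \<sigma>: "\<And>x. x \<in> V \<Longrightarrow> \<sigma> x \<in> carrier T"
begin

lemma monomial_closed: "Poly_Mapping.keys t \<subseteq> V \<Longrightarrow> monomial \<sigma> t \<in> carrier T"
  unfolding monomial_def using \<sigma> by (intro finprod_closed) auto

lemma monomial_superset:
  assumes "finite S" "S \<subseteq> V" "Poly_Mapping.keys t \<subseteq> S"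
  shows "monomial \<sigma> t = (\<Otimes>x\<in>S. \<sigma> x [^] Poly_Mapping.lookup t x)"
  unfolding monomial_def
  by (rule finprod_mono_neutral_cong_left) (use assms \<sigma> in \<open>auto simp: in_keys_iff\<close>)

lemma monomial_add:
  assumes "Poly_Mapping.keys s \<subseteq> V" "Poly_Mapping.keys t \<subseteq> V"
  shows "monomial \<sigma> (s + t) = monomial \<sigma> s \<otimes> monomial \<sigma> t"
proof -
  let ?S = "Poly_Mapping.keys s \<union> Poly_Mapping.keys t"
  have S: "finite ?S" "?S \<subseteq> V" using assms by auto
  have "(\<Otimes>x\<in>?S. \<sigma> x [^] Poly_Mapping.lookup (s + t) x) =
      (\<Otimes>x\<in>?S. \<sigma> x [^] Poly_Mapping.lookup s x \<otimes> \<sigma> x [^] Poly_Mapping.lookup t x)"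
    by (rule finprod_cong') (use S(2) \<sigma> in \<open>auto simp: lookup_add nat_pow_mult\<close>)
  also have "\<dots> = (\<Otimes>x\<in>?S. \<sigma> x [^] Poly_Mapping.lookup s x) \<otimes> (\<Otimes>x\<in>?S. \<sigma> x [^] Poly_Mapping.lookup t x)"
    by (rule finprod_multf) (use S(2) \<sigma> in auto)
  finally show ?thesis
    using S by (simp add: monomial_superset[of ?S] keys_add_nat)
qed

lemma monomial_zero: "monomial \<sigma> 0 = \<one>"
  by (simp add: monomial_def)

lemma monomial_single: "x \<in> V \<Longrightarrow> monomial \<sigma> (Poly_Mapping.single x 1) = \<sigma> x"
  using \<sigma> by (simp add: monomial_def)

lemma mpoly_eval_superset:
  assumes "finite S" "\<And>t. t \<in> S \<Longrightarrow> Poly_Mapping.keys t \<subseteq> V" "Poly_Mapping.keys p \<subseteq> S"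
  shows "mpoly_eval T \<sigma> p = (\<Oplus>t\<in>S. Poly_Mapping.lookup p t \<odot> monomial \<sigma> t)"
  unfolding mpoly_eval_monomial
  by (rule add.finprod_mono_neutral_cong_left)
    (use assms monomial_closed in \<open>auto simp: in_keys_iff smult_zero_left\<close>)

lemma mpoly_eval_closed: "p \<in> carrier (mpoly_ring V) \<Longrightarrow> mpoly_eval T \<sigma> p \<in> carrier T"
  unfolding mpoly_eval_monomial by (intro finsum_closed) (auto simp: mem_mpoly_ring monomial_closed)

lemma mpoly_eval_zero: "mpoly_eval T \<sigma> 0 = \<zero>"
  by (simp add: mpoly_eval_monomial)

lemma mpoly_eval_add:
  assumes "p \<in> carrier (mpoly_ring V)" "q \<in> carrier (mpoly_ring V)"
  shows "mpoly_eval T \<sigma> (p + q) = mpoly_eval T \<sigma> p \<oplus> mpoly_eval T \<sigma> q"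
proof -
  let ?S = "Poly_Mapping.keys p \<union> Poly_Mapping.keys q"
  have S: "finite ?S" "\<And>t. t \<in> ?S \<Longrightarrow> Poly_Mapping.keys t \<subseteq> V" using assms by (auto simp: mem_mpoly_ring)
  have "(\<Oplus>t\<in>?S. Poly_Mapping.lookup (p + q) t \<odot> monomial \<sigma> t) =
      (\<Oplus>t\<in>?S. Poly_Mapping.lookup p t \<odot> monomial \<sigma> t \<oplus> Poly_Mapping.lookup q t \<odot> monomial \<sigma> t)"
    by (rule finsum_cong') (use S(2) monomial_closed in \<open>auto simp: lookup_add smult_l_distrib\<close>)
  also have "\<dots> = (\<Oplus>t\<in>?S. Poly_Mapping.lookup p t \<odot> monomial \<sigma> t) \<oplus> (\<Oplus>t\<in>?S. Poly_Mapping.lookup q t \<odot> monomial \<sigma> t)"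
    by (rule finsum_addf) (use S(2) monomial_closed in auto)
  finally show ?thesis
    using S mpoly_eval_superset[of ?S] keys_add[of p q] by simp
qed

lemma mpoly_eval_single:
  "Poly_Mapping.keys t \<subseteq> V \<Longrightarrow> mpoly_eval T \<sigma> (Poly_Mapping.single t c) = c \<odot> monomial \<sigma> t"
  using mpoly_eval_superset[of "{t}" "Poly_Mapping.single t c"] monomial_closed[of t] by simp

text \<open>A product with a single term shifts monomials, and the scalars combine by
  \<open>smult_assoc\<close>; general products then follow by additivity.\<close>

lemma mpoly_eval_single_mult:
  assumes t: "Poly_Mapping.keys t \<subseteq> V" and "p \<in> carrier (mpoly_ring V)"
  shows "mpoly_eval T \<sigma> (Poly_Mapping.single t c * p) = c \<odot> (monomial \<sigma> t \<otimes> mpoly_eval T \<sigma> p)"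
  using assms(2)
proof (induction p rule: mpoly_induct)
  case zero
  then show ?case using monomial_closed[OF t] by (simp add: mpoly_eval_zero smult_zero_right)
next
  case (add s d p)
  have *: "Poly_Mapping.keys (t + s) \<subseteq> V" using add(1) t by (simp add: keys_add_nat)
  note c = monomial_closed[OF t] monomial_closed[OF add(1)] mpoly_eval_closed[OF add(2)]
  have m: "monomial \<sigma> t \<otimes> (d \<odot> monomial \<sigma> s) = d \<odot> monomial \<sigma> (t + s)"
    using c t add(1) by (simp add: monomial_add m_comm[of "monomial \<sigma> t"] smult_mult)
  have "mpoly_eval T \<sigma> (Poly_Mapping.single t c * (Poly_Mapping.single s d + p)) =
     mpoly_eval T \<sigma> (Poly_Mapping.single (t + s) (c * d) + Poly_Mapping.single t c * p)"
    by (simp add: distrib_left mult_single)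
  also have "\<dots> = (c * d) \<odot> monomial \<sigma> (t + s) \<oplus> c \<odot> (monomial \<sigma> t \<otimes> mpoly_eval T \<sigma> p)"
    using * by (subst mpoly_eval_add)
      (auto simp: mpoly_eval_single add.IH mpoly_ring_single intro!: mpoly_ring_closed(3) mpoly_ring_single t add)
  also have "\<dots> = c \<odot> (monomial \<sigma> t \<otimes> (d \<odot> monomial \<sigma> s \<oplus> mpoly_eval T \<sigma> p))"
    using c * by (simp add: smult_assoc r_distr m smult_r_distrib monomial_closed)
  finally show ?case using add
    by (simp add: mpoly_eval_add mpoly_ring_single mpoly_eval_single)
qed

lemma mpoly_eval_mult:
  assumes "p \<in> carrier (mpoly_ring V)" and q: "q \<in> carrier (mpoly_ring V)"
  shows "mpoly_eval T \<sigma> (p * q) = mpoly_eval T \<sigma> p \<otimes> mpoly_eval T \<sigma> q"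
  using assms(1)
proof (induction p rule: mpoly_induct)
  case zero
  then show ?case using mpoly_eval_closed[OF q] by (simp add: mpoly_eval_zero)
next
  case (add t c p)
  note cl = monomial_closed[OF add(1)] mpoly_eval_closed[OF add(2)] mpoly_eval_closed[OF q]
  have "mpoly_eval T \<sigma> ((Poly_Mapping.single t c + p) * q) =
     mpoly_eval T \<sigma> (Poly_Mapping.single t c * q) \<oplus> mpoly_eval T \<sigma> (p * q)"
    unfolding distrib_right
    by (rule mpoly_eval_add) (auto intro!: mpoly_ring_closed(3) mpoly_ring_single add q)
  also have "\<dots> = (c \<odot> monomial \<sigma> t \<oplus> mpoly_eval T \<sigma> p) \<otimes> mpoly_eval T \<sigma> q"
    using cl add q by (simp add: mpoly_eval_single_mult l_distr smult_mult)
  finally show ?case using add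
    by (simp add: mpoly_eval_add mpoly_ring_single mpoly_eval_single)
qed

lemma mpoly_eval_smult:
  "p \<in> carrier (mpoly_ring V) \<Longrightarrow> mpoly_eval T \<sigma> (Poly_Mapping.single 0 c * p) = c \<odot> mpoly_eval T \<sigma> p"
  using mpoly_eval_single_mult[of 0 p c] mpoly_eval_closed[of p] by (simp add: monomial_zero)

lemma mpoly_eval_one: "mpoly_eval T \<sigma> 1 = \<one>"
  using mpoly_eval_single[of 0 1] by (simp add: smult_one monomial_zero)

lemma mpoly_eval_var: "x \<in> V \<Longrightarrow> mpoly_eval T \<sigma> (Poly_Mapping.single (Poly_Mapping.single x 1) 1) = \<sigma> x"
  using mpoly_eval_single[of "Poly_Mapping.single x 1" 1] monomial_single[of x] \<sigma>[of x]
  by (simp add: smult_one)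

lemma mpoly_eval_uminus:
  assumes "p \<in> carrier (mpoly_ring V)"
  shows "mpoly_eval T \<sigma> (- p) = \<ominus> mpoly_eval T \<sigma> p"
  using mpoly_eval_add[OF assms mpoly_ring_closed(4)[OF assms assms]] mpoly_eval_closed assms
  by (intro minus_equality[symmetric]) (auto simp: mpoly_eval_zero a_comm mpoly_ring_closed(4))

lemma K_subalgebra_mpoly_eval_image: "K_subalgebra T (mpoly_eval T \<sigma> ` carrier (mpoly_ring V))"
  unfolding K_subalgebra_def
proof (intro conjI allI ballI)
  show "subring (mpoly_eval T \<sigma> ` carrier (mpoly_ring V)) T"
  proof (rule subringI)
    show "\<one> \<in> mpoly_eval T \<sigma> ` carrier (mpoly_ring V)"
      using mpoly_eval_one mpoly_ring_one by (metis image_eqI)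
    fix h assume "h \<in> mpoly_eval T \<sigma> ` carrier (mpoly_ring V)"
    then obtain p where p: "p \<in> carrier (mpoly_ring V)" "h = mpoly_eval T \<sigma> p" by auto
    then show "\<ominus> h \<in> mpoly_eval T \<sigma> ` carrier (mpoly_ring V)"
      by (intro image_eqI[of _ _ "-p"]) (auto simp: mpoly_eval_uminus mpoly_ring_closed(4))
    fix h' assume "h' \<in> mpoly_eval T \<sigma> ` carrier (mpoly_ring V)"
    then obtain q where q: "q \<in> carrier (mpoly_ring V)" "h' = mpoly_eval T \<sigma> q" by auto
    show "h \<otimes> h' \<in> mpoly_eval T \<sigma> ` carrier (mpoly_ring V)"
      using p q by (intro image_eqI[of _ _ "p * q"]) (auto simp: mpoly_eval_mult mpoly_ring_closed(3))
    show "h \<oplus> h' \<in> mpoly_eval T \<sigma> ` carrier (mpoly_ring V)"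
      using p q by (intro image_eqI[of _ _ "p + q"]) (auto simp: mpoly_eval_add mpoly_ring_closed(1))
  qed (auto simp: mpoly_eval_closed)
  fix c x assume "x \<in> mpoly_eval T \<sigma> ` carrier (mpoly_ring V)"
  then obtain p where p: "p \<in> carrier (mpoly_ring V)" "x = mpoly_eval T \<sigma> p" by auto
  then show "c \<odot> x \<in> mpoly_eval T \<sigma> ` carrier (mpoly_ring V)"
    by (intro image_eqI[of _ _ "Poly_Mapping.single 0 c * p"])
      (auto simp: mpoly_eval_smult intro!: mpoly_ring_closed(3) mpoly_ring_single)
qed

lemma mpoly_eval_in_subalgebra:
  assumes C: "K_subalgebra T C" "\<sigma> ` V \<subseteq> C" and "p \<in> carrier (mpoly_ring V)"
  shows "mpoly_eval T \<sigma> p \<in> C"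
proof -
  note S = subringE[of C T] and sm = C(1)[unfolded K_subalgebra_def]
  have mon: "monomial \<sigma> t \<in> C" if "Poly_Mapping.keys t \<subseteq> V" for t
    using that
  proof (induction t rule: poly_mapping_nat_induct)
    case zero
    then show ?case using S sm by (simp add: monomial_zero)
  next
    case (add x t)
    have "monomial \<sigma> (Poly_Mapping.single x 1 + t) = \<sigma> x \<otimes> monomial \<sigma> t"
      using add monomial_add[of "Poly_Mapping.single x 1" t] monomial_single[of x] by simp
    then show ?case using S(6) sm add C(2) by auto
  qed
  from assms(3) show ?thesis
  proof (induction p rule: mpoly_induct)
    case zero
    then show ?case using S sm by (simp add: mpoly_eval_zero)
  next
    case (add t c p)
    then show ?case using mon[OF add(1)] S(7) sm
      by (simp add: mpoly_eval_add mpoly_ring_single mpoly_eval_single)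
  qed
qed

text \<open>The image is a subalgebra, and it is contained in every subalgebra that contains the
  generators. This links surjectivity of \<open>\<beta>\<close> with the generated algebra in
  \<open>khovanskii_basis\<close>.\<close>

lemma mpoly_eval_image: "mpoly_eval T \<sigma> ` carrier (mpoly_ring V) = generated_algebra T (\<sigma> ` V)"
proof -
  have "\<sigma> ` V \<subseteq> mpoly_eval T \<sigma> ` carrier (mpoly_ring V)"
  proof
    fix y assume "y \<in> \<sigma> ` V"
    then obtain x where x: "x \<in> V" "y = \<sigma> x" by auto
    then show "y \<in> mpoly_eval T \<sigma> ` carrier (mpoly_ring V)"
      using mpoly_eval_var[OF x(1)]
      by (intro image_eqI[of _ _ "Poly_Mapping.single (Poly_Mapping.single x 1) 1"]) (auto intro!: mpoly_ring_single)
  qed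
  then show ?thesis
    unfolding generated_algebra_def
    using K_subalgebra_mpoly_eval_image mpoly_eval_in_subalgebra by fast
qed

lemma ideal_kernel_mpoly_eval:
  "ideal (a_kernel (mpoly_ring V) T (mpoly_eval T \<sigma>)) (mpoly_ring V)"
  by (rule ideal_mpoly_ringI)
    (auto simp: a_kernel_def' mpoly_ring_zero mpoly_eval_zero mpoly_eval_add mpoly_ring_closed mpoly_ring_single
      mpoly_eval_single_mult monomial_closed smult_zero_right)

end

end

section \<open>Generated subalgebras, and \<open>B\<close> as an algebra over
  \<open>K\<close>\<close>

lemma generated_algebra_incl: "S \<subseteq> generated_algebra T S"
  unfolding generated_algebra_def by auto

lemma generated_algebra_minimal: "K_subalgebra T C \<Longrightarrow> S \<subseteq> C \<Longrightarrow> generated_algebra T S \<subseteq> C"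
  unfolding generated_algebra_def by auto

lemma class_algebra_simps [simp]:
  "carrier (class_algebra s) = UNIV" "x \<otimes>\<^bsub>class_algebra s\<^esub> y = x * y" "\<one>\<^bsub>class_algebra s\<^esub> = 1"
  "\<zero>\<^bsub>class_algebra s\<^esub> = 0" "x \<oplus>\<^bsub>class_algebra s\<^esub> y = x + y" "c \<odot>\<^bsub>class_algebra s\<^esub> x = s c x"
  by (simp_all add: class_algebra_def)

lemma cring_class_algebra: "cring (class_algebra s)"
proof (rule cringI)
  show "abelian_group (class_algebra s)"
    by (rule abelian_groupI) (auto simp: algebra_simps intro: exI[of _ "- x" for x])
  show "comm_monoid (class_algebra s)"
    by (rule comm_monoidI) (auto simp: algebra_simps)
qed (auto simp: algebra_simps)

context K_algebra
begin

lemma record_algebra_class_algebra: "record_algebra (class_algebra scale)"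
  by (intro record_algebra.intro cring_class_algebra, unfold_locales)
    (auto simp: scale_right_distrib scale_left_distrib scale_mult_left)

lemma mpoly_eval_class_algebra:
  "mpoly_eval (class_algebra scale) \<sigma> p = (\<Sum>t\<in>Poly_Mapping.keys p. scale (Poly_Mapping.lookup p t)
     (\<Prod>x\<in>Poly_Mapping.keys t. \<sigma> x ^ Poly_Mapping.lookup t x))"
proof -
  interpret R: cring "class_algebra scale" by (rule cring_class_algebra)
  have pow: "y [^]\<^bsub>class_algebra scale\<^esub> n = y ^ n" for y and n :: nat
    by (induction n) (auto simp: mult.commute)
  have sum: "(\<Oplus>\<^bsub>class_algebra scale\<^esub>i\<in>S. g i) = sum g S" for g :: "'i \<Rightarrow> _" and S
    by (induction S rule: infinite_finite_induct) auto
  have prod: "(\<Otimes>\<^bsub>class_algebra scale\<^esub>i\<in>S. g i) = prod g S" for g :: "'i \<Rightarrow> _" and S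
    by (induction S rule: infinite_finite_induct) auto
  show ?thesis by (simp add: mpoly_eval_def pow sum prod)
qed

end

section \<open>Monoid algebras and tensor products\<close>

lemma monoid_algebra_mult_superset:
  fixes G :: "('m, 'z) monoid_scheme" and p q :: "'m \<Rightarrow>\<^sub>0 'k::field"
  assumes "finite S" "finite S'" "Poly_Mapping.keys p \<subseteq> S" "Poly_Mapping.keys q \<subseteq> S'"
  shows "p \<otimes>\<^bsub>monoid_algebra G\<^esub> q =
    (\<Sum>a\<in>S. \<Sum>b\<in>S'. Poly_Mapping.single (a \<otimes>\<^bsub>G\<^esub> b) (Poly_Mapping.lookup p a * Poly_Mapping.lookup q b))"
proof -
  have "p \<otimes>\<^bsub>monoid_algebra G\<^esub> q = (\<Sum>a\<in>Poly_Mapping.keys p. \<Sum>b\<in>Poly_Mapping.keys q.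
     Poly_Mapping.single (a \<otimes>\<^bsub>G\<^esub> b) (Poly_Mapping.lookup p a * Poly_Mapping.lookup q b))"
    by (simp add: monoid_algebra_def)
  also have "\<dots> = (\<Sum>a\<in>Poly_Mapping.keys p. \<Sum>b\<in>S'.
     Poly_Mapping.single (a \<otimes>\<^bsub>G\<^esub> b) (Poly_Mapping.lookup p a * Poly_Mapping.lookup q b))"
    using assms by (intro sum.cong sum.mono_neutral_left) (auto simp: in_keys_iff)
  also have "\<dots> = (\<Sum>a\<in>S. \<Sum>b\<in>S'.
     Poly_Mapping.single (a \<otimes>\<^bsub>G\<^esub> b) (Poly_Mapping.lookup p a * Poly_Mapping.lookup q b))"
    using assms by (intro sum.mono_neutral_left) (auto simp: in_keys_iff)
  finally show ?thesis .
qed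

lemma monoid_algebra_distrib:
  fixes G :: "('m, 'z) monoid_scheme" and p q r :: "'m \<Rightarrow>\<^sub>0 'k::field"
  shows "(p + q) \<otimes>\<^bsub>monoid_algebra G\<^esub> r = p \<otimes>\<^bsub>monoid_algebra G\<^esub> r + q \<otimes>\<^bsub>monoid_algebra G\<^esub> r"
    and "r \<otimes>\<^bsub>monoid_algebra G\<^esub> (p + q) = r \<otimes>\<^bsub>monoid_algebra G\<^esub> p + r \<otimes>\<^bsub>monoid_algebra G\<^esub> q"
proof -
  let ?S = "Poly_Mapping.keys p \<union> Poly_Mapping.keys q" and ?R = "Poly_Mapping.keys r"
  have S: "finite ?S" "Poly_Mapping.keys (p + q) \<subseteq> ?S" using keys_add[of p q] by auto
  show "(p + q) \<otimes>\<^bsub>monoid_algebra G\<^esub> r = p \<otimes>\<^bsub>monoid_algebra G\<^esub> r + q \<otimes>\<^bsub>monoid_algebra G\<^esub> r"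
    using S by (simp add: monoid_algebra_mult_superset[of ?S ?R] lookup_add algebra_simps single_add sum.distrib)
  show "r \<otimes>\<^bsub>monoid_algebra G\<^esub> (p + q) = r \<otimes>\<^bsub>monoid_algebra G\<^esub> p + r \<otimes>\<^bsub>monoid_algebra G\<^esub> q"
    using S by (simp add: monoid_algebra_mult_superset[of ?R ?S] lookup_add algebra_simps single_add sum.distrib)
qed

lemma monoid_algebra_single:
  "Poly_Mapping.single a c \<otimes>\<^bsub>monoid_algebra G\<^esub> Poly_Mapping.single b d
    = Poly_Mapping.single (a \<otimes>\<^bsub>G\<^esub> b) (c * d :: 'k::field)"
  by (simp add: monoid_algebra_mult_superset[of "{a}" "{b}"])

lemma monoid_algebra_sum:
  fixes p q :: "'m \<Rightarrow>\<^sub>0 'k::field" and g :: "'i \<Rightarrow> 'm \<Rightarrow>\<^sub>0 'k"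
  shows "(\<Sum>i\<in>S. g i) \<otimes>\<^bsub>monoid_algebra G\<^esub> q = (\<Sum>i\<in>S. g i \<otimes>\<^bsub>monoid_algebra G\<^esub> q)"
    and "p \<otimes>\<^bsub>monoid_algebra G\<^esub> (\<Sum>i\<in>S. g i) = (\<Sum>i\<in>S. p \<otimes>\<^bsub>monoid_algebra G\<^esub> g i)"
proof -
  have z: "0 \<otimes>\<^bsub>monoid_algebra G\<^esub> q = 0" "p \<otimes>\<^bsub>monoid_algebra G\<^esub> 0 = 0"
    by (simp_all add: monoid_algebra_def)
  show "(\<Sum>i\<in>S. g i) \<otimes>\<^bsub>monoid_algebra G\<^esub> q = (\<Sum>i\<in>S. g i \<otimes>\<^bsub>monoid_algebra G\<^esub> q)"
    by (induction S rule: infinite_finite_induct) (auto simp: z monoid_algebra_distrib)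
  show "p \<otimes>\<^bsub>monoid_algebra G\<^esub> (\<Sum>i\<in>S. g i) = (\<Sum>i\<in>S. p \<otimes>\<^bsub>monoid_algebra G\<^esub> g i)"
    by (induction S rule: infinite_finite_induct) (auto simp: z monoid_algebra_distrib)
qed

lemma monoid_algebra_simps:
  "p \<in> carrier (monoid_algebra G) \<longleftrightarrow> Poly_Mapping.keys p \<subseteq> carrier G"
  "\<one>\<^bsub>monoid_algebra G\<^esub> = Poly_Mapping.single \<one>\<^bsub>G\<^esub> 1" "\<zero>\<^bsub>monoid_algebra G\<^esub> = 0"
  "p \<oplus>\<^bsub>monoid_algebra G\<^esub> q = p + q"
  by (simp_all add: monoid_algebra_def)

text \<open>All laws of the product are multilinear, so after expansion into basis elements they
  reduce to the laws of \<open>G\<close>, which apply because supports lie in its carrier.\<close>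

lemma cring_monoid_algebra:
  assumes "comm_monoid G"
  shows "cring (monoid_algebra G :: ('m \<Rightarrow>\<^sub>0 'k::field) ring)"
proof -
  interpret G: comm_monoid G by fact
  let ?R = "monoid_algebra G :: ('m \<Rightarrow>\<^sub>0 'k) ring"
  have expand: "x = (\<Sum>a\<in>Poly_Mapping.keys x. Poly_Mapping.single a (Poly_Mapping.lookup x a))"
    for x :: "'m \<Rightarrow>\<^sub>0 'k"
    by (rule poly_mapping_sum_single) auto
  show ?thesis
  proof (rule cringI)
    show "abelian_group ?R"
    proof (rule abelian_groupI)
      fix x assume x: "x \<in> carrier ?R"
      have "Poly_Mapping.keys (-x) = Poly_Mapping.keys x" by (auto simp: in_keys_iff)
      then show "\<exists>y\<in>carrier ?R. y \<oplus>\<^bsub>?R\<^esub> x = \<zero>\<^bsub>?R\<^esub>"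
        using x by (intro bexI[of _ "-x"]) (auto simp: monoid_algebra_simps)
    qed (use keys_add in \<open>fastforce simp: monoid_algebra_simps algebra_simps\<close>)+
    show "comm_monoid ?R"
    proof (rule comm_monoidI)
      fix x y z assume c: "x \<in> carrier ?R" "y \<in> carrier ?R" "z \<in> carrier ?R"
      show "x \<otimes>\<^bsub>?R\<^esub> y \<in> carrier ?R"
        unfolding monoid_algebra_simps(1)
        by (subst expand[of x], subst expand[of y], unfold monoid_algebra_sum monoid_algebra_single,
            intro order.trans[OF keys_sum] UN_least)
          (use c in \<open>auto simp: monoid_algebra_simps(1)\<close>)
      show "x \<otimes>\<^bsub>?R\<^esub> y \<otimes>\<^bsub>?R\<^esub> z = x \<otimes>\<^bsub>?R\<^esub> (y \<otimes>\<^bsub>?R\<^esub> z)"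
        by (subst (1 2) expand[of x], subst (1 2) expand[of y], subst (1 2) expand[of z],
            unfold monoid_algebra_sum monoid_algebra_single, intro sum.cong refl)
          (use c in \<open>auto simp: monoid_algebra_simps(1) G.m_assoc mult.assoc subset_iff\<close>)
      show "x \<otimes>\<^bsub>?R\<^esub> y = y \<otimes>\<^bsub>?R\<^esub> x"
        by (subst (1 2) expand[of x], subst (1 2) expand[of y],
            unfold monoid_algebra_sum monoid_algebra_single, subst sum.swap, intro sum.cong refl)
          (use c in \<open>auto simp: monoid_algebra_simps(1) G.m_comm mult.commute subset_iff\<close>)
      show "\<one>\<^bsub>?R\<^esub> \<otimes>\<^bsub>?R\<^esub> x = x"
        by (subst (1 2) expand[of x],
            unfold monoid_algebra_simps(2) monoid_algebra_sum monoid_algebra_single, intro sum.cong refl)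
          (use c in \<open>auto simp: monoid_algebra_simps(1) subset_iff\<close>)
    qed (simp add: monoid_algebra_simps)
  qed (simp add: monoid_algebra_simps monoid_algebra_distrib)
qed

text \<open>The free algebra on pairs takes its ring structure from the multiplicative monoids of
  the factors; closure under sums and scalar multiples places the bilinearity relations inside
  it.\<close>

locale tensor_factors =
  fixes M :: "('k::field, 'm, 'y) module_scheme" and N :: "('k, 'n, 'z) module_scheme"
  assumes comm_monoid_M: "comm_monoid M" and comm_monoid_N: "comm_monoid N"
    and closed_M: "\<And>x y. x \<in> carrier M \<Longrightarrow> y \<in> carrier M \<Longrightarrow> x \<oplus>\<^bsub>M\<^esub> y \<in> carrier M"
      "\<And>c x. x \<in> carrier M \<Longrightarrow> c \<odot>\<^bsub>M\<^esub> x \<in> carrier M"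
    and closed_N: "\<And>x y. x \<in> carrier N \<Longrightarrow> y \<in> carrier N \<Longrightarrow> x \<oplus>\<^bsub>N\<^esub> y \<in> carrier N"
      "\<And>c x. x \<in> carrier N \<Longrightarrow> c \<odot>\<^bsub>N\<^esub> x \<in> carrier N"
begin

interpretation M: comm_monoid M by (rule comm_monoid_M)
interpretation N: comm_monoid N by (rule comm_monoid_N)

abbreviation "FP \<equiv> free_pairs M N"
abbreviation "TT \<equiv> tensor_algebra M N"
abbreviation "TI \<equiv> tensor_ideal M N"

lemma cring_free_pairs: "cring FP"
proof -
  have "comm_monoid (M \<times>\<times> N)"
    by (rule comm_monoidI) (auto simp: DirProd_def M.m_ac N.m_ac)
  then show ?thesis unfolding free_pairs_def by (rule cring_monoid_algebra)
qed

interpretation FP: cring FP by (rule cring_free_pairs)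

lemma free_pairs_simps:
  "p \<in> carrier FP \<longleftrightarrow> Poly_Mapping.keys p \<subseteq> carrier M \<times> carrier N"
  "\<one>\<^bsub>FP\<^esub> = Poly_Mapping.single (\<one>\<^bsub>M\<^esub>, \<one>\<^bsub>N\<^esub>) 1" "\<zero>\<^bsub>FP\<^esub> = 0" "p \<oplus>\<^bsub>FP\<^esub> q = p + q"
  by (simp_all add: free_pairs_def monoid_algebra_simps DirProd_def)

lemma free_pairs_single_mult:
  "Poly_Mapping.single (m, n) c \<otimes>\<^bsub>FP\<^esub> Poly_Mapping.single (m', n') d
    = Poly_Mapping.single (m \<otimes>\<^bsub>M\<^esub> m', n \<otimes>\<^bsub>N\<^esub> n') (c * d)"
  by (simp add: free_pairs_def monoid_algebra_single DirProd_def)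

lemma free_pairs_minus: "p \<in> carrier FP \<Longrightarrow> q \<in> carrier FP \<Longrightarrow> p \<ominus>\<^bsub>FP\<^esub> q = p - q"
proof -
  assume p: "p \<in> carrier FP" and q: "q \<in> carrier FP"
  have k: "Poly_Mapping.keys (-q) = Poly_Mapping.keys q" by (auto simp: in_keys_iff)
  have "\<ominus>\<^bsub>FP\<^esub> q = - q"
    using q by (intro FP.minus_equality) (auto simp: free_pairs_simps k)
  then show ?thesis by (simp add: a_minus_def free_pairs_simps)
qed

lemma bilinearity_relations_carrier: "bilinearity_relations M N \<subseteq> carrier FP"
proof -
  have d: "p - q \<in> carrier FP" if "p \<in> carrier FP" "q \<in> carrier FP" for p q
    using FP.minus_closed[OF that] free_pairs_minus[OF that] by simp
  have s: "Poly_Mapping.single (m, n) c \<in> carrier FP" if "m \<in> carrier M" "n \<in> carrier N" for m n c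
    using that by (simp add: free_pairs_simps)
  show ?thesis unfolding bilinearity_relations_def
    by (auto intro!: d s closed_M closed_N)
qed

lemma ideal_tensor_ideal: "ideal TI FP"
  unfolding tensor_ideal_def by (rule FP.genideal_ideal[OF bilinearity_relations_carrier])

interpretation TI: ideal TI FP by (rule ideal_tensor_ideal)

interpretation Q: cring "FP Quot TI" by (rule TI.quotient_is_cring[OF cring_free_pairs])

lemma tensor_algebra_simps:
  "carrier TT = carrier (FP Quot TI)" "X \<otimes>\<^bsub>TT\<^esub> Y = X \<otimes>\<^bsub>FP Quot TI\<^esub> Y" "\<one>\<^bsub>TT\<^esub> = \<one>\<^bsub>FP Quot TI\<^esub>"
  "\<zero>\<^bsub>TT\<^esub> = \<zero>\<^bsub>FP Quot TI\<^esub>" "X \<oplus>\<^bsub>TT\<^esub> Y = X \<oplus>\<^bsub>FP Quot TI\<^esub> Y"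
  "c \<odot>\<^bsub>TT\<^esub> X = (TI +>\<^bsub>FP\<^esub> Poly_Mapping.single (\<one>\<^bsub>M\<^esub>, \<one>\<^bsub>N\<^esub>) c) \<otimes>\<^bsub>FP Quot TI\<^esub> X"
  by (simp_all add: tensor_algebra_def Let_def)

lemma coset_carrier: "p \<in> carrier FP \<Longrightarrow> TI +>\<^bsub>FP\<^esub> p \<in> carrier TT"
  unfolding tensor_algebra_simps
  by (rule ring_hom_closed[OF TI.rcos_ring_hom])

lemma coset_add: "p \<in> carrier FP \<Longrightarrow> q \<in> carrier FP \<Longrightarrow>
    (TI +>\<^bsub>FP\<^esub> p) \<oplus>\<^bsub>TT\<^esub> (TI +>\<^bsub>FP\<^esub> q) = TI +>\<^bsub>FP\<^esub> (p + q)"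
  unfolding tensor_algebra_simps
  using ring_hom_add[OF TI.rcos_ring_hom, of p q] by (simp add: free_pairs_simps(4))

lemma coset_mult: "p \<in> carrier FP \<Longrightarrow> q \<in> carrier FP \<Longrightarrow>
    (TI +>\<^bsub>FP\<^esub> p) \<otimes>\<^bsub>TT\<^esub> (TI +>\<^bsub>FP\<^esub> q) = TI +>\<^bsub>FP\<^esub> (p \<otimes>\<^bsub>FP\<^esub> q)"
  unfolding tensor_algebra_simps using ring_hom_mult[OF TI.rcos_ring_hom] by simp

lemma coset_one: "\<one>\<^bsub>TT\<^esub> = TI +>\<^bsub>FP\<^esub> Poly_Mapping.single (\<one>\<^bsub>M\<^esub>, \<one>\<^bsub>N\<^esub>) 1"
  unfolding tensor_algebra_simps
  using ring_hom_one[OF TI.rcos_ring_hom] by (simp add: free_pairs_simps)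

lemma coset_zero: "\<zero>\<^bsub>TT\<^esub> = TI" by (simp add: tensor_algebra_simps FactRing_def)

lemma coset_eq: "p \<in> carrier FP \<Longrightarrow> q \<in> carrier FP \<Longrightarrow> p - q \<in> TI \<Longrightarrow> TI +>\<^bsub>FP\<^esub> p = TI +>\<^bsub>FP\<^esub> q"
  using FP.quotient_eq_iff_same_a_r_cos[OF ideal_tensor_ideal, of p q] by (simp add: free_pairs_minus)

lemma coset_eq_zeroD: "p \<in> carrier FP \<Longrightarrow> TI +>\<^bsub>FP\<^esub> p = \<zero>\<^bsub>TT\<^esub> \<Longrightarrow> p \<in> TI"
  unfolding coset_zero using TI.rcos_const_imp_mem by blast

lemma cring_tensor_algebra: "cring TT"
proof (rule cringI)
  show "abelian_group TT"
    by (rule abelian_groupI)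
      (auto simp: tensor_algebra_simps Q.a_ac intro: Q.a_inv_closed Q.l_neg bexI[of _ "\<ominus>\<^bsub>FP Quot TI\<^esub> x" for x])
  show "comm_monoid TT"
    by (rule comm_monoidI) (auto simp: tensor_algebra_simps Q.m_ac)
qed (auto simp: tensor_algebra_simps Q.l_distr)

text \<open>A scalar \<open>c\<close> acts as multiplication by the class of \<open>c\<close> times
  the unit pair, so the scalar laws are instances of the ring laws.\<close>

sublocale tensor: record_algebra "tensor_algebra M N"
proof (intro record_algebra.intro cring_tensor_algebra record_algebra_axioms.intro)
  interpret T: cring TT by (rule cring_tensor_algebra)
  let ?i = "\<lambda>c. TI +>\<^bsub>FP\<^esub> Poly_Mapping.single (\<one>\<^bsub>M\<^esub>, \<one>\<^bsub>N\<^esub>) c"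
  have i: "Poly_Mapping.single (\<one>\<^bsub>M\<^esub>, \<one>\<^bsub>N\<^esub>) c \<in> carrier FP" for c by (simp add: free_pairs_simps)
  have iT: "?i c \<in> carrier TT" for c by (rule coset_carrier[OF i])
  have sm: "c \<odot>\<^bsub>TT\<^esub> X = ?i c \<otimes>\<^bsub>TT\<^esub> X" for c X by (simp add: tensor_algebra_simps)
  fix x y c d assume x: "x \<in> carrier TT"
  show "c \<odot>\<^bsub>TT\<^esub> x \<in> carrier TT" unfolding sm using x iT by simp
  show "(c + d) \<odot>\<^bsub>TT\<^esub> x = c \<odot>\<^bsub>TT\<^esub> x \<oplus>\<^bsub>TT\<^esub> d \<odot>\<^bsub>TT\<^esub> x"
    unfolding sm by (simp add: single_add coset_add[OF i i, symmetric] T.l_distr x iT)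
  show "(c * d) \<odot>\<^bsub>TT\<^esub> x = c \<odot>\<^bsub>TT\<^esub> (d \<odot>\<^bsub>TT\<^esub> x)"
    unfolding sm T.m_assoc[OF iT iT x, symmetric] coset_mult[OF i i] by (simp add: free_pairs_single_mult)
  show "1 \<odot>\<^bsub>TT\<^esub> x = x"
    unfolding sm coset_one[symmetric] using x by simp
  assume y: "y \<in> carrier TT"
  show "c \<odot>\<^bsub>TT\<^esub> (x \<oplus>\<^bsub>TT\<^esub> y) = c \<odot>\<^bsub>TT\<^esub> x \<oplus>\<^bsub>TT\<^esub> c \<odot>\<^bsub>TT\<^esub> y"
    unfolding sm using x y iT by (simp add: T.r_distr)
  show "(c \<odot>\<^bsub>TT\<^esub> x) \<otimes>\<^bsub>TT\<^esub> y = c \<odot>\<^bsub>TT\<^esub> (x \<otimes>\<^bsub>TT\<^esub> y)"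
    unfolding sm using x y iT by (simp add: T.m_assoc)
qed

lemma single_free_pairs: "m \<in> carrier M \<Longrightarrow> n \<in> carrier N \<Longrightarrow> Poly_Mapping.single (m, n) c \<in> carrier FP"
  by (simp add: free_pairs_simps)

lemma pure_tensor_closed: "m \<in> carrier M \<Longrightarrow> n \<in> carrier N \<Longrightarrow> pure_tensor M N m n \<in> carrier TT"
  unfolding pure_tensor_def by (intro coset_carrier single_free_pairs)

lemma pure_tensor_mult:
  "m \<in> carrier M \<Longrightarrow> n \<in> carrier N \<Longrightarrow> m' \<in> carrier M \<Longrightarrow> n' \<in> carrier N \<Longrightarrow>
    pure_tensor M N m n \<otimes>\<^bsub>TT\<^esub> pure_tensor M N m' n' = pure_tensor M N (m \<otimes>\<^bsub>M\<^esub> m') (n \<otimes>\<^bsub>N\<^esub> n')"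
  unfolding pure_tensor_def by (simp add: coset_mult single_free_pairs free_pairs_single_mult)

lemma pure_tensor_add_left:
  assumes "m \<in> carrier M" "m' \<in> carrier M" "n \<in> carrier N"
  shows "pure_tensor M N (m \<oplus>\<^bsub>M\<^esub> m') n = pure_tensor M N m n \<oplus>\<^bsub>TT\<^esub> pure_tensor M N m' n"
proof -
  have "Poly_Mapping.single (m \<oplus>\<^bsub>M\<^esub> m', n) 1 - (Poly_Mapping.single (m, n) 1 + Poly_Mapping.single (m', n) 1) \<in> TI"
    unfolding tensor_ideal_def
    by (intro subsetD[OF FP.genideal_self[OF bilinearity_relations_carrier]])
      (use assms in \<open>force simp: bilinearity_relations_def diff_diff_eq\<close>)
  moreover have "Poly_Mapping.single (m, n) 1 + Poly_Mapping.single (m', n) 1 \<in> carrier FP"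
    using FP.a_closed[OF single_free_pairs single_free_pairs] assms by (simp add: free_pairs_simps(4))
  ultimately show ?thesis
    unfolding pure_tensor_def using assms
    by (simp add: coset_add single_free_pairs) (intro coset_eq single_free_pairs closed_M)
qed

lemma pure_tensor_smult_left:
  assumes "m \<in> carrier M" "n \<in> carrier N"
  shows "c \<odot>\<^bsub>TT\<^esub> pure_tensor M N m n = pure_tensor M N (c \<odot>\<^bsub>M\<^esub> m) n"
proof -
  have "Poly_Mapping.single (c \<odot>\<^bsub>M\<^esub> m, n) 1 - Poly_Mapping.single (m, n) c \<in> TI"
    unfolding tensor_ideal_def
    by (intro subsetD[OF FP.genideal_self[OF bilinearity_relations_carrier]])
      (use assms in \<open>force simp: bilinearity_relations_def\<close>)
  then have "pure_tensor M N (c \<odot>\<^bsub>M\<^esub> m) n = TI +>\<^bsub>FP\<^esub> Poly_Mapping.single (m, n) c"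
    unfolding pure_tensor_def using assms by (intro coset_eq single_free_pairs closed_M)
  also have "\<dots> = c \<odot>\<^bsub>TT\<^esub> pure_tensor M N m n"
    unfolding pure_tensor_def tensor_algebra_simps(6) tensor_algebra_simps(2)[symmetric] using assms
    by (simp add: coset_mult single_free_pairs free_pairs_single_mult)
  finally show ?thesis ..
qed

lemma pure_tensor_one: "pure_tensor M N \<one>\<^bsub>M\<^esub> \<one>\<^bsub>N\<^esub> = \<one>\<^bsub>TT\<^esub>"
  unfolding pure_tensor_def coset_one ..

lemma finsum_pure_tensor:
  assumes "finite S" "\<And>i. i \<in> S \<Longrightarrow> m i \<in> carrier M" "\<And>i. i \<in> S \<Longrightarrow> n i \<in> carrier N"
  shows "(\<Oplus>\<^bsub>TT\<^esub>i\<in>S. pure_tensor M N (m i) (n i)) = TI +>\<^bsub>FP\<^esub> (\<Sum>i\<in>S. Poly_Mapping.single (m i, n i) 1)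
    \<and> (\<Sum>i\<in>S. Poly_Mapping.single (m i, n i) 1) \<in> carrier FP"
  using assms
proof (induction S)
  case empty
  show ?case using TI.a_rcos_const[of 0] TI.additive_subgroup_axioms additive_subgroup.zero_closed[of TI FP]
    by (simp add: coset_zero free_pairs_simps)
next
  case (insert x S)
  then have *: "Poly_Mapping.single (m x, n x) 1 \<in> carrier FP" by (intro single_free_pairs) auto
  have **: "(\<Sum>i\<in>S. Poly_Mapping.single (m i, n i) 1) \<in> carrier FP" using insert by simp
  have "(\<Oplus>\<^bsub>TT\<^esub>i\<in>insert x S. pure_tensor M N (m i) (n i)) =
      pure_tensor M N (m x) (n x) \<oplus>\<^bsub>TT\<^esub> (\<Oplus>\<^bsub>TT\<^esub>i\<in>S. pure_tensor M N (m i) (n i))"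
    using insert by (intro tensor.finsum_insert) (auto intro: pure_tensor_closed)
  then show ?case
    using insert coset_add[OF * **] FP.a_closed[OF * **] pure_tensor_def[of M N "m x" "n x"]
    by (simp add: free_pairs_simps(4))
qed

text \<open>Vanishing in the quotient means membership in the ideal generated by the relations,
  hence in every ideal \<open>Z\<close> containing them. A suitable \<open>Z\<close> turns this into
  a condition that can be checked.\<close>

lemma sum_pure_tensor_eq_zeroD:
  assumes "finite S" "\<And>i. i \<in> S \<Longrightarrow> m i \<in> carrier M" "\<And>i. i \<in> S \<Longrightarrow> n i \<in> carrier N"
    and "(\<Oplus>\<^bsub>TT\<^esub>i\<in>S. pure_tensor M N (m i) (n i)) = \<zero>\<^bsub>TT\<^esub>"
    and "ideal Z FP" "bilinearity_relations M N \<subseteq> Z"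
  shows "(\<Sum>i\<in>S. Poly_Mapping.single (m i, n i) 1) \<in> Z"
proof -
  have "(\<Sum>i\<in>S. Poly_Mapping.single (m i, n i) 1) \<in> TI"
    using finsum_pure_tensor[of S m n] assms(1-4) by (intro coset_eq_zeroD) auto
  then show ?thesis
    unfolding tensor_ideal_def using FP.genideal_minimal[OF assms(5,6)] by blast
qed

end

section \<open>The associated graded algebra\<close>

lemma group_algebra_simps [simp]:
  "carrier (group_algebra :: ('k::field, 'd::ab_group_add \<Rightarrow>\<^sub>0 'k) module) = UNIV"
  "x \<otimes>\<^bsub>(group_algebra :: ('k::field, 'd::ab_group_add \<Rightarrow>\<^sub>0 'k) module)\<^esub> y = x * y"
  "\<one>\<^bsub>(group_algebra :: ('k::field, 'd::ab_group_add \<Rightarrow>\<^sub>0 'k) module)\<^esub> = 1"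
  "x \<oplus>\<^bsub>(group_algebra :: ('k::field, 'd::ab_group_add \<Rightarrow>\<^sub>0 'k) module)\<^esub> y = x + y"
  "c \<odot>\<^bsub>(group_algebra :: ('k::field, 'd::ab_group_add \<Rightarrow>\<^sub>0 'k) module)\<^esub> x = Poly_Mapping.map ((*) c) x"
  by (simp_all add: group_algebra_def)

locale valued_algebra = K_algebra scale
  for scale :: "'k::field \<Rightarrow> 'b::idom \<Rightarrow> 'b" +
  fixes v :: "'b \<Rightarrow> 'g::linordered_ab_group_add"
  assumes valuation: "is_valuation scale v"
begin

section \<open>The filtration of \<open>B\<close> by values\<close>

lemma v_add: "f \<noteq> 0 \<Longrightarrow> g \<noteq> 0 \<Longrightarrow> f + g \<noteq> 0 \<Longrightarrow> min (v f) (v g) \<le> v (f + g)"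
  and v_mult: "f \<noteq> 0 \<Longrightarrow> g \<noteq> 0 \<Longrightarrow> v (f * g) = v f + v g"
  and v_scale: "c \<noteq> 0 \<Longrightarrow> f \<noteq> 0 \<Longrightarrow> v (scale c f) = v f"
  using valuation unfolding is_valuation_def by blast+

lemma v_one: "v 1 = 0"
  using v_mult[of 1 1] by simp

lemma v_uminus: "v (- f) = v f"
  using v_scale[of "-1" f] by (cases "f = 0") simp_all

lemma F_ge_iff: "f \<in> F_ge v \<gamma> \<longleftrightarrow> f = 0 \<or> \<gamma> \<le> v f"
  and F_gt_iff: "f \<in> F_gt v \<gamma> \<longleftrightarrow> f = 0 \<or> \<gamma> < v f"
  by (auto simp: F_ge_def F_gt_def)

lemma F_gt_imp_F_ge: "f \<in> F_gt v \<gamma> \<Longrightarrow> f \<in> F_ge v \<gamma>"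
  by (auto simp: F_ge_iff F_gt_iff)

lemma F_zero [simp]: "0 \<in> F_ge v \<gamma>" "0 \<in> F_gt v \<gamma>"
  by (auto simp: F_ge_iff F_gt_iff)

lemma F_ge_add: "f \<in> F_ge v \<gamma> \<Longrightarrow> g \<in> F_ge v \<gamma> \<Longrightarrow> f + g \<in> F_ge v \<gamma>"
  using v_add[of f g] by (cases "f = 0"; cases "g = 0"; cases "f + g = 0") (auto simp: F_ge_iff min_le_iff_disj)

lemma F_gt_add: "f \<in> F_gt v \<gamma> \<Longrightarrow> g \<in> F_gt v \<gamma> \<Longrightarrow> f + g \<in> F_gt v \<gamma>"
  using v_add[of f g] by (cases "f = 0"; cases "g = 0"; cases "f + g = 0") (auto simp: F_gt_iff min_le_iff_disj)

lemma F_uminus: "- f \<in> F_ge v \<gamma> \<longleftrightarrow> f \<in> F_ge v \<gamma>" "- f \<in> F_gt v \<gamma> \<longleftrightarrow> f \<in> F_gt v \<gamma>"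
  by (auto simp: F_ge_iff F_gt_iff v_uminus)

lemma F_ge_diff: "f \<in> F_ge v \<gamma> \<Longrightarrow> g \<in> F_ge v \<gamma> \<Longrightarrow> f - g \<in> F_ge v \<gamma>"
  using F_ge_add[of f \<gamma> "-g"] by (simp add: F_uminus)

lemma F_gt_diff: "f \<in> F_gt v \<gamma> \<Longrightarrow> g \<in> F_gt v \<gamma> \<Longrightarrow> f - g \<in> F_gt v \<gamma>"
  using F_gt_add[of f \<gamma> "-g"] by (simp add: F_uminus)

lemma F_ge_scale: "f \<in> F_ge v \<gamma> \<Longrightarrow> scale c f \<in> F_ge v \<gamma>"
  by (cases "c = 0"; cases "f = 0") (auto simp: F_ge_iff v_scale)

lemma F_gt_scale: "f \<in> F_gt v \<gamma> \<Longrightarrow> scale c f \<in> F_gt v \<gamma>"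
  by (cases "c = 0"; cases "f = 0") (auto simp: F_gt_iff v_scale)

lemma F_ge_mult: "f \<in> F_ge v \<gamma> \<Longrightarrow> g \<in> F_ge v \<gamma>' \<Longrightarrow> f * g \<in> F_ge v (\<gamma> + \<gamma>')"
  by (cases "f = 0"; cases "g = 0") (auto simp: F_ge_iff v_mult add_mono)

lemma F_gt_mult: "f \<in> F_gt v \<gamma> \<Longrightarrow> g \<in> F_ge v \<gamma>' \<Longrightarrow> f * g \<in> F_gt v (\<gamma> + \<gamma>')"
  "f \<in> F_ge v \<gamma> \<Longrightarrow> g \<in> F_gt v \<gamma>' \<Longrightarrow> f * g \<in> F_gt v (\<gamma> + \<gamma>')"
  by (cases "f = 0"; cases "g = 0"; auto simp: F_ge_iff F_gt_iff v_mult add_less_le_mono add_le_less_mono)+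

lemma F_ge_sum: "(\<And>i. i \<in> S \<Longrightarrow> g i \<in> F_ge v \<gamma>) \<Longrightarrow> sum g S \<in> F_ge v \<gamma>"
  by (induction S rule: infinite_finite_induct) (auto simp: F_ge_add)

lemma F_gt_sum: "(\<And>i. i \<in> S \<Longrightarrow> g i \<in> F_gt v \<gamma>) \<Longrightarrow> sum g S \<in> F_gt v \<gamma>"
  by (induction S rule: infinite_finite_induct) (auto simp: F_gt_add)

lemma F_gt_diff_trans: "f - g \<in> F_gt v \<gamma> \<Longrightarrow> g - h \<in> F_gt v \<gamma> \<Longrightarrow> f - h \<in> F_gt v \<gamma>"
  using F_gt_add[of "f - g" \<gamma> "g - h"] by simp

lemma F_gt_diff_sym: "f - g \<in> F_gt v \<gamma> \<Longrightarrow> g - f \<in> F_gt v \<gamma>"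
  using F_uminus(2)[of "f - g" \<gamma>] by simp

lemma mem_gr_class: "g \<in> gr_class v \<gamma> f \<longleftrightarrow> f - g \<in> F_gt v \<gamma>"
  by (simp add: gr_class_def)

lemma gr_class_eq_iff: "gr_class v \<gamma> f = gr_class v \<gamma> g \<longleftrightarrow> f - g \<in> F_gt v \<gamma>"
proof
  assume "gr_class v \<gamma> f = gr_class v \<gamma> g"
  then have "g \<in> gr_class v \<gamma> f" by (simp add: mem_gr_class)
  then show "f - g \<in> F_gt v \<gamma>" by (simp add: mem_gr_class)
next
  assume "f - g \<in> F_gt v \<gamma>"
  then have "f - h \<in> F_gt v \<gamma> \<longleftrightarrow> g - h \<in> F_gt v \<gamma>" for h
    using F_gt_diff_trans[of f g \<gamma> h] F_gt_diff_trans[of g f \<gamma> h] F_gt_diff_sym[of f g \<gamma>] by blast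
  then show "gr_class v \<gamma> f = gr_class v \<gamma> g"
    by (simp add: mem_gr_class set_eq_iff)
qed

lemma gr_class_zero: "gr_class v \<gamma> 0 = F_gt v \<gamma>"
  by (auto simp: mem_gr_class F_uminus)

abbreviation "gr \<equiv> gr_algebra scale v"

text \<open>The filtered families form the Rees algebra of the filtration inside the group ring of
  \<open>\<Gamma>\<close> over \<open>B\<close>; \<open>cls\<close> presents the associated graded
  algebra as a quotient of it.\<close>

definition filtered :: "('g \<Rightarrow>\<^sub>0 'b) \<Rightarrow> bool"
  where "filtered p \<longleftrightarrow> (\<forall>\<gamma>. Poly_Mapping.lookup p \<gamma> \<in> F_ge v \<gamma>)"

definition cls :: "('g \<Rightarrow>\<^sub>0 'b) \<Rightarrow> ('g \<Rightarrow> 'b set)"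
  where "cls p = (\<lambda>\<gamma>. gr_class v \<gamma> (Poly_Mapping.lookup p \<gamma>))"

lemma cls_eq_iff:
  "cls p = cls q \<longleftrightarrow> (\<forall>\<gamma>. Poly_Mapping.lookup p \<gamma> - Poly_Mapping.lookup q \<gamma> \<in> F_gt v \<gamma>)"
  by (simp add: cls_def fun_eq_iff gr_class_eq_iff)

lemma lookup_mult_F_gt:
  fixes p q :: "'g \<Rightarrow>\<^sub>0 'b"
  assumes "(\<forall>\<alpha>. Poly_Mapping.lookup p \<alpha> \<in> F_gt v \<alpha>) \<and> (\<forall>\<alpha>. Poly_Mapping.lookup q \<alpha> \<in> F_ge v \<alpha>) \<or>
    (\<forall>\<alpha>. Poly_Mapping.lookup p \<alpha> \<in> F_ge v \<alpha>) \<and> (\<forall>\<alpha>. Poly_Mapping.lookup q \<alpha> \<in> F_gt v \<alpha>)"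
  shows "Poly_Mapping.lookup (p * q) \<gamma> \<in> F_gt v \<gamma>"
proof -
  have "Poly_Mapping.lookup p \<alpha> * Poly_Mapping.lookup q (\<gamma> - \<alpha>) \<in> F_gt v (\<alpha> + (\<gamma> - \<alpha>))" for \<alpha>
    using assms F_gt_mult by blast
  then show ?thesis
    by (subst lookup_mult_group[of "Poly_Mapping.keys p"]) (auto intro!: F_gt_sum)
qed

lemma filtered_mult:
  assumes "filtered p" "filtered q"
  shows "filtered (p * q)"
  unfolding filtered_def
proof
  fix \<gamma>
  have "Poly_Mapping.lookup p \<alpha> * Poly_Mapping.lookup q (\<gamma> - \<alpha>) \<in> F_ge v (\<alpha> + (\<gamma> - \<alpha>))" for \<alpha>
    using assms F_ge_mult unfolding filtered_def by blast
  then show "Poly_Mapping.lookup (p * q) \<gamma> \<in> F_ge v \<gamma>"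
    by (subst lookup_mult_group[of "Poly_Mapping.keys p"]) (auto intro!: F_ge_sum)
qed

lemma filtered_add: "filtered p \<Longrightarrow> filtered q \<Longrightarrow> filtered (p + q)"
  by (simp add: filtered_def lookup_add F_ge_add)

lemma lookup_map_scale: "Poly_Mapping.lookup (Poly_Mapping.map (scale c) p) \<gamma> = scale c (Poly_Mapping.lookup p \<gamma>)"
  by (simp add: map.rep_eq when_def)

lemma filtered_map_scale: "filtered p \<Longrightarrow> filtered (Poly_Mapping.map (scale c) p)"
  by (simp add: filtered_def lookup_map_scale F_ge_scale)

lemma filtered_single: "filtered (Poly_Mapping.single \<gamma> b) \<longleftrightarrow> b \<in> F_ge v \<gamma>"
  by (auto simp: filtered_def lookup_single when_def)

text \<open>The defining union runs over a single coset:
  \<open>p * q - p' * q' = (p - p') * q + p' * (q - q')\<close> has all coefficients in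
  \<open>F_gt\<close>, since a factor in \<open>F_gt\<close> times one in \<open>F_ge\<close> falls
  into \<open>F_gt\<close>.\<close>

lemma cls_mult:
  assumes "filtered p" "filtered q"
  shows "cls p \<otimes>\<^bsub>gr\<^esub> cls q = cls (p * q)"
proof
  fix \<gamma>
  let ?C = "\<lambda>p' q'. (\<forall>\<alpha>. Poly_Mapping.lookup p' \<alpha> \<in> cls p \<alpha>) \<and> (\<forall>\<beta>. Poly_Mapping.lookup q' \<beta> \<in> cls q \<beta>)"
  have "Poly_Mapping.lookup (p * q) \<gamma> - Poly_Mapping.lookup (p' * q') \<gamma> \<in> F_gt v \<gamma>" if "?C p' q'" for p' q'
  proof -
    have d: "Poly_Mapping.lookup (p - p') \<alpha> \<in> F_gt v \<alpha>" "Poly_Mapping.lookup (q - q') \<alpha> \<in> F_gt v \<alpha>" for \<alpha>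
      using that by (auto simp: cls_def mem_gr_class lookup_minus)
    have p': "Poly_Mapping.lookup p' \<alpha> \<in> F_ge v \<alpha>" for \<alpha>
      using F_ge_diff[of "Poly_Mapping.lookup p \<alpha>" \<alpha> "Poly_Mapping.lookup (p - p') \<alpha>"] assms(1) F_gt_imp_F_ge[OF d(1)]
      by (simp add: filtered_def lookup_minus)
    have "p * q - p' * q' = (p - p') * q + p' * (q - q')" by (simp add: algebra_simps)
    then have "Poly_Mapping.lookup (p * q) \<gamma> - Poly_Mapping.lookup (p' * q') \<gamma> =
      Poly_Mapping.lookup ((p - p') * q) \<gamma> + Poly_Mapping.lookup (p' * (q - q')) \<gamma>"
      by (metis lookup_add lookup_minus)
    also have "\<dots> \<in> F_gt v \<gamma>"
      using d p' assms(2) by (intro F_gt_add lookup_mult_F_gt) (auto simp: filtered_def)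
    finally show ?thesis .
  qed
  then have eq: "gr_class v \<gamma> (Poly_Mapping.lookup (p' * q') \<gamma>) = cls (p * q) \<gamma>" if "?C p' q'" for p' q'
    using that by (metis cls_def gr_class_eq_iff)
  have C: "?C p q" by (simp add: cls_def mem_gr_class)
  have "{gr_class v \<gamma> (Poly_Mapping.lookup (p' * q') \<gamma>) | p' q'. ?C p' q'} = {cls (p * q) \<gamma>}"
    using eq C eq[OF C] by blast
  then show "(cls p \<otimes>\<^bsub>gr\<^esub> cls q) \<gamma> = cls (p * q) \<gamma>"
    by (simp add: gr_algebra_def)
qed

lemma cls_add: "cls p \<oplus>\<^bsub>gr\<^esub> cls q = cls (p + q)"
proof
  fix \<gamma>
  have "{f + g | f g. f \<in> gr_class v \<gamma> a \<and> g \<in> gr_class v \<gamma> b} = gr_class v \<gamma> (a + b)" for a b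
  proof (intro equalityI subsetI)
    fix x assume "x \<in> {f + g | f g. f \<in> gr_class v \<gamma> a \<and> g \<in> gr_class v \<gamma> b}"
    then obtain f g where "x = f + g" "a - f \<in> F_gt v \<gamma>" "b - g \<in> F_gt v \<gamma>" by (auto simp: mem_gr_class)
    then show "x \<in> gr_class v \<gamma> (a + b)"
      using F_gt_add[of "a - f" \<gamma> "b - g"] by (simp add: mem_gr_class algebra_simps)
  next
    fix x assume "x \<in> gr_class v \<gamma> (a + b)"
    then have "x = a + (x - a)" "a \<in> gr_class v \<gamma> a" "x - a \<in> gr_class v \<gamma> b"
      by (auto simp: mem_gr_class algebra_simps)
    then show "x \<in> {f + g | f g. f \<in> gr_class v \<gamma> a \<and> g \<in> gr_class v \<gamma> b}" by blast
  qed
  then show "(cls p \<oplus>\<^bsub>gr\<^esub> cls q) \<gamma> = cls (p + q) \<gamma>"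
    by (simp add: gr_algebra_def cls_def lookup_add)
qed

lemma cls_smult: "c \<odot>\<^bsub>gr\<^esub> cls p = cls (Poly_Mapping.map (scale c) p)"
proof
  fix \<gamma>
  have eq: "gr_class v \<gamma> (scale c f) = gr_class v \<gamma> (scale c a)" if "f \<in> gr_class v \<gamma> a" for f a
    using F_gt_scale[OF F_gt_diff_sym[of a f \<gamma>], of c] that
    by (simp add: mem_gr_class gr_class_eq_iff scale_right_diff_distrib)
  have m: "a \<in> gr_class v \<gamma> a" for a by (simp add: mem_gr_class)
  have "{gr_class v \<gamma> (scale c f) | f. f \<in> gr_class v \<gamma> a} = {gr_class v \<gamma> (scale c a)}" for a
    using eq m by blast
  then show "(c \<odot>\<^bsub>gr\<^esub> cls p) \<gamma> = cls (Poly_Mapping.map (scale c) p) \<gamma>"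
    by (simp add: gr_algebra_def cls_def lookup_map_scale)
qed

lemma cls_one: "\<one>\<^bsub>gr\<^esub> = cls 1"
  by (auto simp: gr_algebra_def cls_def lookup_one gr_class_zero fun_eq_iff when_def)

lemma filtered_one: "filtered 1"
  by (auto simp: filtered_def lookup_one F_ge_iff v_one when_def)

lemma carrier_gr: "carrier gr = cls ` Collect filtered"
proof (intro equalityI subsetI)
  fix x assume "x \<in> carrier gr"
  then have x: "\<forall>\<gamma>. x \<gamma> \<in> F_ge v \<gamma> // {(f, g). f - g \<in> F_gt v \<gamma>}" and fin: "finite {\<gamma>. x \<gamma> \<noteq> F_gt v \<gamma>}"
    by (auto simp: gr_algebra_def)
  have "\<forall>\<gamma>. \<exists>f\<in>F_ge v \<gamma>. x \<gamma> = gr_class v \<gamma> f"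
    using x by (fastforce simp: quotient_def gr_class_def Image_def)
  then obtain F where F: "\<And>\<gamma>. F \<gamma> \<in> F_ge v \<gamma>" "\<And>\<gamma>. x \<gamma> = gr_class v \<gamma> (F \<gamma>)" by metis
  \<comment> \<open>Trivial cosets get the representative 0; otherwise the chosen representatives
    might have infinite support.\<close>
  define F' where "F' \<gamma> = (if x \<gamma> = F_gt v \<gamma> then 0 else F \<gamma>)" for \<gamma>
  have "finite {\<gamma>. F' \<gamma> \<noteq> 0}" by (rule finite_subset[OF _ fin]) (auto simp: F'_def)
  then have l: "Poly_Mapping.lookup (Abs_poly_mapping F') = F'" by (rule lookup_Abs_poly_mapping)
  have "filtered (Abs_poly_mapping F')" using F by (auto simp: filtered_def l F'_def)
  moreover have "x = cls (Abs_poly_mapping F')"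
    unfolding cls_def l using F gr_class_zero by (auto simp: F'_def fun_eq_iff)
  ultimately show "x \<in> cls ` Collect filtered" by blast
next
  fix x assume "x \<in> cls ` Collect filtered"
  then obtain p where p: "filtered p" "x = cls p" by auto
  have "{\<gamma>. x \<gamma> \<noteq> F_gt v \<gamma>} \<subseteq> Poly_Mapping.keys p"
    using gr_class_zero by (auto simp: p(2) cls_def in_keys_iff)
  then have "finite {\<gamma>. x \<gamma> \<noteq> F_gt v \<gamma>}" by (rule finite_subset) simp
  then show "x \<in> carrier gr"
    using p by (auto simp: gr_algebra_def cls_def filtered_def quotient_def gr_class_def Image_def)
qed

text \<open>An arbitrary choice of representing family. It is compatible with the operations of
  \<open>gr\<close> only modulo \<open>F_gt\<close>, so computations with it are carried out up to
  elements of \<open>F_gt\<close>.\<close>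

definition rep :: "('g \<Rightarrow> 'b set) \<Rightarrow> ('g \<Rightarrow>\<^sub>0 'b)"
  where "rep x = (SOME p. filtered p \<and> cls p = x)"

lemma rep: "x \<in> carrier gr \<Longrightarrow> filtered (rep x)" "x \<in> carrier gr \<Longrightarrow> cls (rep x) = x"
proof -
  assume "x \<in> carrier gr"
  then have "\<exists>p. filtered p \<and> cls p = x" by (auto simp: carrier_gr)
  then have "filtered (rep x) \<and> cls (rep x) = x" unfolding rep_def by (rule someI_ex)
  then show "filtered (rep x)" "cls (rep x) = x" by auto
qed

lemma cls_carrier: "filtered p \<Longrightarrow> cls p \<in> carrier gr"
  by (simp add: carrier_gr)

lemma comm_monoid_gr: "comm_monoid gr"
proof (rule comm_monoidI)
  fix x y z assume "x \<in> carrier gr" "y \<in> carrier gr" "z \<in> carrier gr"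
  then obtain p q r where *: "filtered p" "x = cls p" "filtered q" "y = cls q" "filtered r" "z = cls r"
    by (auto simp: carrier_gr)
  then show "x \<otimes>\<^bsub>gr\<^esub> y \<in> carrier gr" "x \<otimes>\<^bsub>gr\<^esub> y \<otimes>\<^bsub>gr\<^esub> z = x \<otimes>\<^bsub>gr\<^esub> (y \<otimes>\<^bsub>gr\<^esub> z)"
    "x \<otimes>\<^bsub>gr\<^esub> y = y \<otimes>\<^bsub>gr\<^esub> x" "\<one>\<^bsub>gr\<^esub> \<otimes>\<^bsub>gr\<^esub> x = x"
    by (auto simp: cls_mult filtered_mult cls_carrier cls_one filtered_one mult_ac)
qed (simp add: cls_one cls_carrier filtered_one)

section \<open>The tensor product of the associated graded algebra with the group algebra\<close>

abbreviation "KD \<equiv> (group_algebra :: ('k, 'd::ab_group_add \<Rightarrow>\<^sub>0 'k) module)"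

lemma tensor_factors_gr: "tensor_factors gr KD"
proof (rule tensor_factors.intro)
  show "comm_monoid gr" by (rule comm_monoid_gr)
  show "comm_monoid KD" by (rule comm_monoidI) (auto simp: mult.assoc mult.commute)
  show "x \<oplus>\<^bsub>gr\<^esub> y \<in> carrier gr" if "x \<in> carrier gr" "y \<in> carrier gr" for x y
    using that by (auto simp: carrier_gr cls_add filtered_add)
  show "c \<odot>\<^bsub>gr\<^esub> x \<in> carrier gr" if "x \<in> carrier gr" for c x
    using that by (auto simp: carrier_gr cls_smult filtered_map_scale)
qed auto

text \<open>
  The coefficient of a formal combination of pairs in degree \<open>(\<gamma>, \<delta>)\<close>; modulo \<open>F_gt v \<gamma>\<close> it
  descends to the tensor product and separates its graded components.
\<close>

definition coefficient :: "'g \<Rightarrow> 'd::ab_group_add \<Rightarrow> (('g \<Rightarrow> 'b set) \<times> ('d \<Rightarrow>\<^sub>0 'k) \<Rightarrow>\<^sub>0 'k) \<Rightarrow> 'b"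
  where "coefficient \<gamma> \<delta> p = (\<Sum>a\<in>Poly_Mapping.keys p.
    scale (Poly_Mapping.lookup p a * Poly_Mapping.lookup (snd a) \<delta>) (Poly_Mapping.lookup (rep (fst a)) \<gamma>))"

lemma coefficient_superset:
  assumes "finite S" "Poly_Mapping.keys p \<subseteq> S"
  shows "coefficient \<gamma> \<delta> p = (\<Sum>a\<in>S.
    scale (Poly_Mapping.lookup p a * Poly_Mapping.lookup (snd a) \<delta>) (Poly_Mapping.lookup (rep (fst a)) \<gamma>))"
  unfolding coefficient_def using assms by (intro sum.mono_neutral_left) (auto simp: in_keys_iff)

lemma coefficient_add: "coefficient \<gamma> \<delta> (p + q) = coefficient \<gamma> \<delta> p + coefficient \<gamma> \<delta> q"
proof -
  let ?S = "Poly_Mapping.keys p \<union> Poly_Mapping.keys q"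
  show ?thesis using keys_add[of p q]
    by (simp add: coefficient_superset[of ?S] lookup_add distrib_right scale_left_distrib sum.distrib)
qed

lemma coefficient_diff: "coefficient \<gamma> \<delta> (p - q) = coefficient \<gamma> \<delta> p - coefficient \<gamma> \<delta> q"
  using coefficient_add[of \<gamma> \<delta> "p - q" q] by (simp add: algebra_simps)

lemma coefficient_sum: "coefficient \<gamma> \<delta> (sum g S) = (\<Sum>i\<in>S. coefficient \<gamma> \<delta> (g i))"
proof -
  have "coefficient \<gamma> \<delta> 0 = 0" by (simp add: coefficient_def)
  then show ?thesis
    by (induction S rule: infinite_finite_induct) (auto simp: coefficient_add)
qed

lemma coefficient_single:
  "coefficient \<gamma> \<delta> (Poly_Mapping.single (x, q) c) = scale (c * Poly_Mapping.lookup q \<delta>) (Poly_Mapping.lookup (rep x) \<gamma>)"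
  by (simp add: coefficient_superset[of "{(x, q)}"])

lemma rep_mult:
  assumes "x \<in> carrier gr" "y \<in> carrier gr"
  shows "Poly_Mapping.lookup (rep (x \<otimes>\<^bsub>gr\<^esub> y)) \<gamma> - Poly_Mapping.lookup (rep x * rep y) \<gamma> \<in> F_gt v \<gamma>"
proof -
  interpret G: comm_monoid gr by (rule comm_monoid_gr)
  have "cls (rep (x \<otimes>\<^bsub>gr\<^esub> y)) = cls (rep x * rep y)"
    using assms by (simp add: rep cls_mult[symmetric])
  then show ?thesis by (simp add: cls_eq_iff)
qed

text \<open>With \<open>rep x * rep (fst a)\<close> in place of the representative of the product,
  the formula would be an exact convolution over both gradings; \<open>rep_mult\<close> controls the
  error.\<close>

lemma coefficient_single_mult:
  fixes p :: "('g \<Rightarrow> 'b set) \<times> ('d::ab_group_add \<Rightarrow>\<^sub>0 'k) \<Rightarrow>\<^sub>0 'k"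
  assumes x: "x \<in> carrier gr" and p: "p \<in> carrier (free_pairs gr KD)"
  shows "coefficient \<gamma> \<delta> (Poly_Mapping.single (x, q) c \<otimes>\<^bsub>free_pairs gr KD\<^esub> p) -
    (\<Sum>\<delta>1\<in>Poly_Mapping.keys q. \<Sum>\<gamma>1\<in>Poly_Mapping.keys (rep x).
      scale (c * Poly_Mapping.lookup q \<delta>1) (Poly_Mapping.lookup (rep x) \<gamma>1 * coefficient (\<gamma> - \<gamma>1) (\<delta> - \<delta>1) p))
    \<in> F_gt v \<gamma>"
proof -
  interpret tensor_factors gr KD by (rule tensor_factors_gr)
  let ?K = "Poly_Mapping.keys p"
  have carr: "fst a \<in> carrier gr" if "a \<in> ?K" for a using that p by (auto simp: free_pairs_simps)
  have "Poly_Mapping.single (x, q) c \<otimes>\<^bsub>free_pairs gr KD\<^esub> p =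
     (\<Sum>a\<in>?K. Poly_Mapping.single (x \<otimes>\<^bsub>gr\<^esub> fst a, q * snd a) (c * Poly_Mapping.lookup p a))"
    unfolding free_pairs_def
    by (subst monoid_algebra_mult_superset[of "{(x, q)}" ?K]) (auto simp: DirProd_def split_def)
  then have 1: "coefficient \<gamma> \<delta> (Poly_Mapping.single (x, q) c \<otimes>\<^bsub>free_pairs gr KD\<^esub> p) =
     (\<Sum>a\<in>?K. scale (c * Poly_Mapping.lookup p a * Poly_Mapping.lookup (q * snd a) \<delta>)
        (Poly_Mapping.lookup (rep (x \<otimes>\<^bsub>gr\<^esub> fst a)) \<gamma>))"
    by (simp add: coefficient_sum coefficient_single)
  have 2: "(\<Sum>\<delta>1\<in>Poly_Mapping.keys q. \<Sum>\<gamma>1\<in>Poly_Mapping.keys (rep x).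
      scale (c * Poly_Mapping.lookup q \<delta>1) (Poly_Mapping.lookup (rep x) \<gamma>1 * coefficient (\<gamma> - \<gamma>1) (\<delta> - \<delta>1) p)) =
     (\<Sum>a\<in>?K. scale (c * Poly_Mapping.lookup p a * Poly_Mapping.lookup (q * snd a) \<delta>)
        (Poly_Mapping.lookup (rep x * rep (fst a)) \<gamma>))" (is "?L = ?R")
  proof -
    have sm: "y * scale e z = scale e (y * z)" for e y z
      using scale_mult_left[of e z y] by (simp add: mult.commute)
    have "?L = (\<Sum>\<delta>1\<in>Poly_Mapping.keys q. \<Sum>\<gamma>1\<in>Poly_Mapping.keys (rep x). \<Sum>a\<in>?K.
        scale (c * Poly_Mapping.lookup p a * (Poly_Mapping.lookup q \<delta>1 * Poly_Mapping.lookup (snd a) (\<delta> - \<delta>1)))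
          (Poly_Mapping.lookup (rep x) \<gamma>1 * Poly_Mapping.lookup (rep (fst a)) (\<gamma> - \<gamma>1)))"
      by (simp add: coefficient_def sum_distrib_left scale_sum_right sm mult_ac)
    also have "\<dots> = (\<Sum>\<delta>1\<in>Poly_Mapping.keys q. \<Sum>a\<in>?K. \<Sum>\<gamma>1\<in>Poly_Mapping.keys (rep x).
        scale (c * Poly_Mapping.lookup p a * (Poly_Mapping.lookup q \<delta>1 * Poly_Mapping.lookup (snd a) (\<delta> - \<delta>1)))
          (Poly_Mapping.lookup (rep x) \<gamma>1 * Poly_Mapping.lookup (rep (fst a)) (\<gamma> - \<gamma>1)))"
      by (intro sum.cong refl sum.swap)
    also have "\<dots> = (\<Sum>a\<in>?K. \<Sum>\<delta>1\<in>Poly_Mapping.keys q. \<Sum>\<gamma>1\<in>Poly_Mapping.keys (rep x).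
        scale (c * Poly_Mapping.lookup p a * (Poly_Mapping.lookup q \<delta>1 * Poly_Mapping.lookup (snd a) (\<delta> - \<delta>1)))
          (Poly_Mapping.lookup (rep x) \<gamma>1 * Poly_Mapping.lookup (rep (fst a)) (\<gamma> - \<gamma>1)))"
      by (rule sum.swap)
    also have "\<dots> = ?R"
      by (simp only: lookup_mult_group[OF finite_keys order.refl] sum_distrib_left scale_sum_left)
        (simp add: scale_sum_right)
    finally show ?thesis .
  qed
  show ?thesis
    unfolding 1 2 sum_subtractf[symmetric] scale_right_diff_distrib[symmetric]
    by (intro F_gt_sum F_gt_scale rep_mult x carr)
qed

text \<open>An explicit ideal containing the tensor ideal, meant as the \<open>Z\<close> of
  \<open>sum_pure_tensor_eq_zeroD\<close>. The condition is modulo \<open>F_gt v \<gamma>\<close>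
  because \<open>rep\<close> is a mere choice.\<close>

definition vanishing :: "(('g \<Rightarrow> 'b set) \<times> ('d::ab_group_add \<Rightarrow>\<^sub>0 'k) \<Rightarrow>\<^sub>0 'k) set"
  where "vanishing = {p \<in> carrier (free_pairs gr KD). \<forall>\<gamma> \<delta>. coefficient \<gamma> \<delta> p \<in> F_gt v \<gamma>}"

lemma ideal_vanishing:
  "ideal (vanishing :: (('g \<Rightarrow> 'b set) \<times> ('d::ab_group_add \<Rightarrow>\<^sub>0 'k) \<Rightarrow>\<^sub>0 'k) set) (free_pairs gr KD)"
proof -
  interpret tensor_factors gr "KD :: ('k, 'd::ab_group_add \<Rightarrow>\<^sub>0 'k) module" by (rule tensor_factors_gr)
  interpret FP: cring "free_pairs gr (KD :: ('k, 'd::ab_group_add \<Rightarrow>\<^sub>0 'k) module)" by (rule cring_free_pairs)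
  have l: "x \<otimes>\<^bsub>FP\<^esub> a \<in> vanishing" if a: "a \<in> vanishing" and x: "x \<in> carrier FP"
    for a x :: "('g \<Rightarrow> 'b set) \<times> ('d \<Rightarrow>\<^sub>0 'k) \<Rightarrow>\<^sub>0 'k"
  proof -
    have ac: "a \<in> carrier FP" using a by (simp add: vanishing_def)
    have 1: "coefficient \<gamma> \<delta> (Poly_Mapping.single (y, q) c \<otimes>\<^bsub>FP\<^esub> a) \<in> F_gt v \<gamma>"
      if y: "y \<in> carrier gr" for y q c \<gamma> \<delta>
    proof -
      \<comment> \<open>Each product in the convolution formula has one factor in
        \<open>F_ge v \<gamma>1\<close> and one in \<open>F_gt v (\<gamma> - \<gamma>1)\<close>, so
        it lies in \<open>F_gt v \<gamma>\<close>.\<close>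
      have "Poly_Mapping.lookup (rep y) \<gamma>1 * coefficient (\<gamma> - \<gamma>1) (\<delta> - \<delta>1) a \<in> F_gt v (\<gamma>1 + (\<gamma> - \<gamma>1))" for \<gamma>1 \<delta>1
        using rep(1)[OF y] a by (intro F_gt_mult(2)) (auto simp: filtered_def vanishing_def)
      then have "(\<Sum>\<delta>1\<in>Poly_Mapping.keys q. \<Sum>\<gamma>1\<in>Poly_Mapping.keys (rep y).
        scale (c * Poly_Mapping.lookup q \<delta>1) (Poly_Mapping.lookup (rep y) \<gamma>1 * coefficient (\<gamma> - \<gamma>1) (\<delta> - \<delta>1) a)) \<in> F_gt v \<gamma>"
        by (intro F_gt_sum F_gt_scale) simp
      from F_gt_add[OF coefficient_single_mult[OF y ac, of \<gamma> \<delta> q c] this] show ?thesis by simp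
    qed
    have "x \<otimes>\<^bsub>FP\<^esub> a = (\<Sum>b\<in>Poly_Mapping.keys x. Poly_Mapping.single (fst b, snd b) (Poly_Mapping.lookup x b) \<otimes>\<^bsub>FP\<^esub> a)"
      unfolding free_pairs_def
      by (subst poly_mapping_sum_single[of "Poly_Mapping.keys x" x]) (auto simp: monoid_algebra_sum)
    then have "coefficient \<gamma> \<delta> (x \<otimes>\<^bsub>FP\<^esub> a) \<in> F_gt v \<gamma>" for \<gamma> \<delta>
      using x by (auto simp: coefficient_sum free_pairs_simps(1) intro!: F_gt_sum 1)
    then show ?thesis using x ac by (simp add: vanishing_def)
  qed
  show ?thesis
  proof (rule idealI)
    show "subgroup vanishing (add_monoid FP)"
    proof (rule FP.add.subgroupI)
      show "vanishing \<subseteq> carrier FP" by (auto simp: vanishing_def)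
      have "(0 :: ('g \<Rightarrow> 'b set) \<times> ('d \<Rightarrow>\<^sub>0 'k) \<Rightarrow>\<^sub>0 'k) \<in> vanishing" by (auto simp: vanishing_def coefficient_def free_pairs_simps)
      then show "(vanishing :: (('g \<Rightarrow> 'b set) \<times> ('d \<Rightarrow>\<^sub>0 'k) \<Rightarrow>\<^sub>0 'k) set) \<noteq> {}" by blast
      fix a b :: "('g \<Rightarrow> 'b set) \<times> ('d \<Rightarrow>\<^sub>0 'k) \<Rightarrow>\<^sub>0 'k"
      assume a: "a \<in> vanishing"
      then have "a \<in> carrier FP" by (simp add: vanishing_def)
      then have "(\<ominus>\<^bsub>FP\<^esub> \<one>\<^bsub>FP\<^esub>) \<otimes>\<^bsub>FP\<^esub> a = \<ominus>\<^bsub>FP\<^esub> a" by (simp add: FP.l_minus)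
      then show "\<ominus>\<^bsub>FP\<^esub> a \<in> vanishing" using l[OF a, of "\<ominus>\<^bsub>FP\<^esub> \<one>\<^bsub>FP\<^esub>"] by simp
      assume b: "b \<in> vanishing"
      show "a \<oplus>\<^bsub>FP\<^esub> b \<in> vanishing"
        using a b FP.a_closed[of a b] by (auto simp: vanishing_def free_pairs_simps(4) coefficient_add F_gt_add)
    qed
    show "\<And>a x. a \<in> vanishing \<Longrightarrow> x \<in> carrier FP \<Longrightarrow> x \<otimes>\<^bsub>FP\<^esub> a \<in> vanishing" by (rule l)
    show "a \<otimes>\<^bsub>FP\<^esub> x \<in> vanishing" if "a \<in> vanishing" "x \<in> carrier FP" for a x
    proof -
      have "a \<in> carrier FP" using that by (simp add: vanishing_def)
      then show ?thesis using l[OF that] FP.m_comm[of a x] that by simp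
    qed
  qed (rule FP.ring_axioms)
qed

text \<open>Relations in the second factor have coefficients exactly 0, because lookup in the group
  ring is linear. For those in the first factor the coefficients are only in \<open>F_gt\<close>,
  the error made by \<open>rep\<close>.\<close>

lemma bilinearity_relations_vanishing:
  "bilinearity_relations gr KD \<subseteq> (vanishing :: (('g \<Rightarrow> 'b set) \<times> ('d::ab_group_add \<Rightarrow>\<^sub>0 'k) \<Rightarrow>\<^sub>0 'k) set)"
proof
  interpret tensor_factors gr "KD :: ('k, 'd::ab_group_add \<Rightarrow>\<^sub>0 'k) module" by (rule tensor_factors_gr)
  fix r :: "('g \<Rightarrow> 'b set) \<times> ('d \<Rightarrow>\<^sub>0 'k) \<Rightarrow>\<^sub>0 'k"
  assume r: "r \<in> bilinearity_relations gr KD"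
  have "coefficient \<gamma> \<delta> r \<in> F_gt v \<gamma>" for \<gamma> \<delta>
    using r unfolding bilinearity_relations_def Un_iff mem_Collect_eq
  proof (elim disjE exE conjE)
    fix m m' n assume *: "m \<in> carrier gr" "m' \<in> carrier gr" and
      r: "r = Poly_Mapping.single (m \<oplus>\<^bsub>gr\<^esub> m', n) 1 - Poly_Mapping.single (m, n) 1 - Poly_Mapping.single (m', n) 1"
    have "cls (rep (m \<oplus>\<^bsub>gr\<^esub> m')) = cls (rep m + rep m')"
      using * by (simp add: rep cls_add[symmetric] closed_M)
    then have "scale (Poly_Mapping.lookup n \<delta>) (Poly_Mapping.lookup (rep (m \<oplus>\<^bsub>gr\<^esub> m')) \<gamma> -
      Poly_Mapping.lookup (rep m + rep m') \<gamma>) \<in> F_gt v \<gamma>"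
      by (intro F_gt_scale) (simp add: cls_eq_iff)
    then show ?thesis
      by (simp add: r coefficient_diff coefficient_add coefficient_single lookup_add scale_right_diff_distrib scale_right_distrib diff_diff_eq)
  next
    fix c m n assume *: "m \<in> carrier gr" and
      r: "r = Poly_Mapping.single (c \<odot>\<^bsub>gr\<^esub> m, n) 1 - Poly_Mapping.single (m, n) c"
    have "cls (rep (c \<odot>\<^bsub>gr\<^esub> m)) = cls (Poly_Mapping.map (scale c) (rep m))"
      using * by (simp add: rep cls_smult[symmetric] closed_M)
    then have "scale (Poly_Mapping.lookup n \<delta>) (Poly_Mapping.lookup (rep (c \<odot>\<^bsub>gr\<^esub> m)) \<gamma> -
      Poly_Mapping.lookup (Poly_Mapping.map (scale c) (rep m)) \<gamma>) \<in> F_gt v \<gamma>"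
      by (intro F_gt_scale) (simp add: cls_eq_iff)
    then show ?thesis
      by (simp add: r coefficient_diff coefficient_single lookup_map_scale scale_right_diff_distrib mult.commute)
  next
    fix m n n' assume r: "r = Poly_Mapping.single (m, n \<oplus>\<^bsub>KD\<^esub> n') 1 - Poly_Mapping.single (m, n) 1 - Poly_Mapping.single (m, n') 1"
    then have "coefficient \<gamma> \<delta> r = 0"
      by (simp add: coefficient_diff coefficient_single lookup_add scale_left_distrib)
    then show ?thesis by simp
  next
    fix c m n assume r: "r = Poly_Mapping.single (m, c \<odot>\<^bsub>KD\<^esub> n) 1 - Poly_Mapping.single (m, n) c"
    have "Poly_Mapping.lookup (Poly_Mapping.map ((*) c) n) \<delta> = c * Poly_Mapping.lookup n \<delta>"
      by (simp add: map.rep_eq when_def)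
    then have "coefficient \<gamma> \<delta> r = 0"
      by (simp add: r coefficient_diff coefficient_single)
    then show ?thesis by simp
  qed
  then show "r \<in> vanishing"
    using r bilinearity_relations_carrier by (auto simp: vanishing_def)
qed

text \<open>The degree \<open>\<gamma>\<close> is a parameter separate from \<open>v b\<close>: if
  \<open>b\<close> is zero or has larger value, this is the zero tensor. Sums in which leading terms
  cancel then need no case distinction.\<close>

definition component :: "'g \<Rightarrow> 'd::ab_group_add \<Rightarrow> 'b \<Rightarrow> ('g, 'b, 'd, 'k) gr_tensor"
  where "component \<gamma> \<delta> b = pure_tensor gr group_algebra (cls (Poly_Mapping.single \<gamma> b)) (Poly_Mapping.single \<delta> 1)"

abbreviation "GT \<equiv> (gr_tensor_algebra scale v :: ('k, ('g, 'b, 'd::ab_group_add, 'k) gr_tensor) module)"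

lemma record_algebra_GT: "record_algebra GT"
proof -
  interpret tensor_factors gr "KD :: ('k, 'd::ab_group_add \<Rightarrow>\<^sub>0 'k) module" by (rule tensor_factors_gr)
  show ?thesis unfolding gr_tensor_algebra_def by (rule tensor.record_algebra_axioms)
qed

context
  fixes \<delta> \<delta>' :: "'d::ab_group_add"
begin

interpretation tensor_factors gr "KD :: ('k, 'd::ab_group_add \<Rightarrow>\<^sub>0 'k) module" by (rule tensor_factors_gr)

lemma cls_single_carrier: "b \<in> F_ge v \<gamma> \<Longrightarrow> cls (Poly_Mapping.single \<gamma> b) \<in> carrier gr"
  by (simp add: cls_carrier filtered_single)

lemma component_closed: "b \<in> F_ge v \<gamma> \<Longrightarrow> component \<gamma> \<delta> b \<in> carrier GT"
  unfolding component_def gr_tensor_algebra_def by (rule pure_tensor_closed) (auto simp: cls_single_carrier)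

lemma component_add:
  "b \<in> F_ge v \<gamma> \<Longrightarrow> b' \<in> F_ge v \<gamma> \<Longrightarrow> component \<gamma> \<delta> (b + b') = component \<gamma> \<delta> b \<oplus>\<^bsub>GT\<^esub> component \<gamma> \<delta> b'"
  unfolding component_def gr_tensor_algebra_def
  by (subst pure_tensor_add_left[symmetric]) (auto simp: cls_single_carrier cls_add single_add)

lemma component_smult:
  "b \<in> F_ge v \<gamma> \<Longrightarrow> c \<odot>\<^bsub>GT\<^esub> component \<gamma> \<delta> b = component \<gamma> \<delta> (scale c b)"
  unfolding component_def gr_tensor_algebra_def
  by (subst pure_tensor_smult_left) (auto simp: cls_single_carrier cls_smult)

lemma component_mult:
  "b \<in> F_ge v \<gamma> \<Longrightarrow> b' \<in> F_ge v \<gamma>' \<Longrightarrow>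
    component \<gamma> \<delta> b \<otimes>\<^bsub>GT\<^esub> component \<gamma>' \<delta>' b' = component (\<gamma> + \<gamma>') (\<delta> + \<delta>') (b * b')"
  unfolding component_def gr_tensor_algebra_def
  by (subst pure_tensor_mult) (auto simp: cls_single_carrier cls_mult filtered_single mult_single)

lemma component_one: "component 0 (0 :: 'd) 1 = \<one>\<^bsub>GT\<^esub>"
  unfolding component_def gr_tensor_algebra_def pure_tensor_one[symmetric]
  by (simp add: cls_one)

lemma component_cong: "b - b' \<in> F_gt v \<gamma> \<Longrightarrow> component \<gamma> \<delta> b = component \<gamma> \<delta> b'"
  unfolding component_def
  by (rule arg_cong2[where f = "pure_tensor gr KD", OF _ refl])
    (auto simp: cls_eq_iff lookup_single when_def)

lemma component_zero: "component \<gamma> \<delta> 0 = \<zero>\<^bsub>GT\<^esub>"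
proof -
  interpret T: record_algebra GT by (rule record_algebra_GT)
  have "component \<gamma> \<delta> 0 = component \<gamma> \<delta> 0 \<oplus>\<^bsub>GT\<^esub> component \<gamma> \<delta> 0"
    using component_add[of 0 \<gamma> 0] by simp
  then show ?thesis
    using component_closed[of 0 \<gamma>] T.add.l_cancel_one[of "component \<gamma> \<delta> 0" "component \<gamma> \<delta> 0"] by simp
qed

lemma component_eq_zero: "b \<in> F_gt v \<gamma> \<Longrightarrow> component \<gamma> \<delta> b = \<zero>\<^bsub>GT\<^esub>"
  using component_cong[of b 0 \<gamma>] component_zero[of \<gamma>] by simp

end

text \<open>Different bidegrees are independent in the tensor product. The condition of
  \<open>vanishing\<close> at bidegree \<open>\<gamma>\<close>, \<open>\<delta>\<close> gives the
  claim for the values of \<open>rep\<close> instead of \<open>b i\<close>; the difference lies in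
  \<open>F_gt v \<gamma>\<close> and is added at the end.\<close>

lemma component_sum_eq_zeroD:
  fixes D :: "'i \<Rightarrow> 'd::ab_group_add"
  assumes S: "finite S" "\<And>i. i \<in> S \<Longrightarrow> b i \<in> F_ge v (C i)"
    and zero: "(\<Oplus>\<^bsub>GT\<^esub>i\<in>S. component (C i) (D i) (b i)) = \<zero>\<^bsub>GT\<^esub>"
  shows "(\<Sum>i | i \<in> S \<and> C i = \<gamma> \<and> D i = \<delta>. b i) \<in> F_gt v \<gamma>"
proof -
  interpret tensor_factors gr "KD :: ('k, 'd::ab_group_add \<Rightarrow>\<^sub>0 'k) module" by (rule tensor_factors_gr)
  let ?m = "\<lambda>i. cls (Poly_Mapping.single (C i) (b i))" and ?n = "\<lambda>i. Poly_Mapping.single (D i) (1::'k)"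
  have "(\<Sum>i\<in>S. Poly_Mapping.single (?m i, ?n i) 1) \<in> vanishing"
    by (rule sum_pure_tensor_eq_zeroD[OF S(1) _ _ _ ideal_vanishing bilinearity_relations_vanishing])
      (use S zero in \<open>auto simp: cls_single_carrier component_def gr_tensor_algebra_def\<close>)
  then have "coefficient \<gamma> \<delta> (\<Sum>i\<in>S. Poly_Mapping.single (?m i, ?n i) 1) \<in> F_gt v \<gamma>"
    by (simp add: vanishing_def)
  then have A: "(\<Sum>i\<in>S. scale (Poly_Mapping.lookup (?n i) \<delta>) (Poly_Mapping.lookup (rep (?m i)) \<gamma>)) \<in> F_gt v \<gamma>"
    by (simp add: coefficient_sum coefficient_single)
  have "cls (rep (?m i)) = cls (Poly_Mapping.single (C i) (b i))" if "i \<in> S" for i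
    using that S(2) by (simp add: rep cls_single_carrier)
  then have "(\<Sum>i\<in>S. scale (Poly_Mapping.lookup (?n i) \<delta>)
      (Poly_Mapping.lookup (Poly_Mapping.single (C i) (b i)) \<gamma> - Poly_Mapping.lookup (rep (?m i)) \<gamma>)) \<in> F_gt v \<gamma>"
    by (intro F_gt_sum F_gt_scale F_gt_diff_sym[of "Poly_Mapping.lookup (rep (?m i)) \<gamma>" for i]) (simp add: cls_eq_iff)
  from F_gt_add[OF this A]
  have "(\<Sum>i\<in>S. scale (Poly_Mapping.lookup (?n i) \<delta>) (Poly_Mapping.lookup (Poly_Mapping.single (C i) (b i)) \<gamma>)) \<in> F_gt v \<gamma>"
    by (simp add: scale_right_diff_distrib sum_subtractf)
  also have "(\<Sum>i\<in>S. scale (Poly_Mapping.lookup (?n i) \<delta>) (Poly_Mapping.lookup (Poly_Mapping.single (C i) (b i)) \<gamma>)) =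
    (\<Sum>i\<in>S. if C i = \<gamma> \<and> D i = \<delta> then b i else 0)"
    by (intro sum.cong) (auto simp: lookup_single when_def)
  also have "\<dots> = (\<Sum>i | i \<in> S \<and> C i = \<gamma> \<and> D i = \<delta>. b i)"
    using S(1) by (simp add: sum.inter_filter)
  finally show ?thesis .
qed

end

section \<open>Gradings and homogeneous families\<close>

locale graded_valued_algebra = valued_algebra scale v
  for scale :: "'k::field \<Rightarrow> 'b::idom \<Rightarrow> 'b" and v :: "'b \<Rightarrow> 'g::linordered_ab_group_add" +
  fixes A :: "'b set" and grd :: "'d::ab_group_add \<Rightarrow> 'b set"
  assumes subalgebra: "K_subalgebra (class_algebra scale) A"
    and grading: "is_grading scale A grd"
begin

interpretation T: record_algebra "GT :: ('k, ('g, 'b, 'd, 'k) gr_tensor) module"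
  by (rule record_algebra_GT)

interpretation R: record_algebra "class_algebra scale"
  by (rule record_algebra_class_algebra)

lemma grd_subspace: "subspace (grd \<delta>)" and grd_subset: "grd \<delta> \<subseteq> A"
  and grd_mult: "a \<in> grd \<delta> \<Longrightarrow> b \<in> grd \<epsilon> \<Longrightarrow> a * b \<in> grd (\<delta> + \<epsilon>)"
  using grading unfolding is_grading_def by blast+

lemmas grd_zero = subspace_0[OF grd_subspace]
  and grd_add = subspace_add[OF grd_subspace]
  and grd_diff = subspace_diff[OF grd_subspace]
  and grd_scale = subspace_scale[OF grd_subspace]
  and grd_sum = subspace_sum[OF grd_subspace]

lemma grd_decomposition:
  assumes "a \<in> A"
  obtains c :: "'d \<Rightarrow>\<^sub>0 'b" where "\<And>\<delta>. Poly_Mapping.lookup c \<delta> \<in> grd \<delta>"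
    "a = (\<Sum>\<delta>\<in>Poly_Mapping.keys c. Poly_Mapping.lookup c \<delta>)"
  using grading assms unfolding is_grading_def by blast

text \<open>The family \<open>c\<close>, cut off outside \<open>S\<close>, and the zero family both
  decompose 0, so uniqueness makes them agree.\<close>

lemma grd_independent:
  assumes "finite S" "\<And>\<delta>. \<delta> \<in> S \<Longrightarrow> c \<delta> \<in> grd \<delta>" "(\<Sum>\<delta>\<in>S. c \<delta>) = 0" "\<delta> \<in> S"
  shows "c \<delta> = 0"
proof -
  let ?c = "\<Sum>\<delta>\<in>S. Poly_Mapping.single \<delta> (c \<delta>)"
  have l: "Poly_Mapping.lookup ?c \<epsilon> = (if \<epsilon> \<in> S then c \<epsilon> else 0)" for \<epsilon>
    using assms(1) by (simp add: lookup_sum lookup_single when_def)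
  have "(\<Sum>\<delta>\<in>Poly_Mapping.keys ?c. Poly_Mapping.lookup ?c \<delta>) = (\<Sum>\<delta>\<in>S. c \<delta>)"
    using assms(1) l by (intro sum.mono_neutral_cong_left) (auto simp: in_keys_iff split: if_splits)
  then have 1: "(\<forall>\<delta>. Poly_Mapping.lookup ?c \<delta> \<in> grd \<delta>) \<and> 0 = (\<Sum>\<delta>\<in>Poly_Mapping.keys ?c. Poly_Mapping.lookup ?c \<delta>)"
    using assms(2,3) by (auto simp: l grd_zero)
  have 2: "(\<forall>\<delta>. Poly_Mapping.lookup (0 :: 'd \<Rightarrow>\<^sub>0 'b) \<delta> \<in> grd \<delta>) \<and>
      0 = (\<Sum>\<delta>\<in>Poly_Mapping.keys (0 :: 'd \<Rightarrow>\<^sub>0 'b). Poly_Mapping.lookup (0 :: 'd \<Rightarrow>\<^sub>0 'b) \<delta>)"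
    by (auto simp: grd_zero)
  have "0 \<in> A" using grd_zero grd_subset by blast
  then have "\<exists>!c :: 'd \<Rightarrow>\<^sub>0 'b. (\<forall>\<delta>. Poly_Mapping.lookup c \<delta> \<in> grd \<delta>) \<and>
      0 = (\<Sum>\<delta>\<in>Poly_Mapping.keys c. Poly_Mapping.lookup c \<delta>)"
    using grading unfolding is_grading_def by blast
  then have "?c = 0" using 1 2 by blast
  then show ?thesis using l[of \<delta>] assms(4) by simp
qed

lemma grd_projection:
  assumes "finite S" "\<And>\<delta>. \<delta> \<in> S \<Longrightarrow> c \<delta> \<in> grd \<delta>" "(\<Sum>\<delta>\<in>S. c \<delta>) = a" "a \<in> grd \<epsilon>" "\<epsilon> \<in> S"
  shows "c \<epsilon> = a"
proof -
  have "(\<Sum>\<delta>\<in>S. c \<delta> - (if \<delta> = \<epsilon> then a else 0)) = 0"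
    using assms by (simp add: sum_subtractf)
  then have "c \<epsilon> - (if \<epsilon> = \<epsilon> then a else 0) = 0"
    using assms by (intro grd_independent[of S "\<lambda>\<delta>. c \<delta> - (if \<delta> = \<epsilon> then a else 0)"])
      (auto intro!: grd_diff)
  then show ?thesis by simp
qed

lemma grd_unique: "a \<noteq> 0 \<Longrightarrow> a \<in> grd \<delta> \<Longrightarrow> a \<in> grd \<epsilon> \<Longrightarrow> \<delta> = \<epsilon>"
proof (rule ccontr)
  assume a: "a \<noteq> 0" "a \<in> grd \<delta>" "a \<in> grd \<epsilon>" "\<delta> \<noteq> \<epsilon>"
  have "(if \<epsilon> = \<delta> then a else 0) = a"
    by (rule grd_projection[of "{\<delta>, \<epsilon>}" "\<lambda>x. if x = \<delta> then a else 0"]) (use a in \<open>auto simp: grd_zero\<close>)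
  then show False using a by simp
qed

lemma hdegree_eq: "a \<noteq> 0 \<Longrightarrow> a \<in> grd \<delta> \<Longrightarrow> hdegree grd a = \<delta>"
  unfolding hdegree_def using grd_unique by blast

text \<open>The definition of a grading does not place 1 in degree 0; this follows because
  \<open>B\<close> is a domain. For a non-zero homogeneous component \<open>a\<close> of 1, of
  degree \<open>\<epsilon>\<close>, the part of \<open>a = a * 1\<close> in degree
  \<open>\<epsilon>\<close> is \<open>a\<close> times the degree-0 part of 1, so that part is
  1.\<close>

lemma one_grd: "1 \<in> grd 0"
proof -
  have "1 \<in> A" using subalgebra subringE(3)[of A "class_algebra scale"] by (simp add: K_subalgebra_def)
  from grd_decomposition[OF this]
  obtain e where e: "\<And>\<delta>. Poly_Mapping.lookup e \<delta> \<in> grd \<delta>"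
    "1 = (\<Sum>\<delta>\<in>Poly_Mapping.keys e. Poly_Mapping.lookup e \<delta>)" by blast
  have "Poly_Mapping.keys e \<noteq> {}" using e(2) by auto
  then obtain \<epsilon> where "\<epsilon> \<in> Poly_Mapping.keys e" by blast
  define a where "a = Poly_Mapping.lookup e \<epsilon>"
  have a: "a \<noteq> 0" "a \<in> grd \<epsilon>" using \<open>\<epsilon> \<in> Poly_Mapping.keys e\<close> e(1) by (auto simp: a_def in_keys_iff)
  \<comment> \<open>\<open>\<epsilon>\<close> is inserted because degree 0 is not yet known to occur
    among the components of 1.\<close>
  let ?S = "insert \<epsilon> ((+) \<epsilon> ` Poly_Mapping.keys e)"
  have "(\<Sum>\<delta>\<in>?S. a * Poly_Mapping.lookup e (\<delta> - \<epsilon>)) = (\<Sum>\<delta>\<in>(+) \<epsilon> ` Poly_Mapping.keys e. a * Poly_Mapping.lookup e (\<delta> - \<epsilon>))"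
    by (intro sum.mono_neutral_right) (auto simp: in_keys_iff image_iff)
  also have "\<dots> = a * 1"
    unfolding e(2) by (subst sum.reindex) (auto simp: sum_distrib_left)
  finally have "a * Poly_Mapping.lookup e (\<epsilon> - \<epsilon>) = a"
  proof (intro grd_projection[of ?S "\<lambda>\<delta>. a * Poly_Mapping.lookup e (\<delta> - \<epsilon>)" a \<epsilon>])
    show "a * Poly_Mapping.lookup e (\<delta> - \<epsilon>) \<in> grd \<delta>" for \<delta>
      using grd_mult[OF a(2) e(1)[of "\<delta> - \<epsilon>"]] by simp
  qed (auto simp: a)
  then have "Poly_Mapping.lookup e 0 = 1" using a(1) by simp
  then show ?thesis using e(1)[of 0] by simp
qed

lemma initial_form_hom_component:
  "a \<noteq> 0 \<Longrightarrow> a \<in> grd \<delta> \<Longrightarrow> initial_form_hom scale v grd a = component (v a) \<delta> a"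
proof -
  assume a: "a \<noteq> 0" "a \<in> grd \<delta>"
  have "initial_form v a = cls (Poly_Mapping.single (v a) a)"
    by (auto simp: initial_form_def cls_def lookup_single when_def gr_class_zero fun_eq_iff)
  then show ?thesis using hdegree_eq[OF a] by (simp add: initial_form_hom_def component_def)
qed

lemma finsum_component:
  assumes "finite S" "\<And>i. i \<in> S \<Longrightarrow> b i \<in> F_ge v \<gamma>"
  shows "(\<Oplus>\<^bsub>GT\<^esub>i\<in>S. component \<gamma> (\<delta> :: 'd) (b i)) = component \<gamma> \<delta> (\<Sum>i\<in>S. b i)"
  using assms
proof (induction S)
  case empty
  then show ?case by (simp add: component_zero)
next
  case (insert x S)
  have "(\<Oplus>\<^bsub>GT\<^esub>i\<in>insert x S. component \<gamma> \<delta> (b i)) =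
    component \<gamma> \<delta> (b x) \<oplus>\<^bsub>GT\<^esub> (\<Oplus>\<^bsub>GT\<^esub>i\<in>S. component \<gamma> \<delta> (b i))"
    using insert by (intro T.finsum_insert) (auto intro!: component_closed)
  then show ?case using insert by (simp add: component_add F_ge_sum)
qed

section \<open>Evaluation of polynomials in \<open>B\<close>\<close>

definition mon :: "('x \<Rightarrow> 'b) \<Rightarrow> ('x \<Rightarrow>\<^sub>0 nat) \<Rightarrow> 'b"
  where "mon \<sigma> t = (\<Prod>x\<in>Poly_Mapping.keys t. \<sigma> x ^ Poly_Mapping.lookup t x)"

abbreviation "ev \<sigma> \<equiv> mpoly_eval (class_algebra scale) \<sigma>"

lemma ev_eq: "ev \<sigma> p = (\<Sum>t\<in>Poly_Mapping.keys p. scale (Poly_Mapping.lookup p t) (mon \<sigma> t))"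
  by (simp add: mpoly_eval_class_algebra mon_def)

lemma ev_single: "ev \<sigma> (Poly_Mapping.single t c) = scale c (mon \<sigma> t)"
  by (cases "c = 0") (simp_all add: ev_eq)

lemma ev_add: "ev \<sigma> (p + q) = ev \<sigma> p + ev \<sigma> q"
  using R.mpoly_eval_add[of UNIV \<sigma> p q] by (simp add: mem_mpoly_ring)

lemma ev_zero: "ev \<sigma> 0 = 0"
  by (simp add: ev_eq)

lemma ev_diff: "ev \<sigma> (p - q) = ev \<sigma> p - ev \<sigma> q"
  using ev_add[of \<sigma> "p - q" q] by simp

lemma ev_sum: "ev \<sigma> (sum p S) = (\<Sum>i\<in>S. ev \<sigma> (p i))"
  by (induction S rule: infinite_finite_induct) (auto simp: ev_add ev_zero)

lemma ev_mult: "ev \<sigma> (p * q) = ev \<sigma> p * ev \<sigma> q"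
  using R.mpoly_eval_mult[of UNIV \<sigma> p q] by (simp add: mem_mpoly_ring)

lemma mon_add: "mon \<sigma> (s + t) = mon \<sigma> s * mon \<sigma> t"
  using ev_mult[of \<sigma> "Poly_Mapping.single s 1" "Poly_Mapping.single t 1"] by (simp add: mult_single ev_single)

lemma mon_zero: "mon \<sigma> 0 = 1"
  by (simp add: mon_def)

lemma mon_single: "mon \<sigma> (Poly_Mapping.single x n) = \<sigma> x ^ n"
  by (cases "n = 0") (simp_all add: mon_def)

end

text \<open>The index type stays open because two kinds of variables occur: the numbers 1 to
  \<open>k\<close> for the ideals, and the elements of \<open>G\<close> themselves, with the
  identity as \<open>\<sigma>\<close>, for the subduction polynomials.\<close>

locale homogeneous_family = graded_valued_algebra scale v A grd
  for scale :: "'k::field \<Rightarrow> 'b::idom \<Rightarrow> 'b" and v :: "'b \<Rightarrow> 'g::linordered_ab_group_add"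
    and A :: "'b set" and grd :: "'d::ab_group_add \<Rightarrow> 'b set" +
  fixes \<sigma> :: "'x \<Rightarrow> 'b" and V :: "'x set"
  assumes family: "\<And>x. x \<in> V \<Longrightarrow> \<sigma> x \<in> A \<and> \<sigma> x \<noteq> 0 \<and> homogeneous grd (\<sigma> x)"
begin

interpretation T: record_algebra "GT :: ('k, ('g, 'b, 'd, 'k) gr_tensor) module"
  by (rule record_algebra_GT)

interpretation R: record_algebra "class_algebra scale"
  by (rule record_algebra_class_algebra)

abbreviation weight :: "('x \<Rightarrow>\<^sub>0 nat) \<Rightarrow> 'g"
  where "weight \<equiv> monomial_degree (\<lambda>x. v (\<sigma> x))"

abbreviation deg :: "('x \<Rightarrow>\<^sub>0 nat) \<Rightarrow> 'd"
  where "deg \<equiv> monomial_degree (\<lambda>x. hdegree grd (\<sigma> x))"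

abbreviation "inev \<equiv> mpoly_eval (GT :: ('k, ('g, 'b, 'd, 'k) gr_tensor) module)
  (\<lambda>x. initial_form_hom scale v grd (\<sigma> x))"

lemma family_grd: "x \<in> V \<Longrightarrow> \<sigma> x \<in> grd (hdegree grd (\<sigma> x))"
  using family[of x] hdegree_eq[of "\<sigma> x"] unfolding homogeneous_def by blast

lemma initial_form_family:
  "x \<in> V \<Longrightarrow> initial_form_hom scale v grd (\<sigma> x) = component (v (\<sigma> x)) (hdegree grd (\<sigma> x)) (\<sigma> x)"
  using family family_grd by (intro initial_form_hom_component) auto

lemma initial_form_family_closed: "x \<in> V \<Longrightarrow> initial_form_hom scale v grd (\<sigma> x) \<in> carrier GT"
  by (simp add: initial_form_family component_closed F_ge_iff)

lemma inev_image: "inev ` carrier (mpoly_ring V) =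
    generated_algebra GT ((\<lambda>x. initial_form_hom scale v grd (\<sigma> x)) ` V)"
  by (rule T.mpoly_eval_image) (rule initial_form_family_closed)

lemma ideal_kernel_inev: "ideal (a_kernel (mpoly_ring V) GT inev) (mpoly_ring V)"
  by (rule T.ideal_kernel_mpoly_eval) (rule initial_form_family_closed)

lemma K_subalgebra_inev: "K_subalgebra GT (inev ` carrier (mpoly_ring V))"
  by (rule T.K_subalgebra_mpoly_eval_image) (rule initial_form_family_closed)

lemma initial_algebra_family: "initial_algebra scale v grd (\<sigma> ` V) = inev ` carrier (mpoly_ring V)"
  unfolding inev_image initial_algebra_def using family
  by (intro arg_cong[where f = "generated_algebra GT"]) auto

text \<open>\<open>B\<close> is a domain and \<open>v\<close> is additive on products, so the value
  of a monomial is exactly its weight. The facts are proved together because multiplying components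
  relies on the value of the monomial built so far.\<close>

lemma mon_facts:
  assumes "Poly_Mapping.keys t \<subseteq> V"
  shows "mon \<sigma> t \<noteq> 0 \<and> v (mon \<sigma> t) = weight t \<and> mon \<sigma> t \<in> grd (deg t) \<and>
    T.monomial (\<lambda>x. initial_form_hom scale v grd (\<sigma> x)) t = component (weight t) (deg t) (mon \<sigma> t)"
  using assms
proof (induction t rule: poly_mapping_nat_induct)
  case zero
  then show ?case using T.monomial_zero[of V "\<lambda>x. initial_form_hom scale v grd (\<sigma> x)", OF initial_form_family_closed]
    by (simp add: mon_zero v_one one_grd component_one)
next
  case (add x t)
  let ?in = "\<lambda>x. initial_form_hom scale v grd (\<sigma> x)"
  have "T.monomial ?in (Poly_Mapping.single x 1 + t) = T.monomial ?in (Poly_Mapping.single x 1) \<otimes>\<^bsub>GT\<^esub> T.monomial ?in t"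
    using add by (intro T.monomial_add[of V ?in, OF initial_form_family_closed]) auto
  also have "T.monomial ?in (Poly_Mapping.single x 1) = component (v (\<sigma> x)) (hdegree grd (\<sigma> x)) (\<sigma> x)"
    using T.monomial_single[of V ?in x, OF initial_form_family_closed] add(1) initial_form_family[of x] by simp
  also have "\<dots> \<otimes>\<^bsub>GT\<^esub> T.monomial ?in t = component (v (\<sigma> x) + weight t) (hdegree grd (\<sigma> x) + deg t) (\<sigma> x * mon \<sigma> t)"
    using add.IH by (simp add: component_mult F_ge_iff)
  finally show ?case
    using add family_grd[of x] family[of x] grd_mult
    by (simp add: mon_add mon_single v_mult monomial_degree_add monomial_degree_single lessThan_Suc)
qed

lemma inev_eq:
  assumes "p \<in> carrier (mpoly_ring V)"
  shows "inev p = (\<Oplus>\<^bsub>GT\<^esub>t\<in>Poly_Mapping.keys p. component (weight t) (deg t) (scale (Poly_Mapping.lookup p t) (mon \<sigma> t)))"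
  unfolding T.mpoly_eval_monomial
  by (rule T.finsum_cong')
    (use assms mon_facts in \<open>auto simp: mem_mpoly_ring component_smult F_ge_iff intro!: component_closed F_ge_scale\<close>)

lemma ev_grd:
  assumes "p \<in> carrier (mpoly_ring V)" "\<And>t. t \<in> Poly_Mapping.keys p \<Longrightarrow> deg t = \<delta>"
  shows "ev \<sigma> p \<in> grd \<delta>"
proof -
  have "mon \<sigma> t \<in> grd \<delta>" if "t \<in> Poly_Mapping.keys p" for t
    using assms that mon_facts[of t] by (auto simp: mem_mpoly_ring)
  then show ?thesis unfolding ev_eq by (intro grd_sum grd_scale)
qed

lemma ev_F_ge:
  assumes "p \<in> carrier (mpoly_ring V)" "\<And>t. t \<in> Poly_Mapping.keys p \<Longrightarrow> \<gamma> \<le> weight t"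
  shows "ev \<sigma> p \<in> F_ge v \<gamma>"
  unfolding ev_eq using assms mon_facts by (intro F_ge_sum F_ge_scale) (auto simp: mem_mpoly_ring F_ge_iff)

lemma ev_F_gt:
  assumes "p \<in> carrier (mpoly_ring V)" "\<And>t. t \<in> Poly_Mapping.keys p \<Longrightarrow> \<gamma> < weight t"
  shows "ev \<sigma> p \<in> F_gt v \<gamma>"
  unfolding ev_eq using assms mon_facts by (intro F_gt_sum F_gt_scale) (auto simp: mem_mpoly_ring F_gt_iff)

text \<open>All terms lie in one bidegree, so their sum can be formed in \<open>B\<close> before
  passing to the class. The value of \<open>ev \<sigma> p\<close> may exceed
  \<open>\<gamma>\<close>, and then both sides are zero.\<close>

lemma inev_bihomogeneous:
  assumes p: "p \<in> carrier (mpoly_ring V)"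
    and h: "\<And>t. t \<in> Poly_Mapping.keys p \<Longrightarrow> weight t = \<gamma> \<and> deg t = \<delta>"
  shows "inev p = component \<gamma> \<delta> (ev \<sigma> p)"
proof -
  have m: "mon \<sigma> t \<in> F_ge v \<gamma>" if "t \<in> Poly_Mapping.keys p" for t
    using that p h mon_facts[of t] by (auto simp: mem_mpoly_ring F_ge_iff)
  have "inev p = (\<Oplus>\<^bsub>GT\<^esub>t\<in>Poly_Mapping.keys p. component \<gamma> \<delta> (scale (Poly_Mapping.lookup p t) (mon \<sigma> t)))"
    unfolding inev_eq[OF p] by (rule T.finsum_cong') (auto simp: h intro!: component_closed F_ge_scale m)
  then show ?thesis
    unfolding ev_eq by (simp add: finsum_component F_ge_scale m)
qed

abbreviation "bipart \<gamma> \<delta> \<equiv> select_terms (\<lambda>t. weight t = \<gamma> \<and> deg t = \<delta>)"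

text \<open>Left to right is the independence of bidegrees. For the converse, the kernel is an ideal
  and \<open>p\<close> is the finite sum of its bihomogeneous parts.\<close>

lemma inev_eq_zero_iff:
  assumes p: "p \<in> carrier (mpoly_ring V)"
  shows "inev p = \<zero>\<^bsub>GT\<^esub> \<longleftrightarrow> (\<forall>\<gamma> \<delta>. ev \<sigma> (bipart \<gamma> \<delta> p) \<in> F_gt v \<gamma>)"
proof
  assume "inev p = \<zero>\<^bsub>GT\<^esub>"
  then have z: "(\<Oplus>\<^bsub>GT\<^esub>t\<in>Poly_Mapping.keys p. component (weight t) (deg t) (scale (Poly_Mapping.lookup p t) (mon \<sigma> t))) = \<zero>\<^bsub>GT\<^esub>"
    by (simp add: inev_eq[OF p])
  have "(\<Sum>t | t \<in> Poly_Mapping.keys p \<and> weight t = \<gamma> \<and> deg t = \<delta>. scale (Poly_Mapping.lookup p t) (mon \<sigma> t)) \<in> F_gt v \<gamma>" for \<gamma> \<delta>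
    by (rule component_sum_eq_zeroD[OF _ _ z])
      (use p mon_facts in \<open>auto simp: mem_mpoly_ring F_ge_iff[of "mon \<sigma> t" for t] intro!: F_ge_scale\<close>)
  moreover have "ev \<sigma> (bipart \<gamma> \<delta> p) =
      (\<Sum>t | t \<in> Poly_Mapping.keys p \<and> weight t = \<gamma> \<and> deg t = \<delta>. scale (Poly_Mapping.lookup p t) (mon \<sigma> t))" for \<gamma> \<delta>
    unfolding ev_eq keys_select_terms by (rule sum.cong) (auto simp: lookup_select_terms)
  ultimately show "\<forall>\<gamma> \<delta>. ev \<sigma> (bipart \<gamma> \<delta> p) \<in> F_gt v \<gamma>" by simp
next
  assume *: "\<forall>\<gamma> \<delta>. ev \<sigma> (bipart \<gamma> \<delta> p) \<in> F_gt v \<gamma>"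
  let ?J = "a_kernel (mpoly_ring V) GT inev"
  have "bipart \<gamma> \<delta> p \<in> ?J" for \<gamma> \<delta>
  proof -
    have "bipart \<gamma> \<delta> p \<in> carrier (mpoly_ring V)" by (rule select_terms_mpoly_ring[OF p])
    moreover from this have "inev (bipart \<gamma> \<delta> p) = component \<gamma> \<delta> (ev \<sigma> (bipart \<gamma> \<delta> p))"
      by (rule inev_bihomogeneous) (auto simp: keys_select_terms)
    ultimately show ?thesis
      using * by (simp add: a_kernel_def' component_eq_zero)
  qed
  then have "(\<Sum>s\<in>(\<lambda>t. (weight t, deg t)) ` Poly_Mapping.keys p. select_terms (\<lambda>t. (weight t, deg t) = s) p) \<in> ?J"
    by (intro ideal_sum_mem[OF ideal_kernel_inev]) auto
  then have "p \<in> ?J" by (simp add: sum_select_terms)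
  then show "inev p = \<zero>\<^bsub>GT\<^esub>" by (simp add: a_kernel_def')
qed

text \<open>By uniqueness of the homogeneous decomposition the other degree parts contribute
  nothing. As 0 lies in every \<open>grd \<epsilon>\<close>, this also shows that each
  \<open>\<Delta>\<close>-homogeneous part of a relation is a relation.\<close>

lemma ev_degree_part:
  assumes p: "p \<in> carrier (mpoly_ring V)"
  shows "ev \<sigma> p \<in> grd \<epsilon> \<Longrightarrow> ev \<sigma> (select_terms (\<lambda>t. deg t = \<epsilon>) p) = ev \<sigma> p"
proof -
  assume a: "ev \<sigma> p \<in> grd \<epsilon>"
  let ?S = "insert \<epsilon> (deg ` Poly_Mapping.keys p)"
  show ?thesis
  proof (rule grd_projection[of ?S "\<lambda>\<delta>. ev \<sigma> (select_terms (\<lambda>t. deg t = \<delta>) p)"])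
    show "ev \<sigma> (select_terms (\<lambda>t. deg t = \<delta>) p) \<in> grd \<delta>" for \<delta>
      by (rule ev_grd[OF select_terms_mpoly_ring[OF p]]) (simp add: keys_select_terms)
    show "(\<Sum>\<delta>\<in>?S. ev \<sigma> (select_terms (\<lambda>t. deg t = \<delta>) p)) = ev \<sigma> p"
      unfolding ev_sum[symmetric] by (subst sum_select_terms) auto
  qed (use a in auto)
qed

lemma initial_poly_minimal_weight:
  assumes "t0 \<in> Poly_Mapping.keys p" "\<And>t. t \<in> Poly_Mapping.keys p \<Longrightarrow> weight t0 \<le> weight t"
  shows "initial_poly (\<lambda>x. v (\<sigma> x)) p = select_terms (\<lambda>t. weight t = weight t0) p"
  unfolding initial_poly_eq_select_terms
  by (rule select_terms_cong) (use assms in \<open>auto intro: antisym\<close>)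

lemma obtain_minimal_weight:
  assumes "p \<noteq> 0"
  obtains t0 where "t0 \<in> Poly_Mapping.keys p" "\<And>t. t \<in> Poly_Mapping.keys p \<Longrightarrow> weight t0 \<le> weight t"
proof -
  have ne: "weight ` Poly_Mapping.keys p \<noteq> {}" using assms by auto
  have "Min (weight ` Poly_Mapping.keys p) \<in> weight ` Poly_Mapping.keys p" using ne by (intro Min_in) auto
  then obtain t0 where "t0 \<in> Poly_Mapping.keys p" "weight t0 = Min (weight ` Poly_Mapping.keys p)" by auto
  then show ?thesis by (intro that[of t0]) auto
qed

section \<open>The ideals \<open>I\<close>, \<open>J\<close> and the initial ideal of
  \<open>I\<close>\<close>

abbreviation "kerI \<equiv> a_kernel (mpoly_ring V) (class_algebra scale) (ev \<sigma>)"
abbreviation "kerJ \<equiv> a_kernel (mpoly_ring V) (GT :: ('k, ('g, 'b, 'd, 'k) gr_tensor) module) inev"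
abbreviation "inI \<equiv> Idl\<^bsub>mpoly_ring V\<^esub> {initial_poly (\<lambda>x. v (\<sigma> x)) h | h. h \<in> kerI}"

lemma mem_kerI: "p \<in> kerI \<longleftrightarrow> p \<in> carrier (mpoly_ring V) \<and> ev \<sigma> p = 0"
  by (simp add: a_kernel_def')

lemma mem_kerJ: "p \<in> kerJ \<longleftrightarrow> p \<in> carrier (mpoly_ring V) \<and> (\<forall>\<gamma> \<delta>. ev \<sigma> (bipart \<gamma> \<delta> p) \<in> F_gt v \<gamma>)"
  using inev_eq_zero_iff by (auto simp: a_kernel_def')

lemma bipart_kerJ: "p \<in> kerJ \<Longrightarrow> bipart \<gamma> \<delta> p \<in> kerJ"
proof -
  assume p: "p \<in> kerJ"
  have "ev \<sigma> (bipart \<gamma>' \<delta>' (bipart \<gamma> \<delta> p)) \<in> F_gt v \<gamma>'" for \<gamma>' \<delta>'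
  proof (cases "\<gamma>' = \<gamma> \<and> \<delta>' = \<delta>")
    case True
    then have "bipart \<gamma>' \<delta>' (bipart \<gamma> \<delta> p) = bipart \<gamma> \<delta> p"
      by (intro poly_mapping_eqI) (simp add: lookup_select_terms)
    then show ?thesis using p True by (simp add: mem_kerJ)
  next
    case False
    then have "bipart \<gamma>' \<delta>' (bipart \<gamma> \<delta> p) = 0"
      by (intro poly_mapping_eqI) (auto simp: lookup_select_terms)
    then show ?thesis by (simp add: ev_zero)
  qed
  then show ?thesis using p by (simp add: mem_kerJ select_terms_mpoly_ring)
qed

lemma ideal_kerI: "ideal kerI (mpoly_ring V)"
  by (rule R.ideal_kernel_mpoly_eval) simp

lemma initial_polys_carrier: "{initial_poly (\<lambda>x. v (\<sigma> x)) h | h. h \<in> kerI} \<subseteq> carrier (mpoly_ring V)"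
  by (auto simp: initial_poly_eq_select_terms mem_kerI intro!: select_terms_mpoly_ring)

lemma inI_subset_kerJ: "inI \<subseteq> kerJ"
proof -
  interpret P: cring "mpoly_ring V :: ('x, 'k) mpoly ring" by (rule cring_mpoly_ring)
  have "initial_poly (\<lambda>x. v (\<sigma> x)) h \<in> kerJ" if h: "h \<in> kerI" for h
  proof (cases "h = 0")
    case True
    then show ?thesis by (simp add: initial_poly_eq_select_terms mem_kerJ ev_zero mpoly_ring_zero)
  next
    case False
    have hc: "h \<in> carrier (mpoly_ring V)" using h by (simp add: mem_kerI)
    obtain t0 where t0: "t0 \<in> Poly_Mapping.keys h" "\<And>t. t \<in> Poly_Mapping.keys h \<Longrightarrow> weight t0 \<le> weight t"
      using obtain_minimal_weight[OF False] by blast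
    have "ev \<sigma> (bipart \<gamma> \<delta> (select_terms (\<lambda>t. weight t = weight t0) h)) \<in> F_gt v \<gamma>" for \<gamma> \<delta>
    proof (cases "\<gamma> = weight t0")
      case False
      then have "bipart \<gamma> \<delta> (select_terms (\<lambda>t. weight t = weight t0) h) = 0"
        by (intro poly_mapping_eqI) (simp add: lookup_select_terms)
      then show ?thesis by (simp add: ev_zero)
    next
      case True
      \<comment> \<open>The \<open>\<delta>\<close>-part of the relation \<open>h\<close> is again a
        relation, so its lowest terms evaluate to the negative of the rest, whose terms all have
        weight above \<open>\<gamma>\<close>.\<close>
      let ?hi = "select_terms (\<lambda>t. weight t \<noteq> \<gamma> \<and> deg t = \<delta>) h"
      have "select_terms (\<lambda>t. deg t = \<delta>) h = bipart \<gamma> \<delta> (select_terms (\<lambda>t. weight t = weight t0) h) + ?hi"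
        by (intro poly_mapping_eqI) (simp add: lookup_select_terms lookup_add True)
      moreover have "ev \<sigma> (select_terms (\<lambda>t. deg t = \<delta>) h) = 0"
        using ev_degree_part[OF hc, of \<delta>] h by (simp add: mem_kerI grd_zero)
      ultimately have "ev \<sigma> (bipart \<gamma> \<delta> (select_terms (\<lambda>t. weight t = weight t0) h)) = - ev \<sigma> ?hi"
        by (simp add: ev_add eq_neg_iff_add_eq_0)
      also have "\<dots> \<in> F_gt v \<gamma>"
        unfolding F_uminus using t0(2)
        by (intro ev_F_gt select_terms_mpoly_ring[OF hc]) (auto simp: keys_select_terms True order.strict_iff_order)
      finally show ?thesis .
    qed
    moreover have "initial_poly (\<lambda>x. v (\<sigma> x)) h = select_terms (\<lambda>t. weight t = weight t0) h"
      by (rule initial_poly_minimal_weight) (use t0 in auto)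
    ultimately show ?thesis
      by (simp add: mem_kerJ select_terms_mpoly_ring[OF hc])
  qed
  then show ?thesis by (intro P.genideal_minimal ideal_kernel_inev) auto
qed

lemma select_terms_single_mult:
  fixes p :: "('x, 'k) mpoly"
  shows "select_terms Q (Poly_Mapping.single t c * p) = Poly_Mapping.single t c * select_terms (\<lambda>s. Q (t + s)) p"
proof -
  have "p \<in> carrier (mpoly_ring UNIV)" by (simp add: mem_mpoly_ring)
  then show ?thesis
  proof (induction p rule: mpoly_induct)
    case (add s d p)
    have *: "select_terms Q' (Poly_Mapping.single s d) = (if Q' s then Poly_Mapping.single s d else 0)"
      for Q' and s :: "'x \<Rightarrow>\<^sub>0 nat" and d :: 'k
      by (rule poly_mapping_eqI) (auto simp: lookup_select_terms lookup_single when_def)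
    show ?case using add.IH by (simp add: distrib_left select_terms_add mult_single *)
  qed simp
qed

text \<open>Stated through the difference, since the bihomogeneous part of \<open>p\<close> may vanish.\<close>

lemma inI_lift:
  assumes "p \<in> inI"
  shows "\<exists>g\<in>kerI. \<forall>t\<in>Poly_Mapping.keys (g - bipart \<gamma> \<delta> p). \<gamma> < weight t \<and> deg t = \<delta>"
proof -
  interpret P: cring "mpoly_ring V :: ('x, 'k) mpoly ring" by (rule cring_mpoly_ring)
  note ID = ideal_mpoly_ringD[OF ideal_kerI]
  \<comment> \<open>Requiring the lifting property in all bidegrees at once makes it stable under
    multiplication by terms, which shift the bidegree. So \<open>Z\<close> is an ideal, and only the
    generators of \<open>inI\<close> remain to be treated.\<close>
  define Z where "Z = {p \<in> carrier (mpoly_ring V). \<forall>\<gamma> \<delta>. \<exists>g\<in>kerI.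
    \<forall>t\<in>Poly_Mapping.keys (g - bipart \<gamma> \<delta> p). \<gamma> < weight t \<and> deg t = \<delta>}"
  have "ideal Z (mpoly_ring V)"
  proof (rule ideal_mpoly_ringI)
    show "0 \<in> Z" using ID(2) by (auto simp: Z_def mpoly_ring_zero intro!: bexI[of _ 0])
    show "p + q \<in> Z" if pq: "p \<in> Z" "q \<in> Z" for p q
    proof -
      have "\<exists>g\<in>kerI. \<forall>t\<in>Poly_Mapping.keys (g - bipart \<gamma> \<delta> (p + q)). \<gamma> < weight t \<and> deg t = \<delta>" for \<gamma> \<delta>
      proof -
        obtain g where g: "g \<in> kerI" "\<forall>t\<in>Poly_Mapping.keys (g - bipart \<gamma> \<delta> p). \<gamma> < weight t \<and> deg t = \<delta>"
          using pq unfolding Z_def by blast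
        obtain g' where g': "g' \<in> kerI" "\<forall>t\<in>Poly_Mapping.keys (g' - bipart \<gamma> \<delta> q). \<gamma> < weight t \<and> deg t = \<delta>"
          using pq unfolding Z_def by blast
        have "(g + g') - bipart \<gamma> \<delta> (p + q) = (g - bipart \<gamma> \<delta> p) + (g' - bipart \<gamma> \<delta> q)"
          by (simp add: select_terms_add)
        then have "Poly_Mapping.keys ((g + g') - bipart \<gamma> \<delta> (p + q)) \<subseteq>
            Poly_Mapping.keys (g - bipart \<gamma> \<delta> p) \<union> Poly_Mapping.keys (g' - bipart \<gamma> \<delta> q)"
          by (simp only: keys_add)
        then have "\<forall>t\<in>Poly_Mapping.keys ((g + g') - bipart \<gamma> \<delta> (p + q)). \<gamma> < weight t \<and> deg t = \<delta>"
          using g(2) g'(2) by (meson UnE subsetD)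
        then show ?thesis using ID(3)[OF g(1) g'(1)] by (rule bexI)
      qed
      then show ?thesis using pq by (simp add: Z_def mpoly_ring_closed(1))
    qed
    show "Poly_Mapping.single t c * p \<in> Z" if t: "Poly_Mapping.keys t \<subseteq> V" and p: "p \<in> Z" for t c p
    proof -
      have "\<exists>g\<in>kerI. \<forall>s\<in>Poly_Mapping.keys (g - bipart \<gamma> \<delta> (Poly_Mapping.single t c * p)). \<gamma> < weight s \<and> deg s = \<delta>" for \<gamma> \<delta>
      proof -
        let ?b = "bipart (\<gamma> - weight t) (\<delta> - deg t) p"
        obtain g where g: "g \<in> kerI" "\<forall>s\<in>Poly_Mapping.keys (g - ?b). \<gamma> - weight t < weight s \<and> deg s = \<delta> - deg t"
          using p unfolding Z_def by blast
        have "bipart \<gamma> \<delta> (Poly_Mapping.single t c * p) = Poly_Mapping.single t c * ?b"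
          unfolding select_terms_single_mult monomial_degree_add
          by (rule arg_cong[where f = "(*) (Poly_Mapping.single t c)"], rule select_terms_cong)
            (auto simp: algebra_simps)
        then have eq: "Poly_Mapping.single t c * g - bipart \<gamma> \<delta> (Poly_Mapping.single t c * p) = Poly_Mapping.single t c * (g - ?b)"
          by (simp add: right_diff_distrib)
        have "\<gamma> < weight s \<and> deg s = \<delta>" if s: "s \<in> Poly_Mapping.keys (Poly_Mapping.single t c * (g - ?b))" for s
        proof -
          obtain s' where "s = t + s'" "s' \<in> Poly_Mapping.keys (g - ?b)"
            using subsetD[OF keys_single_mult_subset s] by (rule imageE)
          moreover from this have "\<gamma> - weight t < weight s'" "deg s' = \<delta> - deg t" using g(2) by blast+
          ultimately show ?thesis by (simp add: monomial_degree_add diff_less_eq add.commute)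
        qed
        moreover have "Poly_Mapping.single t c * g \<in> kerI" by (rule ID(5)[OF mpoly_ring_single[OF t] g(1)])
        ultimately show ?thesis unfolding eq[symmetric] by blast
      qed
      moreover have "Poly_Mapping.single t c * p \<in> carrier (mpoly_ring V)"
        using p t by (auto simp: Z_def intro!: mpoly_ring_closed(3) mpoly_ring_single)
      ultimately show ?thesis by (simp add: Z_def)
    qed
  qed (auto simp: Z_def)
  moreover have "initial_poly (\<lambda>x. v (\<sigma> x)) h \<in> Z" if h: "h \<in> kerI" for h
  proof (cases "h = 0")
    case True
    then show ?thesis using ID(2) by (auto simp: Z_def initial_poly_eq_select_terms mpoly_ring_zero intro!: bexI[of _ 0])
  next
    case False
    have hc: "h \<in> carrier (mpoly_ring V)" using h by (simp add: mem_kerI)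
    obtain t0 where t0: "t0 \<in> Poly_Mapping.keys h" "\<And>t. t \<in> Poly_Mapping.keys h \<Longrightarrow> weight t0 \<le> weight t"
      using obtain_minimal_weight[OF False] by blast
    have "\<exists>g\<in>kerI. \<forall>t\<in>Poly_Mapping.keys (g - bipart \<gamma> \<delta> (select_terms (\<lambda>t. weight t = weight t0) h)). \<gamma> < weight t \<and> deg t = \<delta>" for \<gamma> \<delta>
    proof (cases "\<gamma> = weight t0")
      case False
      then have "bipart \<gamma> \<delta> (select_terms (\<lambda>t. weight t = weight t0) h) = 0"
        by (intro poly_mapping_eqI) (simp add: lookup_select_terms)
      then show ?thesis using ID(2) by (intro bexI[of _ 0]) auto
    next
      case True
      \<comment> \<open>The \<open>\<delta>\<close>-part of \<open>h\<close> is the lift: it is a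
        relation, its terms of weight \<open>\<gamma>\<close> are the given bihomogeneous part, and
        its other terms are heavier.\<close>
      let ?g = "select_terms (\<lambda>t. deg t = \<delta>) h"
      have "?g - bipart \<gamma> \<delta> (select_terms (\<lambda>t. weight t = weight t0) h) = select_terms (\<lambda>t. weight t \<noteq> \<gamma> \<and> deg t = \<delta>) h"
        by (intro poly_mapping_eqI) (simp add: lookup_select_terms lookup_minus True)
      then have "\<forall>t\<in>Poly_Mapping.keys (?g - bipart \<gamma> \<delta> (select_terms (\<lambda>t. weight t = weight t0) h)). \<gamma> < weight t \<and> deg t = \<delta>"
        using t0(2) by (auto simp: keys_select_terms True order.strict_iff_order)
      moreover have "?g \<in> kerI"
        using ev_degree_part[OF hc, of \<delta>] h by (simp add: mem_kerI grd_zero select_terms_mpoly_ring)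
      ultimately show ?thesis by blast
    qed
    moreover have "initial_poly (\<lambda>x. v (\<sigma> x)) h = select_terms (\<lambda>t. weight t = weight t0) h"
      by (rule initial_poly_minimal_weight) (use t0 in auto)
    ultimately show ?thesis
      by (simp add: Z_def select_terms_mpoly_ring[OF hc])
  qed
  ultimately have "inI \<subseteq> Z" by (intro P.genideal_minimal) auto
  then show ?thesis using assms unfolding Z_def by blast
qed

end

section \<open>Subduction\<close>

context graded_valued_algebra
begin

text \<open>An invariant rule for the remainder. Value and degree of a term are those of its
  monomial, so the condition on \<open>h\<close> is passed on without coefficients. The degree
  \<open>\<delta>\<close> is carried along because \<open>valid_rule\<close> constrains the choice
  only at homogeneous remainders.\<close>

lemma subduction_induct:
  assumes rule: "valid_rule scale v A grd \<rho>" and input: "subduction_input A grd a G" and a: "a \<in> grd \<delta>"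
    and run: "subduction scale v grd \<rho> a G = Some (G', q, r)"
    and init: "P a"
    and step: "\<And>r h. P r \<Longrightarrow> r \<in> grd \<delta> \<Longrightarrow> subduction_continues scale v grd G r \<Longrightarrow>
      (\<And>t. t \<in> Poly_Mapping.keys h \<Longrightarrow> Poly_Mapping.keys t \<subseteq> G \<and> v r \<le> v (mon (\<lambda>g. g) t) \<and> mon (\<lambda>g. g) t \<in> grd \<delta>) \<Longrightarrow>
      P (r - ev (\<lambda>g. g) h)"
  shows "P r \<and> r \<in> grd \<delta> \<and> \<not> subduction_continues scale v grd G r"
proof -
  interpret G: homogeneous_family scale v A grd "\<lambda>g. g" G
    by unfold_locales (use input in \<open>auto simp: subduction_input_def\<close>)
  let ?b = "\<lambda>(G' :: 'b set, h :: ('b, 'k) mpoly, r). subduction_continues scale v grd G r"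
  let ?Q = "\<lambda>s :: ('b, 'k) subduction_state. P (snd (snd s)) \<and> snd (snd s) \<in> grd \<delta>"
  have "?Q (G', q, r)"
  proof (rule while_option_rule[where P = ?Q and b = ?b])
    show "while_option ?b (subduction_step scale \<rho> a G) ({}, 0, a) = Some (G', q, r)"
      using run by (simp add: subduction_def)
    show "?Q ({}, 0, a)" using init a by simp
    fix s :: "('b, 'k) subduction_state" assume s: "?Q s" "?b s"
    obtain G1 h1 r1 where s1: "s = (G1, h1, r1)" by (cases s)
    have r1: "P r1" "r1 \<in> grd \<delta>" and cont: "subduction_continues scale v grd G r1" using s s1 by auto
    obtain F h' where Fh: "\<rho> a G (G1, h1, r1) = (F, h')" by (cases "\<rho> a G (G1, h1, r1)")
    have "r1 \<in> A" "homogeneous grd r1" using r1(2) grd_subset by (auto simp: homogeneous_def)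
    then have vc: "valid_choice scale v grd G r1 F h'"
      using rule input cont Fh unfolding valid_rule_def by (metis case_prod_conv)
    have r1n: "r1 \<noteq> 0" using cont by (simp add: subduction_continues_def)
    have t: "Poly_Mapping.keys t \<subseteq> G \<and> v r1 \<le> v (mon (\<lambda>g. g) t) \<and> mon (\<lambda>g. g) t \<in> grd \<delta>"
      if t: "t \<in> Poly_Mapping.keys h'" for t
    proof -
      have tG: "Poly_Mapping.keys t \<subseteq> G" using vc t unfolding valid_choice_def mem_mpoly_ring by blast
      let ?c = "Poly_Mapping.lookup h' t"
      have c: "?c \<noteq> 0" using t by (simp add: in_keys_iff)
      have m: "mon (\<lambda>g. g) t \<noteq> 0" "mon (\<lambda>g. g) t \<in> grd (G.deg t)" using G.mon_facts[OF tG] by auto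
      have b: "v r1 \<le> v (scale ?c (mon (\<lambda>g. g) t))" "hdegree grd (scale ?c (mon (\<lambda>g. g) t)) = hdegree grd r1"
        using vc t unfolding valid_choice_def Let_def ev_single by blast+
      have "hdegree grd (scale ?c (mon (\<lambda>g. g) t)) = G.deg t"
        using m c by (intro hdegree_eq grd_scale) auto
      then have "G.deg t = \<delta>" using b(2) hdegree_eq[OF r1n r1(2)] by simp
      then show ?thesis using tG b(1) m v_scale[OF c m(1)] by simp
    qed
    then have "ev (\<lambda>g. g) h' \<in> grd \<delta>"
      unfolding ev_eq by (intro grd_sum grd_scale) auto
    moreover have "P (r1 - ev (\<lambda>g. g) h')" by (rule step[OF r1 cont t])
    ultimately show "?Q (subduction_step scale \<rho> a G s)"
      using r1(2) by (simp add: s1 subduction_step_def Fh grd_diff)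
  qed
  moreover have "\<not> ?b (G', q, r)"
    using run unfolding subduction_def by (rule while_option_stop)
  ultimately show ?thesis by simp
qed

subsection \<open>Termination and elements of degree zero\<close>

text \<open>Remainders are tracked as formal polynomials in \<open>z\<close>, where non-vanishing
  can be decided by degree, before they are evaluated in \<open>B\<close>.\<close>

definition peval :: "'b \<Rightarrow> 'k poly \<Rightarrow> 'b"
  where "peval z p = poly (map_poly (\<lambda>c. scale c 1) p) z"

lemma peval_0 [simp]: "peval z 0 = 0"
  by (simp add: peval_def)

lemma peval_pCons [simp]: "peval z (pCons c p) = scale c 1 + z * peval z p"
  by (simp add: peval_def map_poly_pCons)

lemma peval_add: "peval z (p + q) = peval z p + peval z q"
  by (induction p q rule: poly_induct2) (simp_all add: scale_left_distrib algebra_simps)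

lemma scale_mult_right: "x * scale c y = scale c (x * y)"
  using scale_mult_left[of c y x] by (simp add: mult.commute)

lemma peval_smult: "peval z (Polynomial.smult c p) = scale c (peval z p)"
  by (induction p) (simp_all add: scale_right_distrib scale_mult_right)

lemma peval_diff: "peval z (p - q) = peval z p - peval z q"
  using peval_add[of z "p - q" q] by simp

lemma peval_mult: "peval z (p * q) = peval z p * peval z q"
  by (induction p) (simp_all add: peval_add peval_smult algebra_simps scale_mult_left)

lemma peval_power: "peval z (p ^ n) = peval z p ^ n"
  by (induction n) (simp_all add: peval_mult one_pCons)

lemma peval_grd: "z \<in> grd 0 \<Longrightarrow> peval z p \<in> grd 0"
  by (induction p) (auto simp: grd_zero intro!: grd_add grd_scale one_grd grd_mult[of _ 0 _ 0, simplified])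

lemma F_gt_close:
  assumes "b \<noteq> 0" "a - b \<in> F_gt v (v b)"
  shows "a \<noteq> 0 \<and> v a = v b"
proof -
  have b: "b \<notin> F_gt v (v b)" using assms(1) by (simp add: F_gt_iff)
  have "a \<notin> F_gt v (v b)" using F_gt_diff[of a "v b" "a - b"] assms(2) b by auto
  moreover have "a \<in> F_ge v (v b)" using F_ge_add[of "a - b" "v b" b] F_gt_imp_F_ge[OF assms(2)] by (simp add: F_ge_iff)
  ultimately show ?thesis by (auto simp: F_ge_iff F_gt_iff)
qed

text \<open>Higher powers of \<open>z\<close> have strictly larger value, so the lowest non-zero
  term decides. In particular \<open>z\<close> is transcendental over \<open>K\<close>.\<close>

lemma peval_lowest_term:
  assumes z: "z \<noteq> 0" "0 < v z" and "p \<noteq> 0"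
  shows "\<exists>n c. c \<noteq> 0 \<and> peval z p - scale c (z ^ n) \<in> F_gt v (v (z ^ n))"
  using assms(3)
proof (induction p)
  case (pCons a p)
  have ge: "peval z q \<in> F_ge v 0" for q
    using z by (induction q)
      (auto intro!: F_ge_add F_ge_scale F_ge_mult[of _ 0 _ 0, simplified] simp: F_ge_iff[of 1] F_ge_iff[of z] v_one)
  show ?case
  proof (cases "a = 0")
    case False
    have "z * peval z p \<in> F_ge v (v z + 0)"
      by (rule F_ge_mult[OF _ ge]) (simp add: F_ge_iff)
    then have "z * peval z p \<in> F_gt v 0" using z by (auto simp: F_ge_iff F_gt_iff)
    then show ?thesis using False by (intro exI[of _ 0] exI[of _ a]) (simp add: v_one)
  next
    case True
    then obtain n c where nc: "c \<noteq> 0" "peval z p - scale c (z ^ n) \<in> F_gt v (v (z ^ n))"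
      using pCons by auto
    have "z * (peval z p - scale c (z ^ n)) \<in> F_gt v (v z + v (z ^ n))"
      by (rule F_gt_mult(2)[OF _ nc(2)]) (simp add: F_ge_iff)
    then have "peval z (pCons a p) - scale c (z ^ Suc n) \<in> F_gt v (v (z ^ Suc n))"
      using True z by (simp add: right_diff_distrib scale_mult_right v_mult)
    then show ?thesis using nc(1) by blast
  qed
qed simp

text \<open>Parity: composition with a quadratic polynomial doubles the degree.\<close>

lemma no_X_in_quadratic_subring: "[:0, 1:] - pcompose q [:0, 1, -1:] \<noteq> (0 :: 'k poly)"
proof
  assume "[:0, 1:] - pcompose q [:0, 1, -1:] = 0"
  then have "Polynomial.degree (pcompose q [:0, 1, -1:]) = Polynomial.degree [:0, 1 :: 'k:]" by simp
  then have "Polynomial.degree q + Polynomial.degree q = 1" by (simp add: degree_pcompose)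
  then show False by presburger
qed

lemma pcompose_X_power: "pcompose ([:0, 1:] ^ n) g = (g :: 'k poly) ^ n"
  by (induction n) (simp_all add: pcompose_mult pcompose_1 pcompose_pCons)

text \<open>
  Subduction of \<open>z\<close> by \<open>z - z\<^sup>2\<close> would replace the remainder by elements of \<open>z + K[z - z\<^sup>2]\<close> forever:
  none of them vanishes, and their initial forms are multiples of powers of the initial form of \<open>z\<close>.
\<close>

lemma no_positive_value_in_degree_zero:
  assumes rule: "valid_rule scale v A grd \<rho>" and terminates: "subduction_terminates scale v A grd \<rho>"
    and z: "z \<noteq> 0" "z \<in> grd 0"
  shows "\<not> 0 < v z"
proof
  assume pos: "0 < v z"
  let ?g = "[:0, 1, -1:] :: 'k poly"
  define y where "y = peval z ?g"
  have y_eq: "y = z * (1 - z)" by (simp add: y_def algebra_simps)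
  have one_z: "1 - z - 1 \<in> F_gt v 0" using pos by (simp add: v_uminus F_gt_iff)
  \<comment> \<open>\<open>1 - z\<close> is congruent to 1 modulo positive values, and so are its
    powers; hence \<open>y ^ n\<close> and \<open>z ^ n\<close> have the same initial form for every
    \<open>n\<close>.\<close>
  have pw: "(1 - z) ^ n - 1 \<in> F_gt v 0" for n
  proof (induction n)
    case (Suc n)
    have "(1 - z) ^ n * (1 - z - 1) \<in> F_gt v (0 + 0)"
      using F_ge_add[OF F_gt_imp_F_ge[OF Suc], of 1] by (intro F_gt_mult(2) one_z) (simp add: F_ge_iff[of 1] v_one)
    then have "(1 - z) ^ n * (1 - z - 1) \<in> F_gt v 0" by simp
    from F_gt_add[OF this Suc] show ?case by (simp add: algebra_simps)
  qed simp
  have y_power: "y ^ n - z ^ n \<in> F_gt v (v (z ^ n))" for n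
  proof -
    have "z ^ n * ((1 - z) ^ n - 1) \<in> F_gt v (v (z ^ n) + 0)"
      by (rule F_gt_mult(2)[OF _ pw]) (simp add: F_ge_iff)
    moreover have "y ^ n - z ^ n = z ^ n * ((1 - z) ^ n - 1)"
      by (simp only: y_eq power_mult_distrib) (simp add: right_diff_distrib)
    ultimately show ?thesis by simp
  qed
  have y: "y \<noteq> 0" "v y = v z" using F_gt_close[of z y] y_power[of 1] z by simp_all
  have y_grd: "y \<in> grd 0" unfolding y_def by (rule peval_grd[OF z(2)])
  have input: "subduction_input A grd z {y}"
    using z y y_grd grd_subset by (auto simp: subduction_input_def homogeneous_def)
  interpret Y: homogeneous_family scale v A grd "\<lambda>g. g" "{y}"
    by unfold_locales (use input in \<open>auto simp: subduction_input_def\<close>)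
  obtain G' q r where run: "subduction scale v grd \<rho> z {y} = Some (G', q, r)"
    using terminates input unfolding subduction_terminates_def by (metis not_None_eq prod.exhaust)
  \<comment> \<open>Whatever polynomial in \<open>y\<close> the rule selects, subtracting it keeps
    the remainder in \<open>z + K[y]\<close>; so the argument applies to every valid rule.\<close>
  let ?P = "\<lambda>r. \<exists>q. r = peval z ([:0, 1:] - pcompose q ?g)"
  have "?P r \<and> r \<in> grd 0 \<and> \<not> subduction_continues scale v grd {y} r"
  proof (rule subduction_induct[OF rule input z(2) run])
    show "?P z" by (intro exI[of _ 0]) simp
    fix r and h :: "('b, 'k) mpoly" assume P: "?P r"
      and h: "\<And>t. t \<in> Poly_Mapping.keys h \<Longrightarrow> Poly_Mapping.keys t \<subseteq> {y} \<and> v r \<le> v (mon (\<lambda>g. g) t) \<and> mon (\<lambda>g. g) t \<in> grd 0"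
    have "\<exists>q. (\<Sum>t\<in>S. scale (Poly_Mapping.lookup h t) (mon (\<lambda>g. g) t)) = peval z (pcompose q ?g)"
      if "finite S" "S \<subseteq> Poly_Mapping.keys h" for S
      using that
    proof (induction S)
      case empty
      show ?case by (intro exI[of _ 0]) simp
    next
      case (insert t S)
      then obtain q where q: "(\<Sum>t\<in>S. scale (Poly_Mapping.lookup h t) (mon (\<lambda>g. g) t)) = peval z (pcompose q ?g)"
        by auto
      have "mon (\<lambda>g. g) t = (\<Prod>x\<in>{y}. x ^ Poly_Mapping.lookup t x)"
        unfolding mon_def using h[of t] insert.prems by (intro prod.mono_neutral_left) (auto simp: in_keys_iff)
      then have "mon (\<lambda>g. g) t = peval z (?g ^ Poly_Mapping.lookup t y)" by (simp only: peval_power y_def) simp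
      then have "scale (Poly_Mapping.lookup h t) (mon (\<lambda>g. g) t) =
          peval z (Polynomial.smult (Poly_Mapping.lookup h t) (?g ^ Poly_Mapping.lookup t y))"
        by (simp only: peval_smult)
      also have "Polynomial.smult (Poly_Mapping.lookup h t) (?g ^ Poly_Mapping.lookup t y) =
          pcompose (Polynomial.smult (Poly_Mapping.lookup h t) ([:0, 1:] ^ Poly_Mapping.lookup t y)) ?g"
        by (simp only: pcompose_smult pcompose_X_power)
      finally have e: "scale (Poly_Mapping.lookup h t) (mon (\<lambda>g. g) t) =
          peval z (pcompose (Polynomial.smult (Poly_Mapping.lookup h t) ([:0, 1:] ^ Poly_Mapping.lookup t y)) ?g)" .
      show ?case
        by (intro exI[of _ "Polynomial.smult (Poly_Mapping.lookup h t) ([:0, 1:] ^ Poly_Mapping.lookup t y) + q"])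
          (simp only: sum.insert[OF insert.hyps] e q pcompose_add peval_add)
    qed
    from this[of "Poly_Mapping.keys h"] obtain q' where q': "ev (\<lambda>g. g) h = peval z (pcompose q' ?g)"
      unfolding ev_eq by auto
    obtain q where "r = peval z ([:0, 1:] - pcompose q ?g)" using P by blast
    then have "r - ev (\<lambda>g. g) h = peval z ([:0, 1:] - pcompose (q + q') ?g)"
      unfolding q' peval_diff pcompose_add peval_add by simp
    then show "?P (r - ev (\<lambda>g. g) h)" by blast
  qed
  then obtain q where q: "r = peval z ([:0, 1:] - pcompose q ?g)" and r: "r \<in> grd 0"
    and stop: "\<not> subduction_continues scale v grd {y} r" by blast
  obtain n c where c: "c \<noteq> 0" and "r - scale c (z ^ n) \<in> F_gt v (v (z ^ n))"
    using peval_lowest_term[OF z(1) pos no_X_in_quadratic_subring] unfolding q by blast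
  then have rz: "r - scale c (z ^ n) \<in> F_gt v (v (scale c (z ^ n)))"
    using z by (simp add: v_scale)
  have rv: "r \<noteq> 0" "v r = v (z ^ n)" using F_gt_close[OF _ rz] z c by (simp_all add: v_scale)
  have "scale c (z ^ n) - scale c (y ^ n) \<in> F_gt v (v (z ^ n))"
    unfolding scale_right_diff_distrib[symmetric] by (intro F_gt_scale F_gt_diff_sym[OF y_power])
  then have ry: "r - scale c (y ^ n) \<in> F_gt v (v r)"
    using F_gt_diff_trans[OF rz] c z rv(2) by (simp add: v_scale)
  \<comment> \<open>The initial form of \<open>r\<close> is that of \<open>c\<close> times
    \<open>z ^ n\<close>, hence that of \<open>c\<close> times \<open>y ^ n\<close>. This one-term
    polynomial witnesses that it lies in the initial algebra of \<open>{y}\<close>, so the loop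
    would go on.\<close>
  let ?p = "Poly_Mapping.single (Poly_Mapping.single y n) c"
  have pc: "?p \<in> carrier (mpoly_ring {y})" by (rule mpoly_ring_single) simp
  have hy: "hdegree grd y = 0" by (rule hdegree_eq[OF y(1) y_grd])
  have vz: "(\<Sum>_<n. v z) = v (z ^ n)" using z by (induction n) (auto simp: v_one v_mult add.commute)
  have "Y.inev ?p = component (v r) 0 (ev (\<lambda>g. g) ?p)"
    by (rule Y.inev_bihomogeneous[OF pc]) (use y hy vz rv c in \<open>auto simp: monomial_degree_single\<close>)
  also have "\<dots> = component (v r) 0 r"
    unfolding ev_single mon_single by (rule component_cong[OF F_gt_diff_sym[OF ry]])
  also have "\<dots> = initial_form_hom scale v grd r"
    by (rule initial_form_hom_component[OF rv(1) r, symmetric])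
  finally have "initial_form_hom scale v grd r \<in> Y.inev ` carrier (mpoly_ring {y})"
    using pc by (metis image_eqI)
  also have "\<dots> = initial_algebra scale v grd {y}"
    using Y.initial_algebra_family by simp
  finally show False using stop rv(1) by (simp add: subduction_continues_def)
qed

end

section \<open>Initial ideals and Khovanskii bases\<close>

context homogeneous_family
begin

text \<open>Translates between the two kinds of variables. Distinct indices may carry the same
  element, so an index is chosen for each factor separately.\<close>

lemma monomial_in_generators:
  assumes "Poly_Mapping.keys t \<subseteq> \<sigma> ` V"
  shows "\<exists>t'. Poly_Mapping.keys t' \<subseteq> V \<and> mon (\<lambda>g. g) t = mon \<sigma> t'"
  using assms
proof (induction t rule: poly_mapping_nat_induct)
  case zero
  show ?case by (intro exI[of _ 0]) (simp add: mon_zero)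
next
  case (add g t)
  then obtain t' x where "Poly_Mapping.keys t' \<subseteq> V" "mon (\<lambda>g. g) t = mon \<sigma> t'" "x \<in> V" "g = \<sigma> x" by blast
  then show ?case
    by (intro exI[of _ "Poly_Mapping.single x 1 + t'"]) (simp add: mon_add mon_single keys_add_nat)
qed

lemma subduction_input_family: "a \<in> grd \<delta> \<Longrightarrow> subduction_input A grd a (\<sigma> ` V)"
  using family grd_subset by (auto simp: subduction_input_def homogeneous_def)

lemma initial_algebra_family_subset: "inev ` carrier (mpoly_ring V) \<subseteq> initial_algebra scale v grd A"
  unfolding initial_algebra_family[symmetric] initial_algebra_def generated_algebra_def
  using family by (intro Inter_anti_mono) blast

lemma remainder_zero_imp_inI:
  assumes rule: "valid_rule scale v A grd \<rho>" and h: "h \<in> kerJ"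
    and hom: "\<And>t. t \<in> Poly_Mapping.keys h \<Longrightarrow> weight t = \<gamma> \<and> deg t = \<delta>"
    and run: "subduction scale v grd \<rho> (ev \<sigma> h) (\<sigma> ` V) = Some (G', q, 0)"
  shows "h \<in> inI"
proof (cases "h = 0")
  case True
  interpret P: cring "mpoly_ring V :: ('x, 'k) mpoly ring" by (rule cring_mpoly_ring)
  show ?thesis using ideal_mpoly_ringD(2)[OF P.genideal_ideal[OF initial_polys_carrier]] True by simp
next
  case False
  interpret P: cring "mpoly_ring V :: ('x, 'k) mpoly ring" by (rule cring_mpoly_ring)
  have hc: "h \<in> carrier (mpoly_ring V)" using h by (simp add: mem_kerJ)
  have grd: "ev \<sigma> h \<in> grd \<delta>" by (rule ev_grd[OF hc]) (use hom in auto)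
  have "bipart \<gamma> \<delta> h = h" by (rule select_terms_eq_self) (use hom in auto)
  moreover have "ev \<sigma> (bipart \<gamma> \<delta> h) \<in> F_gt v \<gamma>" using h by (simp add: mem_kerJ)
  ultimately have gt: "ev \<sigma> h \<in> F_gt v \<gamma>" by simp
  \<comment> \<open>\<open>p\<close> collects the polynomials subtracted so far, rewritten in the
    variables of \<open>V\<close>.\<close>
  let ?P = "\<lambda>r. \<exists>p\<in>carrier (mpoly_ring V). (\<forall>t\<in>Poly_Mapping.keys p. \<gamma> < weight t) \<and> r = ev \<sigma> h - ev \<sigma> p"
  have "?P 0 \<and> 0 \<in> grd \<delta> \<and> \<not> subduction_continues scale v grd (\<sigma> ` V) 0"
  proof (rule subduction_induct[OF rule subduction_input_family[OF grd] grd run])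
    show "?P (ev \<sigma> h)" by (intro bexI[of _ 0]) (auto simp: ev_zero mpoly_ring_zero)
    fix r and h' :: "('b, 'k) mpoly"
    assume "?P r" and cont: "subduction_continues scale v grd (\<sigma> ` V) r"
      and h': "\<And>t. t \<in> Poly_Mapping.keys h' \<Longrightarrow>
        Poly_Mapping.keys t \<subseteq> \<sigma> ` V \<and> v r \<le> v (mon (\<lambda>g. g) t) \<and> mon (\<lambda>g. g) t \<in> grd \<delta>"
    then obtain p where p: "p \<in> carrier (mpoly_ring V)" "\<forall>t\<in>Poly_Mapping.keys p. \<gamma> < weight t" "r = ev \<sigma> h - ev \<sigma> p"
      by blast
    \<comment> \<open>Here membership of \<open>h\<close> in \<open>J\<close> enters: every non-zero
      remainder has value above \<open>\<gamma>\<close>, and by validity of the choice so has every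
      monomial subtracted from it.\<close>
    have "r \<in> F_gt v \<gamma>" unfolding p(3) using p(1,2) by (intro F_gt_diff gt ev_F_gt) auto
    then have vr: "\<gamma> < v r" using cont by (auto simp: F_gt_iff subduction_continues_def)
    have "\<exists>t'. Poly_Mapping.keys t' \<subseteq> V \<and> \<gamma> < weight t' \<and> mon (\<lambda>g. g) t = mon \<sigma> t'"
      if t: "t \<in> Poly_Mapping.keys h'" for t
    proof -
      obtain t' where "Poly_Mapping.keys t' \<subseteq> V" "mon (\<lambda>g. g) t = mon \<sigma> t'"
        using h'[OF t] monomial_in_generators by blast
      then show ?thesis using h'[OF t] vr mon_facts[of t'] by (intro exI[of _ t']) auto
    qed
    then obtain T where T: "\<And>t. t \<in> Poly_Mapping.keys h' \<Longrightarrow>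
        Poly_Mapping.keys (T t) \<subseteq> V \<and> \<gamma> < weight (T t) \<and> mon (\<lambda>g. g) t = mon \<sigma> (T t)"
      by metis
    let ?q = "\<Sum>t\<in>Poly_Mapping.keys h'. Poly_Mapping.single (T t) (Poly_Mapping.lookup h' t)"
    have "ev (\<lambda>g. g) h' = ev \<sigma> ?q"
      unfolding ev_sum ev_single by (subst ev_eq) (use T in auto)
    then have e1: "r - ev (\<lambda>g. g) h' = ev \<sigma> h - ev \<sigma> (p + ?q)" by (simp add: p(3) ev_add)
    have e2: "p + ?q \<in> carrier (mpoly_ring V)"
      using T by (intro mpoly_ring_closed(1) p(1) mpoly_ring_sum mpoly_ring_single) auto
    have e3: "\<gamma> < weight t" if "t \<in> Poly_Mapping.keys (p + ?q)" for t
    proof -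
      have "t \<in> Poly_Mapping.keys p \<or> t \<in> Poly_Mapping.keys ?q" using subsetD[OF keys_add that] by (rule UnE) auto
      then show ?thesis
      proof
        assume "t \<in> Poly_Mapping.keys ?q"
        then have "t \<in> (\<Union>s\<in>Poly_Mapping.keys h'. Poly_Mapping.keys (Poly_Mapping.single (T s) (Poly_Mapping.lookup h' s)))"
          by (rule subsetD[OF keys_sum])
        then show ?thesis using T by (auto split: if_splits)
      qed (use p(2) in blast)
    qed
    show "?P (r - ev (\<lambda>g. g) h')" by (intro bexI[OF _ e2] conjI ballI e3 e1)
  qed
  then obtain p where p: "p \<in> carrier (mpoly_ring V)" "\<forall>t\<in>Poly_Mapping.keys p. \<gamma> < weight t" "0 = ev \<sigma> h - ev \<sigma> p"
    by blast
  have "h - p \<in> kerI" using p hc by (simp add: mem_kerI ev_diff mpoly_ring_closed(2))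
  \<comment> \<open>All terms of \<open>h\<close> have weight \<open>\<gamma>\<close> and
    \<open>p\<close> has no term of that weight, so \<open>h\<close> survives intact as the lowest
    part of \<open>h - p\<close>.\<close>
  moreover have "initial_poly (\<lambda>x. v (\<sigma> x)) (h - p) = h"
  proof -
    obtain t0 where t0: "t0 \<in> Poly_Mapping.keys h" using False by (metis all_not_in_conv keys_eq_empty)
    have l: "Poly_Mapping.lookup (h - p) t = Poly_Mapping.lookup h t" if "weight t = \<gamma>" for t
    proof -
      have "t \<notin> Poly_Mapping.keys p" using p(2) that by blast
      then show ?thesis by (simp add: in_keys_iff lookup_minus)
    qed
    have "initial_poly (\<lambda>x. v (\<sigma> x)) (h - p) = select_terms (\<lambda>t. weight t = weight t0) (h - p)"
    proof (rule initial_poly_minimal_weight)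
      show "t0 \<in> Poly_Mapping.keys (h - p)" using t0 hom[OF t0] l[of t0] by (simp add: in_keys_iff)
      fix t assume "t \<in> Poly_Mapping.keys (h - p)"
      then have "t \<in> Poly_Mapping.keys h \<or> t \<in> Poly_Mapping.keys p" by (auto simp: in_keys_iff lookup_minus)
      then show "weight t0 \<le> weight t" using hom[OF t0] hom[of t] p(2) by auto
    qed
    also have "\<dots> = h"
    proof (rule poly_mapping_eqI)
      fix t
      show "Poly_Mapping.lookup (select_terms (\<lambda>t. weight t = weight t0) (h - p)) t = Poly_Mapping.lookup h t"
        using hom[OF t0] hom[of t] l[of t] by (auto simp: lookup_select_terms in_keys_iff)
    qed
    finally show ?thesis .
  qed
  ultimately show ?thesis using P.genideal_self[OF initial_polys_carrier] by force
qed

text \<open>The loop cannot stop at a non-zero remainder: its initial form lies in the initial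
  algebra of \<open>A\<close>, which by surjectivity is that of the generators.\<close>

lemma surjective_imp_remainder_zero:
  assumes rule: "valid_rule scale v A grd \<rho>" and terminates: "subduction_terminates scale v A grd \<rho>"
    and surj: "inev ` carrier (mpoly_ring V) = initial_algebra scale v grd A" and a: "a \<in> grd \<delta>"
  shows "\<exists>G' q. subduction scale v grd \<rho> a (\<sigma> ` V) = Some (G', q, 0)"
proof -
  note input = subduction_input_family[OF a]
  obtain G' q r where run: "subduction scale v grd \<rho> a (\<sigma> ` V) = Some (G', q, r)"
    using terminates input unfolding subduction_terminates_def by (metis not_None_eq prod.exhaust)
  have r: "True \<and> r \<in> grd \<delta> \<and> \<not> subduction_continues scale v grd (\<sigma> ` V) r"
    by (rule subduction_induct[OF rule input a run]) auto
  have "r = 0"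
  proof (rule ccontr)
    assume "r \<noteq> 0"
    then have "initial_form_hom scale v grd r \<in> {initial_form_hom scale v grd f | f. f \<in> A \<and> f \<noteq> 0 \<and> homogeneous grd f}"
      using r grd_subset by (auto simp: homogeneous_def)
    then have "initial_form_hom scale v grd r \<in> initial_algebra scale v grd A"
      unfolding initial_algebra_def by (rule subsetD[OF generated_algebra_incl])
    then show False using r \<open>r \<noteq> 0\<close> unfolding subduction_continues_def initial_algebra_family surj by blast
  qed
  then show ?thesis using run by blast
qed

text \<open>\<open>J\<close> contains the bihomogeneous parts of its elements, so subduction can be
  applied to each part and the results added up.\<close>

lemma surjective_imp_kerJ_subset_inI:
  assumes rule: "valid_rule scale v A grd \<rho>" and terminates: "subduction_terminates scale v A grd \<rho>"
    and surj: "inev ` carrier (mpoly_ring V) = initial_algebra scale v grd A"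
  shows "kerJ \<subseteq> inI"
proof
  interpret P: cring "mpoly_ring V :: ('x, 'k) mpoly ring" by (rule cring_mpoly_ring)
  fix p assume p: "p \<in> kerJ"
  have "bipart \<gamma> \<delta> p \<in> inI" for \<gamma> \<delta>
  proof -
    have J: "bipart \<gamma> \<delta> p \<in> kerJ" by (rule bipart_kerJ[OF p])
    then have "ev \<sigma> (bipart \<gamma> \<delta> p) \<in> grd \<delta>" by (intro ev_grd) (auto simp: mem_kerJ keys_select_terms)
    from surjective_imp_remainder_zero[OF rule terminates surj this] show ?thesis
      using remainder_zero_imp_inI[OF rule J, of \<gamma> \<delta>] by (auto simp: keys_select_terms)
  qed
  then have "(\<Sum>s\<in>(\<lambda>t. (weight t, deg t)) ` Poly_Mapping.keys p. select_terms (\<lambda>t. (weight t, deg t) = s) p) \<in> inI"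
    by (intro ideal_sum_mem[OF P.genideal_ideal[OF initial_polys_carrier]]) auto
  then show "p \<in> inI" by (simp add: sum_select_terms)
qed

text \<open>Oriented so that minimal elements have largest weight. Fixing the degree is essential:
  the quotient of the two monomials found by \<open>dickson\<close> then has degree 0, where
  positive values are excluded.\<close>

lemma wf_increasing_weights:
  assumes rule: "valid_rule scale v A grd \<rho>" and terminates: "subduction_terminates scale v A grd \<rho>"
    and V: "finite V"
  shows "wf {(s, t). Poly_Mapping.keys s \<subseteq> V \<and> Poly_Mapping.keys t \<subseteq> V \<and> deg s = deg t \<and> weight t < weight s}"
proof (subst wf_iff_no_infinite_down_chain, rule notI, elim exE)
  fix t :: "nat \<Rightarrow> 'x \<Rightarrow>\<^sub>0 nat"
  assume "\<forall>i. (t (Suc i), t i) \<in>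
    {(s, t). Poly_Mapping.keys s \<subseteq> V \<and> Poly_Mapping.keys t \<subseteq> V \<and> deg s = deg t \<and> weight t < weight s}"
  then have t: "\<And>i. Poly_Mapping.keys (t i) \<subseteq> V" "\<And>i. deg (t (Suc i)) = deg (t i)" "\<And>i. weight (t i) < weight (t (Suc i))"
    by auto
  obtain i j u where ij: "i < j" and u: "t j = t i + u" using dickson[OF V t(1)] by blast
  have "weight (t i) < weight (t j)" by (rule lift_Suc_mono_less[of "\<lambda>i. weight (t i)", OF t(3) ij])
  moreover have deg0: "deg (t m) = deg (t 0)" for m by (induction m) (auto simp: t(2))
  have "deg (t j) = deg (t i)" using deg0[of i] deg0[of j] by simp
  ultimately have "0 < weight u" "deg u = 0" by (simp_all add: u monomial_degree_add)
  moreover have "Poly_Mapping.keys u \<subseteq> V" using t(1)[of j] by (auto simp: u keys_add_nat)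
  ultimately show False
    using no_positive_value_in_degree_zero[OF rule terminates, of "mon \<sigma> u"] mon_facts[of u] by simp
qed

text \<open>If the lowest part of a representation \<open>h\<close> of \<open>a\<close> evaluated to
  something of larger value, it would lie in \<open>J\<close>, hence be the lowest part of a
  relation \<open>g\<close>, and \<open>h - g\<close> would represent \<open>a\<close> with larger
  lowest weight. So for an optimal \<open>h\<close> the lowest weight is \<open>v a\<close>, and
  \<open>\<beta>\<close> maps the lowest part to the initial form of \<open>a\<close>.\<close>

lemma kerJ_subset_inI_imp_surjective:
  assumes rule: "valid_rule scale v A grd \<rho>" and terminates: "subduction_terminates scale v A grd \<rho>"
    and V: "finite V" and gen: "A \<subseteq> ev \<sigma> ` carrier (mpoly_ring V)" and sub: "kerJ \<subseteq> inI"
  shows "inev ` carrier (mpoly_ring V) = initial_algebra scale v grd A"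
proof (rule equalityI[OF initial_algebra_family_subset])
  have main: "initial_form_hom scale v grd a \<in> inev ` carrier (mpoly_ring V)" if a: "a \<noteq> 0" "a \<in> grd \<delta>" for a \<delta>
  proof -
    \<comment> \<open>The optimum is sought among the lowest monomials of homogeneous
      representations, since \<open>wf_increasing_weights\<close> speaks of monomials and not of
      values in \<open>\<Gamma>\<close>.\<close>
    define X where "X = {t. \<exists>h\<in>carrier (mpoly_ring V). ev \<sigma> h = a \<and> (\<forall>s\<in>Poly_Mapping.keys h. deg s = \<delta>) \<and>
      t \<in> Poly_Mapping.keys h \<and> (\<forall>s\<in>Poly_Mapping.keys h. weight t \<le> weight s)}"
    have memX: "\<exists>t\<in>X. t \<in> Poly_Mapping.keys h" if "h \<in> carrier (mpoly_ring V)" "ev \<sigma> h = a" "\<forall>s\<in>Poly_Mapping.keys h. deg s = \<delta>" for h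
    proof -
      have "h \<noteq> 0" using that(2) a(1) by (auto simp: ev_zero)
      from obtain_minimal_weight[OF this] obtain t where "t \<in> Poly_Mapping.keys h"
        "\<And>s. s \<in> Poly_Mapping.keys h \<Longrightarrow> weight t \<le> weight s" by blast
      then show ?thesis using that unfolding X_def by blast
    qed
    have "a \<in> A" using a(2) grd_subset by blast
    then obtain h0 where h0: "h0 \<in> carrier (mpoly_ring V)" "ev \<sigma> h0 = a" using gen by blast
    have "ev \<sigma> (select_terms (\<lambda>t. deg t = \<delta>) h0) = a"
      using ev_degree_part[OF h0(1), of \<delta>] h0(2) a(2) by simp
    from memX[OF select_terms_mpoly_ring[OF h0(1)] this]
    obtain t0 where "t0 \<in> X" by (auto simp: keys_select_terms)
    let ?W = "{(s, t). Poly_Mapping.keys s \<subseteq> V \<and> Poly_Mapping.keys t \<subseteq> V \<and> deg s = deg t \<and> weight t < weight s}"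
    obtain t where tX: "t \<in> X" and max: "\<And>s. (s, t) \<in> ?W \<Longrightarrow> s \<notin> X"
    proof (rule wfE_min[OF wf_increasing_weights[OF rule terminates V] \<open>t0 \<in> X\<close>])
      fix z assume "z \<in> X" "\<And>y. (y, z) \<in> ?W \<Longrightarrow> y \<notin> X"
      then show thesis by (rule that)
    qed
    obtain h where h: "h \<in> carrier (mpoly_ring V)" "ev \<sigma> h = a" "\<forall>s\<in>Poly_Mapping.keys h. deg s = \<delta>"
      "t \<in> Poly_Mapping.keys h" "\<forall>s\<in>Poly_Mapping.keys h. weight t \<le> weight s"
      using tX unfolding X_def by blast
    define \<gamma> where "\<gamma> = weight t"
    let ?p = "bipart \<gamma> \<delta> h"
    have pc: "?p \<in> carrier (mpoly_ring V)" by (rule select_terms_mpoly_ring[OF h(1)])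
    have rest: "\<gamma> < weight s \<and> deg s = \<delta>" if "s \<in> Poly_Mapping.keys (h - ?p)" for s
    proof -
      have "s \<in> Poly_Mapping.keys h" "\<not> (weight s = \<gamma> \<and> deg s = \<delta>)"
        using that by (auto simp: in_keys_iff lookup_minus lookup_select_terms split: if_splits)
      then show ?thesis using h(3,5) by (auto simp: \<gamma>_def order.strict_iff_order)
    qed
    have "ev \<sigma> (h - ?p) \<in> F_gt v \<gamma>" using rest by (intro ev_F_gt mpoly_ring_closed(2) h(1) pc) auto
    then have diff: "a - ev \<sigma> ?p \<in> F_gt v \<gamma>" by (simp add: ev_diff h(2))
    have pk: "weight s = \<gamma> \<and> deg s = \<delta>" if "s \<in> Poly_Mapping.keys ?p" for s using that by (simp add: keys_select_terms)
    have inp: "inev ?p = component \<gamma> \<delta> (ev \<sigma> ?p)" by (rule inev_bihomogeneous[OF pc pk])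
    have "ev \<sigma> ?p \<notin> F_gt v \<gamma>"
    proof
      assume "ev \<sigma> ?p \<in> F_gt v \<gamma>"
      then have "?p \<in> kerJ" using pc by (simp add: a_kernel_def' inp component_eq_zero)
      then have "?p \<in> inI" using sub by blast
      from inI_lift[OF this, of \<gamma> \<delta>] obtain g where g: "g \<in> kerI"
        "\<forall>s\<in>Poly_Mapping.keys (g - bipart \<gamma> \<delta> ?p). \<gamma> < weight s \<and> deg s = \<delta>" by blast
      have "bipart \<gamma> \<delta> ?p = ?p" by (rule select_terms_eq_self[OF pk])
      with g have g2: "\<forall>s\<in>Poly_Mapping.keys (g - ?p). \<gamma> < weight s \<and> deg s = \<delta>" by simp
      have hg: "\<gamma> < weight s \<and> deg s = \<delta>" if "s \<in> Poly_Mapping.keys (h - g)" for s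
      proof -
        have "Poly_Mapping.lookup (h - g) s = Poly_Mapping.lookup (h - ?p) s - Poly_Mapping.lookup (g - ?p) s"
          by (simp add: lookup_minus)
        then have "s \<in> Poly_Mapping.keys (h - ?p) \<or> s \<in> Poly_Mapping.keys (g - ?p)"
          using that unfolding in_keys_iff by auto
        then show ?thesis using rest g2 by blast
      qed
      have hgc: "h - g \<in> carrier (mpoly_ring V)" using h(1) g(1) by (simp add: mem_kerI mpoly_ring_closed(2))
      have "ev \<sigma> (h - g) = a" using g(1) h(2) by (simp add: ev_diff mem_kerI)
      \<comment> \<open>A lowest monomial of \<open>h - g\<close> competes with \<open>t\<close> in
        the same degree and has larger weight, against the choice of \<open>t\<close>.\<close>
      then obtain s where s: "s \<in> X" "s \<in> Poly_Mapping.keys (h - g)" using memX[OF hgc] hg by blast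
      have "Poly_Mapping.keys s \<subseteq> V" "Poly_Mapping.keys t \<subseteq> V" using bspec[OF hgc[unfolded mem_mpoly_ring] s(2)] bspec[OF h(1)[unfolded mem_mpoly_ring] h(4)] by auto
      then show False using max[of s] s hg[OF s(2)] h(3,4) unfolding \<gamma>_def by simp
    qed
    then have "a \<notin> F_gt v \<gamma>" using diff F_gt_diff[of a \<gamma> "a - ev \<sigma> ?p"] by auto
    moreover have "a \<in> F_ge v \<gamma>"
      using ev_F_ge[OF h(1), of \<gamma>] h(2,5) by (auto simp: \<gamma>_def)
    ultimately have "v a = \<gamma>" by (auto simp: F_ge_iff F_gt_iff)
    then have "initial_form_hom scale v grd a = component \<gamma> \<delta> a"
      using initial_form_hom_component[OF a] by simp
    also have "\<dots> = inev ?p" unfolding inp by (rule component_cong[OF diff])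
    finally show ?thesis using pc by blast
  qed
  show "initial_algebra scale v grd A \<subseteq> inev ` carrier (mpoly_ring V)"
    unfolding initial_algebra_def
    by (rule generated_algebra_minimal[OF K_subalgebra_inev]) (use main in \<open>auto simp: homogeneous_def\<close>)
qed

end

text \<open>The part of \<open>p\<close> in the bidegree of its leading monomial lies in
  \<open>J\<close> and keeps that monomial as its maximum, since only other terms are dropped. So
  bihomogeneous elements realise all leading monomials of \<open>J\<close>, and the generators can
  be picked among them.\<close>

lemma bihomogeneous_finite_basis:
  fixes \<sigma> :: "'x::linorder \<Rightarrow> 'b::idom"
  assumes "homogeneous_family scale v A grd \<sigma> V" and V: "finite V"
  defines "J \<equiv> a_kernel (mpoly_ring V) (gr_tensor_algebra scale v)
    (mpoly_eval (gr_tensor_algebra scale v) (\<lambda>x. initial_form_hom scale v grd (\<sigma> x)))"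
  shows "\<exists>H. finite H \<and> H \<subseteq> J \<and> Idl\<^bsub>mpoly_ring V\<^esub> H = J \<and>
    (\<forall>h\<in>H. homogeneous_poly (\<lambda>x. v (\<sigma> x)) h \<and> homogeneous_poly (\<lambda>x. hdegree grd (\<sigma> x)) h)"
proof -
  interpret homogeneous_family scale v A grd \<sigma> V by fact
  let ?S = "{h \<in> J. homogeneous_poly (\<lambda>x. v (\<sigma> x)) h \<and> homogeneous_poly (\<lambda>x. hdegree grd (\<sigma> x)) h}"
  have "\<exists>H. finite H \<and> H \<subseteq> ?S \<and> Idl\<^bsub>mpoly_ring V\<^esub> H = J"
  proof (rule finite_basis_with_leading_monomials[OF V])
    show "ideal J (mpoly_ring V)" unfolding J_def by (rule ideal_kernel_inev)
    fix p assume p: "p \<in> J" "p \<noteq> 0"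
    define m where "m = Max (Poly_Mapping.keys p)"
    have m: "m \<in> Poly_Mapping.keys p" unfolding m_def using p(2) by (intro Max_in) auto
    let ?q = "bipart (weight m) (deg m) p"
    have mq: "m \<in> Poly_Mapping.keys ?q" using m by (simp add: keys_select_terms)
    have "Max (Poly_Mapping.keys ?q) = m"
      by (rule Max_eqI) (use mq in \<open>auto simp: keys_select_terms m_def\<close>)
    moreover have "?q \<in> ?S" using bipart_kerJ p(1) by (auto simp: J_def homogeneous_poly_def keys_select_terms)
    moreover have "?q \<noteq> 0" using mq by auto
    ultimately show "\<exists>q\<in>?S. q \<noteq> 0 \<and> Max (Poly_Mapping.keys q) = Max (Poly_Mapping.keys p)"
      unfolding m_def by blast
  qed auto
  then show ?thesis by blast
qed

theorem theorem2p21: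
  fixes scale :: "'k::field \<Rightarrow> 'b::idom \<Rightarrow> 'b"
    and v :: "'b \<Rightarrow> 'g::linordered_ab_group_add"
    and A :: "'b set"
    and grd :: "'d::ab_group_add \<Rightarrow> 'b set"
    and \<rho> :: "('b, 'k) subduction_rule"
    and k :: nat
    and f :: "nat \<Rightarrow> 'b"
    and \<alpha> :: "(nat, 'k) mpoly \<Rightarrow> 'b"
    and \<beta> :: "(nat, 'k) mpoly \<Rightarrow> ('g, 'b, 'd, 'k) gr_tensor"
    and P :: "(nat, 'k) mpoly ring"
    and I J in_I :: "(nat, 'k) mpoly set"
  assumes "K_algebra scale"
    and "fg_algebra (class_algebra scale) (UNIV :: 'b set)"
    and "fg_algebra (class_algebra scale) A"
    and "is_valuation scale v"
    and "fg_group TYPE('d)"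
    and "is_grading scale A grd"
    and "valid_rule scale v A grd \<rho>"
    and "subduction_terminates scale v A grd \<rho>"
    and "\<And>i. i \<in> {1..k} \<Longrightarrow> f i \<in> A \<and> f i \<noteq> 0 \<and> homogeneous grd (f i)"
    and "generated_algebra (class_algebra scale) (f ` {1..k}) = A"
    and P_def: "P = mpoly_ring {1..k}"
    and \<alpha>_def: "\<alpha> = mpoly_eval (class_algebra scale) f"
    and \<beta>_def: "\<beta> = mpoly_eval (gr_tensor_algebra scale v) (\<lambda>i. initial_form_hom scale v grd (f i))"
    and I_def: "I = a_kernel P (class_algebra scale) \<alpha>"
    and J_def: "J = a_kernel P (gr_tensor_algebra scale v) \<beta>"
    and in_I_def: "in_I = Idl\<^bsub>P\<^esub> {initial_poly (\<lambda>i. v (f i)) h | h. h \<in> I}"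
  shows "(\<beta> ` carrier P = initial_algebra scale v grd A \<longleftrightarrow>
            khovanskii_basis scale v grd A (f ` {1..k})) \<and>
         (\<beta> ` carrier P = initial_algebra scale v grd A \<longleftrightarrow> in_I = J) \<and>
         (\<beta> ` carrier P = initial_algebra scale v grd A \<longleftrightarrow>
            (\<exists>H. finite H \<and> H \<subseteq> carrier P \<and> Idl\<^bsub>P\<^esub> H = J \<and>
              (\<forall>h\<in>H. homogeneous_poly (\<lambda>i. v (f i)) h \<and>
                homogeneous_poly (\<lambda>i. hdegree grd (f i)) h \<and>
                (\<exists>G' q. subduction scale v grd \<rho> (\<alpha> h) (f ` {1..k}) = Some (G', q, 0)))))"
proof -
  let ?T = "gr_tensor_algebra scale v :: ('k, ('g, 'b, 'd, 'k) gr_tensor) module"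
  have A: "K_subalgebra (class_algebra scale) A" using assms(3) by (simp add: fg_algebra_def)
  interpret K_algebra scale by fact
  interpret F: homogeneous_family scale v A grd f "{1..k}"
    by unfold_locales (use assms(4,6,9) A in auto)
  interpret R: record_algebra "class_algebra scale" by (rule record_algebra_class_algebra)
  interpret Q: cring "mpoly_ring {1..k} :: (nat, 'k) mpoly ring" by (rule cring_mpoly_ring)
  note rule = assms(7) and terminates = assms(8)
  have gen: "A \<subseteq> F.ev f ` carrier (mpoly_ring {1..k})"
    using R.mpoly_eval_image[of "{1..k}" f] assms(10) by simp
  have img: "\<beta> ` carrier P = F.inev ` carrier (mpoly_ring {1..k})" by (simp add: \<beta>_def P_def)
  have J: "J = F.kerJ" by (simp add: J_def P_def \<beta>_def)
  have in_I: "in_I = F.inI" by (simp add: in_I_def I_def P_def \<alpha>_def)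
  have ideal_inI: "ideal in_I P"
    unfolding in_I P_def by (rule Q.genideal_ideal[OF F.initial_polys_carrier])
  have inI_subset: "in_I \<subseteq> J" unfolding in_I J by (rule F.inI_subset_kerJ)
  \<comment> \<open>One inclusion holds unconditionally, so both directions concern only
    \<open>J \<subseteq> in_I\<close>.\<close>
  have i_iff_ii: "\<beta> ` carrier P = initial_algebra scale v grd A \<longleftrightarrow> in_I = J"
    using inI_subset F.surjective_imp_kerJ_subset_inI[OF rule terminates]
      F.kerJ_subset_inI_imp_surjective[OF rule terminates _ gen]
    unfolding img in_I J by auto
  \<comment> \<open>The generators are non-zero, so removing 0 in the definition of a Khovanskii
    basis changes nothing; the image of \<open>\<beta>\<close> is the algebra generated by their
    initial forms.\<close>
  have khovanskii: "\<beta> ` carrier P = initial_algebra scale v grd A \<longleftrightarrow>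
      khovanskii_basis scale v grd A (f ` {1..k})"
  proof -
    have "f ` {1..k} - {0} = f ` {1..k}" using assms(9) by auto
    moreover have "f ` {1..k} \<subseteq> A" "\<forall>g\<in>f ` {1..k}. homogeneous grd g" using assms(9) by auto
    ultimately show ?thesis
      using assms(10) unfolding khovanskii_basis_def img F.inev_image by (simp add: image_image)
  qed
  have i_imp_iii: "\<exists>H. finite H \<and> H \<subseteq> carrier P \<and> Idl\<^bsub>P\<^esub> H = J \<and>
      (\<forall>h\<in>H. homogeneous_poly (\<lambda>i. v (f i)) h \<and> homogeneous_poly (\<lambda>i. hdegree grd (f i)) h \<and>
        (\<exists>G' q. subduction scale v grd \<rho> (\<alpha> h) (f ` {1..k}) = Some (G', q, 0)))"
    if surj: "\<beta> ` carrier P = initial_algebra scale v grd A"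
  proof -
    obtain H where H: "finite H" "H \<subseteq> J" "Idl\<^bsub>P\<^esub> H = J"
      "\<forall>h\<in>H. homogeneous_poly (\<lambda>i. v (f i)) h \<and> homogeneous_poly (\<lambda>i. hdegree grd (f i)) h"
      using bihomogeneous_finite_basis[OF F.homogeneous_family_axioms] unfolding J P_def by auto
    have HP: "H \<subseteq> carrier P" using H(2) by (auto simp: J_def a_kernel_def')
    have "\<exists>G' q. subduction scale v grd \<rho> (\<alpha> h) (f ` {1..k}) = Some (G', q, 0)" if h: "h \<in> H" for h
    proof -
      obtain \<delta> where "\<forall>t\<in>Poly_Mapping.keys h. F.deg t = \<delta>"
        using H(4) h unfolding homogeneous_poly_def by blast
      then have "\<alpha> h \<in> grd \<delta>"
        unfolding \<alpha>_def using HP h by (intro F.ev_grd) (auto simp: P_def)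
      then show ?thesis
        using F.surjective_imp_remainder_zero[OF rule terminates] surj unfolding img by blast
    qed
    then show ?thesis using H HP by blast
  qed
  \<comment> \<open>\<open>H\<close> is an arbitrary set as in (iii): its elements lie in
    \<open>in_I\<close>, hence so does the ideal \<open>J\<close> that they generate.\<close>
  have iii_imp_ii: "in_I = J"
    if "finite H" "H \<subseteq> carrier P" and HJ: "Idl\<^bsub>P\<^esub> H = J" and
      H: "\<forall>h\<in>H. homogeneous_poly (\<lambda>i. v (f i)) h \<and> homogeneous_poly (\<lambda>i. hdegree grd (f i)) h \<and>
        (\<exists>G' q. subduction scale v grd \<rho> (\<alpha> h) (f ` {1..k}) = Some (G', q, 0))" for H
  proof -
    have "h \<in> in_I" if h: "h \<in> H" for h
    proof -
      have "h \<in> J" using Q.genideal_self[of H] that \<open>H \<subseteq> carrier P\<close> HJ unfolding P_def by blast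
      then have hJ: "h \<in> F.kerJ" by (simp only: J)
      obtain \<gamma> \<delta> where hom: "\<And>t. t \<in> Poly_Mapping.keys h \<Longrightarrow> F.weight t = \<gamma> \<and> F.deg t = \<delta>"
        using H h unfolding homogeneous_poly_def by meson
      obtain G' q where run: "subduction scale v grd \<rho> (F.ev f h) (f ` {1..k}) = Some (G', q, 0)"
        using H h unfolding \<alpha>_def by blast
      show ?thesis unfolding in_I by (rule F.remainder_zero_imp_inI[OF rule hJ hom run])
    qed
    then have "Idl\<^bsub>P\<^esub> H \<subseteq> in_I"
      unfolding P_def by (intro Q.genideal_minimal ideal_inI[unfolded P_def]) auto
    then show ?thesis using HJ inI_subset by blast
  qed
  show ?thesis
    using khovanskii i_iff_ii i_imp_iii iii_imp_ii by blast
qed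

end
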